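(* Let $X$ be a (real or complex) Banach space which is an $M$-ideal in $X^{**}$ and let $k$ be a positive integer. If $P\in\mathcal{P}_I(^kX)$, then the Aron-Berner extension $\overline{P}$ is the unique norm preserving extension of $P$ to $\mathcal{P}_I(^kX^{**})$; that is, $\overline{P}$ is the unique $Q\in\mathcal{P}_I(^kX^{**})$ with $Q|_X=P$ and $\|Q\|_{\mathcal{P}_I(^kX^{**})}=\|P\|_{\mathcal{P}_I(^kX)}$.
   Context: A closed subspace $X$ of a Banach space $Y$ is an $M$-ideal in $Y$ if $Y^*=X^\perp\oplus_1X^\sharp$ ($\ell_1$-direct sum), with $X^\perp$ the annihilator of $X$ and $X^\sharp$ a closed subspace of $Y^*$; here $X\subset X^{**}$ canonically. A (scalar-valued, continuous) $k$-homogeneous polynomial $P$ on $X$ is integral if there is a regular Borel measure $\mu$ of bounded variation on $(B_{X^*},w^* )$ with $P(x)=\int_{B_{X^*}}\phi(x)^k\,d\mu(\phi)$ for all $x\in X$; the integral norm $\|P\|_{\mathcal{P}_I(^kX)}$ is the infimum of $|\mu|(B_{X^*})$ over all such $\mu$, and $\mathcal{P}_I(^kX)$ is the space of such polynomials with this norm. The Aron-Berner extension $\overline{P}\colon X^{**}\to\mathbb{K}$ of a continuous $k$-homogeneous polynomial $P$ with associated symmetric $k$-linear form $A$ is $\overline{P}(z)=\overline{A}(z,\dots,z)$, where $\overline{A}(z_1,\dots,z_k)=\lim_{i_1}\cdots\lim_{i_k}A(x_{i_1},\dots,x_{i_k})$ with $(x_{i_j})$ a net in $X$ converging weak* to $z_j\in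 X^{**}$. *)

theory Defs
  imports "HOL-Analysis.Analysis" "HOL-Library.Function_Algebras"
begin

section \<open>The scalar field\<close>

text \<open>
  A type of this class is isometrically isomorphic, as a field, to the reals or to the
  complex numbers.
\<close>

class real_or_complex = real_normed_field + euclidean_space +
  assumes isometric_real_or_complex:
    "\<exists>h :: 'a \<Rightarrow> complex.
       (\<forall>x y. h (x + y) = h x + h y) \<and> (\<forall>x y. h (x * y) = h x * h y) \<and>
       (\<forall>x. norm (h x) = norm x) \<and> (range h = \<real> \<or> range h = UNIV)"

instance real :: real_or_complex
  by standard (rule exI[of _ complex_of_real], auto simp: Reals_def)

instance complex :: real_or_complex
  by standard (rule exI[of _ id], auto)


section \<open>Normed spaces, duals and biduals\<close>

text \<open>
  Addition of vectors is that of the ambient type \<open>'v\<close> (pointwise when \<open>'v\<close> is a function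
  type); the remaining structure is carried explicitly, so that the real and complex cases and
  iterated duals are treated uniformly.
\<close>

record ('k, 'v) nspace =
  vecs :: "'v set"
  smul :: "'k \<Rightarrow> 'v \<Rightarrow> 'v"
  nrm :: "'v \<Rightarrow> real"

definition type_space :: "('k \<Rightarrow> 'v \<Rightarrow> 'v) \<Rightarrow> ('k, 'v::real_normed_vector) nspace" where
  "type_space sm = \<lparr>vecs = UNIV, smul = sm, nrm = norm\<rparr>"

definition unit_ball :: "('k, 'v) nspace \<Rightarrow> 'v set" where
  "unit_ball E = {x \<in> vecs E. nrm E x \<le> 1}"

definition linear_form :: "('k::real_or_complex, 'v::ab_group_add) nspace \<Rightarrow> ('v \<Rightarrow> 'k) \<Rightarrow> bool" where
  "linear_form E f \<longleftrightarrow>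
     (\<forall>x\<in>vecs E. \<forall>y\<in>vecs E. f (x + y) = f x + f y) \<and>
     (\<forall>c. \<forall>x\<in>vecs E. f (smul E c x) = c * f x)"

text \<open>
  Functions on a space are made unique by requiring the value 0 outside the carrier. Under this
  convention the weak* topology of the dual is the subspace topology of the product topology
  on \<open>'v \<Rightarrow> 'k\<close>, i.e. of the type's own topology.
\<close>

definition dual :: "('k::real_or_complex, 'v::ab_group_add) nspace \<Rightarrow> ('k, 'v \<Rightarrow> 'k) nspace" where
  "dual E =
     \<lparr>vecs = {f. linear_form E f \<and> (\<exists>C. \<forall>x\<in>vecs E. norm (f x) \<le> C * nrm E x) \<and>
                 (\<forall>x. x \<notin> vecs E \<longrightarrow> f x = 0)},
      smul = (\<lambda>c f x. c * f x),
      nrm = (\<lambda>f. SUP x\<in>unit_ball E. norm (f x))\<rparr>"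

abbreviation bidual :: "('k::real_or_complex, 'v::ab_group_add) nspace \<Rightarrow> ('k, ('v \<Rightarrow> 'k) \<Rightarrow> 'k) nspace"
  where "bidual E \<equiv> dual (dual E)"

definition canon :: "('k::real_or_complex, 'v::ab_group_add) nspace \<Rightarrow> 'v \<Rightarrow> ('v \<Rightarrow> 'k) \<Rightarrow> 'k" where
  "canon E x = (\<lambda>f. if f \<in> vecs (dual E) then f x else 0)"


section \<open>M-ideals\<close>

definition closed_subspace :: "('k::real_or_complex, 'v::ab_group_add) nspace \<Rightarrow> 'v set \<Rightarrow> bool" where
  "closed_subspace Y W \<longleftrightarrow>
     W \<subseteq> vecs Y \<and> module.subspace (smul Y) W \<and>
     (\<forall>x\<in>vecs Y. (\<forall>e>0. \<exists>w\<in>W. nrm Y (x - w) < e) \<longrightarrow> x \<in> W)"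

definition annihilator :: "('k::real_or_complex, 'v::ab_group_add) nspace \<Rightarrow> 'v set \<Rightarrow> ('v \<Rightarrow> 'k) set" where
  "annihilator Y U = {f \<in> vecs (dual Y). \<forall>x\<in>U. f x = 0}"

definition l1_direct_sum ::
    "('k::real_or_complex, 'v::ab_group_add) nspace \<Rightarrow> 'v set \<Rightarrow> 'v set \<Rightarrow> bool" where
  "l1_direct_sum E U W \<longleftrightarrow>
     vecs E = {u + w | u w. u \<in> U \<and> w \<in> W} \<and> U \<inter> W = {0} \<and>
     (\<forall>u\<in>U. \<forall>w\<in>W. nrm E (u + w) = nrm E u + nrm E w)"

definition M_ideal :: "('k::real_or_complex, 'v::ab_group_add) nspace \<Rightarrow> 'v set \<Rightarrow> bool" where
  "M_ideal Y U \<longleftrightarrow> closed_subspace Y U \<and>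
     (\<exists>W. closed_subspace (dual Y) W \<and> l1_direct_sum (dual Y) (annihilator Y U) W)"


section \<open>Scalar-valued measures\<close>

definition scalar_measure :: "'b measure \<Rightarrow> ('b set \<Rightarrow> 'k::real_or_complex) \<Rightarrow> bool" where
  "scalar_measure M \<mu> \<longleftrightarrow>
     (\<forall>A. range A \<subseteq> sets M \<and> disjoint_family A \<longrightarrow> (\<lambda>i::nat. \<mu> (A i)) sums \<mu> (\<Union>i. A i))"

definition variation :: "'b measure \<Rightarrow> ('b set \<Rightarrow> 'k::real_or_complex) \<Rightarrow> 'b set \<Rightarrow> ennreal" where
  "variation M \<mu> S =
     (SUP \<A>\<in>{\<A>. finite \<A> \<and> \<A> \<subseteq> sets M \<and> disjoint \<A> \<and> \<Union>\<A> = S}. \<Sum>A\<in>\<A>. ennreal (norm (\<mu> A)))"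

text \<open>
  The integral of a bounded function: the limit of the integrals of simple functions
  converging uniformly to it.
\<close>

definition has_scalar_integral ::
    "'b measure \<Rightarrow> ('b set \<Rightarrow> 'k::real_or_complex) \<Rightarrow> ('b \<Rightarrow> 'k) \<Rightarrow> 'k \<Rightarrow> bool" where
  "has_scalar_integral M \<mu> f I \<longleftrightarrow>
     (\<exists>s. (\<forall>n. simple_function M (s n)) \<and> uniform_limit (space M) s f sequentially \<and>
          (\<lambda>n. \<Sum>y\<in>s n ` space M. y * \<mu> (s n -` {y} \<inter> space M)) \<longlonglongrightarrow> I)"

definition regular_borel_bv :: "'b::topological_space set \<Rightarrow> ('b set \<Rightarrow> 'k::real_or_complex) \<Rightarrow> bool" where
  "regular_borel_bv B \<mu> \<longleftrightarrow>
     (let M = restrict_space borel B in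
        scalar_measure M \<mu> \<and> variation M \<mu> B < \<infinity> \<and>
        (\<forall>A\<in>sets M. \<forall>e>0. \<exists>K U. compact K \<and> openin (top_of_set B) U \<and> K \<subseteq> A \<and> A \<subseteq> U \<and>
           variation M \<mu> (U - K) < e))"


section \<open>Homogeneous and integral polynomials\<close>

text \<open>A \<open>k\<close>-linear form takes the list of its \<open>k\<close> arguments; other lists are irrelevant.\<close>

definition symmetric_form ::
    "('k::real_or_complex, 'v::ab_group_add) nspace \<Rightarrow> nat \<Rightarrow> ('v list \<Rightarrow> 'k) \<Rightarrow> bool" where
  "symmetric_form E k A \<longleftrightarrow>
     (\<forall>xs\<in>lists (vecs E). length xs = k \<longrightarrow>
        (\<forall>i<k. linear_form E (\<lambda>x. A (xs[i := x]))) \<and>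
        (\<forall>ys. mset ys = mset xs \<longrightarrow> A ys = A xs)) \<and>
     (\<exists>C. \<forall>xs\<in>lists (vecs E). length xs = k \<longrightarrow> norm (A xs) \<le> C * prod_list (map (nrm E) xs))"

definition associated_form ::
    "('k::real_or_complex, 'v::ab_group_add) nspace \<Rightarrow> nat \<Rightarrow> ('v \<Rightarrow> 'k) \<Rightarrow> ('v list \<Rightarrow> 'k) \<Rightarrow> bool" where
  "associated_form E k P A \<longleftrightarrow>
     symmetric_form E k A \<and> (\<forall>x\<in>vecs E. P x = A (replicate k x))"

definition homogeneous_polynomial ::
    "('k::real_or_complex, 'v::ab_group_add) nspace \<Rightarrow> nat \<Rightarrow> ('v \<Rightarrow> 'k) \<Rightarrow> bool" where
  "homogeneous_polynomial E k P \<longleftrightarrow>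
     (\<exists>A. associated_form E k P A) \<and> (\<forall>x. x \<notin> vecs E \<longrightarrow> P x = 0)"

definition representing_measures ::
    "('k::real_or_complex, 'v::ab_group_add) nspace \<Rightarrow> nat \<Rightarrow> ('v \<Rightarrow> 'k) \<Rightarrow> (('v \<Rightarrow> 'k) set \<Rightarrow> 'k) set" where
  "representing_measures E k P =
     {\<mu>. regular_borel_bv (unit_ball (dual E)) \<mu> \<and>
         (\<forall>x\<in>vecs E. has_scalar_integral (restrict_space borel (unit_ball (dual E))) \<mu>
            (\<lambda>\<phi>. \<phi> x ^ k) (P x))}"

definition integral_polynomials ::
    "('k::real_or_complex, 'v::ab_group_add) nspace \<Rightarrow> nat \<Rightarrow> ('v \<Rightarrow> 'k) set" where
  "integral_polynomials E k =
     {P. homogeneous_polynomial E k P \<and> representing_measures E k P \<noteq> {}}"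

definition integral_norm ::
    "('k::real_or_complex, 'v::ab_group_add) nspace \<Rightarrow> nat \<Rightarrow> ('v \<Rightarrow> 'k) \<Rightarrow> real" where
  "integral_norm E k P =
     (INF \<mu>\<in>representing_measures E k P.
        enn2real (variation (restrict_space borel (unit_ball (dual E))) \<mu> (unit_ball (dual E))))"


section \<open>The Aron-Berner extension\<close>

text \<open>
  Nets are represented by proper filters. The first filter in the list belongs to the outermost
  limit.
\<close>

fun iterated_limit :: "'v filter list \<Rightarrow> ('v list \<Rightarrow> 'k::topological_space) \<Rightarrow> 'k \<Rightarrow> bool" where
  "iterated_limit [] A l \<longleftrightarrow> l = A []"
| "iterated_limit (F # Fs) A l \<longleftrightarrow>
     (\<exists>h. (\<forall>\<^sub>F x in F. iterated_limit Fs (\<lambda>xs. A (x # xs)) (h x)) \<and> (h \<longlongrightarrow> l) F)"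

definition weak_star_net ::
    "('k::real_or_complex, 'v::ab_group_add) nspace \<Rightarrow> 'v filter \<Rightarrow> (('v \<Rightarrow> 'k) \<Rightarrow> 'k) \<Rightarrow> bool" where
  "weak_star_net E F z \<longleftrightarrow>
     F \<noteq> bot \<and> (\<forall>\<^sub>F x in F. x \<in> vecs E) \<and> (\<forall>f\<in>vecs (dual E). ((\<lambda>x. canon E x f) \<longlongrightarrow> z f) F)"

definition form_extension ::
    "('k::real_or_complex, 'v::ab_group_add) nspace \<Rightarrow> ('v list \<Rightarrow> 'k) \<Rightarrow> (('v \<Rightarrow> 'k) \<Rightarrow> 'k) list \<Rightarrow> 'k" where
  "form_extension E A zs = (THE l. \<exists>Fs. list_all2 (weak_star_net E) Fs zs \<and> iterated_limit Fs A l)"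

text \<open>
  By polarization the associated form is determined on \<open>k\<close>-tuples of vectors, hence the
  choice below does not matter.
\<close>

definition aron_berner ::
    "('k::real_or_complex, 'v::ab_group_add) nspace \<Rightarrow> nat \<Rightarrow> ('v \<Rightarrow> 'k) \<Rightarrow> (('v \<Rightarrow> 'k) \<Rightarrow> 'k) \<Rightarrow> 'k" where
  "aron_berner E k P =
     (\<lambda>z. if z \<in> vecs (bidual E)
          then form_extension E (SOME A. associated_form E k P A) (replicate k z) else 0)"

definition norm_preserving_extension ::
    "('k::real_or_complex, 'v::ab_group_add) nspace \<Rightarrow> nat \<Rightarrow> ('v \<Rightarrow> 'k) \<Rightarrow> ((('v \<Rightarrow> 'k) \<Rightarrow> 'k) \<Rightarrow> 'k) \<Rightarrow> bool" where
  "norm_preserving_extension E k P Q \<longleftrightarrow>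
     Q \<in> integral_polynomials (bidual E) k \<and>
     (\<forall>x\<in>vecs E. Q (canon E x) = P x) \<and>
     integral_norm (bidual E) k Q = integral_norm E k P"

end

theory Submission
  imports Defs
begin

text \<open>
  Write \<open>X\<close> for the space and \<open>j\<close> for the canonical embedding of its dual in its third dual.
  Everything rests on one consequence of the M-ideal property: a functional \<open>\<Phi>\<close> on the bidual
  satisfies \<open>\<parallel>\<Phi>\<parallel> \<ge> \<parallel>\<phi>\<parallel> + \<parallel>\<Phi> - j \<phi>\<parallel>\<close>, where \<open>\<phi>\<close> is its restriction to \<open>X\<close>
  (\<open>norm_restriction_add\<close>). A functional in the unit ball whose restriction has norm close to 1 is
  therefore close to a canonical one.

  The first use of this inequality is that regular measures on the dual ball with its weak*
  topology are tight for the norm (\<open>norm_tightness\<close>). Given countably many vectors, a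
  functional of least norm with prescribed values on them is a weak limit of functionals from a
  countable set, since a cluster point in the third dual has no room for a component that
  annihilates \<open>X\<close>; by Hahn-Banach the dual is separable over the given vectors
  (\<open>countable_uniform_approximation\<close>). A weak* compact set without norm-small relatively open
  parts would contain the branches of a dyadic tree, which are uncountably many and uniformly
  separated over countably many vectors; so there is no such set (\<open>fragmentability\<close>). Applied to
  the support of a measure this produces norm-small sets of positive mass, and these exhaust the
  measure.

  If a measure on the ball of the third dual is, up to a small mass, carried by small balls around
  finitely many canonical functionals, then the polynomial it represents is uniformly close to a
  finite sum of \<open>k\<close>-th powers of evaluations at functionals on \<open>X\<close>. For such a sum the iterated
  limits defining the Aron-Berner extension are evaluations. Hence the polynomial is close to
  the Aron-Berner extension of its restriction to \<open>X\<close> (\<open>aron_berner_near_representation\<close>).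

  Existence: by tightness \<open>j\<close> is weak* continuous on compact sets of almost full measure, so a
  measure representing the given polynomial has a regular image under \<open>j\<close>. This image is of the kind
  just described, hence represents the Aron-Berner extension, and it has no larger variation
  (\<open>aron_berner_representation\<close>). Conversely, restricting functionals to \<open>X\<close> carries a measure
  representing an extension to one that represents the given polynomial.

  Uniqueness: take a measure that represents a norm preserving extension and nearly attains its
  norm. Functionals whose restriction has norm at most \<open>1 - \<delta>\<close> can be stretched after
  restriction, at the gain of a factor \<open>(1 - \<delta>) ^ k\<close> in the mass, so they carry little of it
  (\<open>integral_norm_restriction_le\<close>). The others are close to canonical functionals, and tightness of
  the image on the dual ball puts the measure in the situation above. Letting the errors tend
  to zero identifies the extension with the Aron-Berner extension.
\<close>

section \<open>Normed spaces, duals and compactness of the dual ball\<close>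

text \<open>
  The dual balls are compact sets of functions. The Hausdorff property of the product topology
  makes their compact subsets closed, hence Borel.
\<close>

instance "fun" :: (type, t0_space) t0_space
proof
  fix f g :: "'a \<Rightarrow> 'b" assume "f \<noteq> g"
  then obtain x where "f x \<noteq> g x" by auto
  then obtain U where "open U" "(f x \<in> U) \<noteq> (g x \<in> U)"
    using separation_t0 by metis
  then show "\<exists>U. open U \<and> (f \<in> U) \<noteq> (g \<in> U)"
    using open_vimage[OF _ continuous_on_product_coordinates[of x]]
    by (intro exI[of _ "(\<lambda>f. f x) -` U"]) auto
qed

instance "fun" :: (type, t1_space) t1_space
proof
  fix f g :: "'a \<Rightarrow> 'b" assume "f \<noteq> g"
  then obtain x where "f x \<noteq> g x" by auto
  then obtain U where "open U" "f x \<in> U" "g x \<notin> U"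
    using separation_t1 by metis
  then show "\<exists>U. open U \<and> f \<in> U \<and> g \<notin> U"
    using open_vimage[OF _ continuous_on_product_coordinates[of x]]
    by (intro exI[of _ "(\<lambda>f. f x) -` U"]) auto
qed

instance "fun" :: (type, t2_space) t2_space
proof
  fix f g :: "'a \<Rightarrow> 'b" assume "f \<noteq> g"
  then obtain x where "f x \<noteq> g x" by auto
  then obtain U V where "open U" "open V" "f x \<in> U" "g x \<in> V" "U \<inter> V = {}"
    using hausdorff by metis
  then show "\<exists>U V. open U \<and> open V \<and> f \<in> U \<and> g \<in> V \<and> U \<inter> V = {}"
    using open_vimage[OF _ continuous_on_product_coordinates[of x]]
    by (intro exI[of _ "(\<lambda>f. f x) -` U"] exI[of _ "(\<lambda>f. f x) -` V"]) auto
qed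

locale normed_space =
  fixes E :: "('k::real_or_complex, 'v::ab_group_add) nspace"
  assumes zero_mem [simp]: "0 \<in> vecs E"
    and add_mem [simp]: "x \<in> vecs E \<Longrightarrow> y \<in> vecs E \<Longrightarrow> x + y \<in> vecs E"
    and smul_mem [simp]: "x \<in> vecs E \<Longrightarrow> smul E c x \<in> vecs E"
    and nrm_zero [simp]: "nrm E 0 = 0"
    and nrm_nonneg: "x \<in> vecs E \<Longrightarrow> 0 \<le> nrm E x"
    and nrm_smul: "x \<in> vecs E \<Longrightarrow> nrm E (smul E c x) = norm c * nrm E x"
    and nrm_add: "x \<in> vecs E \<Longrightarrow> y \<in> vecs E \<Longrightarrow> nrm E (x + y) \<le> nrm E x + nrm E y"

lemma linear_form_add:
  "linear_form E f \<Longrightarrow> x \<in> vecs E \<Longrightarrow> y \<in> vecs E \<Longrightarrow> f (x + y) = f x + f y"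
  by (simp add: linear_form_def)

lemma linear_form_smul:
  "linear_form E f \<Longrightarrow> x \<in> vecs E \<Longrightarrow> f (smul E c x) = c * f x"
  by (simp add: linear_form_def)

lemma dual_linear: "f \<in> vecs (dual E) \<Longrightarrow> linear_form E f"
  and dual_outside: "f \<in> vecs (dual E) \<Longrightarrow> x \<notin> vecs E \<Longrightarrow> f x = 0"
  by (simp_all add: dual_def)

lemmas dual_add = linear_form_add[OF dual_linear]
  and dual_smul = linear_form_smul[OF dual_linear]

lemma dualI:
  assumes "\<And>x y. x \<in> vecs E \<Longrightarrow> y \<in> vecs E \<Longrightarrow> f (x + y) = f x + f y"
    and "\<And>c x. x \<in> vecs E \<Longrightarrow> f (smul E c x) = c * f x"
    and "\<And>x. x \<in> vecs E \<Longrightarrow> norm (f x) \<le> C * nrm E x"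
    and "\<And>x. x \<notin> vecs E \<Longrightarrow> f x = 0"
  shows "f \<in> vecs (dual E)"
  using assms unfolding dual_def linear_form_def by simp blast

lemma smul_dual [simp]: "smul (dual E) c f = (\<lambda>x. c * f x)"
  by (simp add: dual_def)

context normed_space
begin

lemma linear_form_zero: "linear_form E f \<Longrightarrow> f 0 = 0"
  using linear_form_add[of E f 0 0] by simp

lemma zero_in_unit_ball: "0 \<in> unit_ball E"
  by (simp add: unit_ball_def)

lemma dual_bdd_above:
  assumes "f \<in> vecs (dual E)" shows "bdd_above ((\<lambda>x. norm (f x)) ` unit_ball E)"
proof -
  obtain C where C: "\<And>x. x \<in> vecs E \<Longrightarrow> norm (f x) \<le> C * nrm E x"
    using assms by (auto simp: dual_def)
  have "norm (f x) \<le> \<bar>C\<bar>" if "x \<in> unit_ball E" for x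
  proof -
    have x: "x \<in> vecs E" "nrm E x \<le> 1" using that by (auto simp: unit_ball_def)
    have "C * nrm E x \<le> \<bar>C\<bar> * 1"
      using x nrm_nonneg by (intro mult_mono) auto
    then show ?thesis using C[OF x(1)] by simp
  qed
  then show ?thesis by (auto intro!: bdd_aboveI2)
qed

lemma dual_le_nrm:
  assumes f: "f \<in> vecs (dual E)" and x: "x \<in> vecs E"
  shows "norm (f x) \<le> nrm (dual E) f * nrm E x"
proof (cases "nrm E x = 0")
  case True
  obtain C where C: "\<And>x. x \<in> vecs E \<Longrightarrow> norm (f x) \<le> C * nrm E x"
    using f by (auto simp: dual_def)
  show ?thesis using C[OF x] True by simp
next
  case False
  then have pos: "nrm E x > 0" using nrm_nonneg[OF x] by simp
  define y where "y = smul E (of_real (1 / nrm E x)) x"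
  have "y \<in> unit_ball E"
    using x pos by (simp add: unit_ball_def y_def nrm_smul norm_divide)
  then have "norm (f y) \<le> nrm (dual E) f"
    unfolding dual_def using dual_bdd_above[OF f] by (auto intro!: cSUP_upper)
  moreover have "norm (f y) = norm (f x) / nrm E x"
    using pos by (simp add: y_def dual_smul[OF f x] norm_mult norm_divide)
  ultimately show ?thesis using pos by (simp add: pos_divide_le_eq)
qed

lemma dual_nrm_leI:
  assumes "\<And>x. x \<in> vecs E \<Longrightarrow> norm (f x) \<le> C * nrm E x" and "C \<ge> 0"
  shows "nrm (dual E) f \<le> C"
proof -
  have "norm (f x) \<le> C" if "x \<in> unit_ball E" for x
    using assms(1)[of x] that mult_left_le[of "nrm E x" C] assms(2)
    by (auto simp: unit_ball_def)
  then show ?thesis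
    unfolding dual_def using zero_in_unit_ball by (auto intro!: cSUP_least)
qed

lemma dual_nrm_nonneg:
  assumes "f \<in> vecs (dual E)" shows "0 \<le> nrm (dual E) f"
proof -
  have "norm (f 0) \<le> nrm (dual E) f"
    unfolding dual_def using dual_bdd_above[OF assms] zero_in_unit_ball
    by (auto intro!: cSUP_upper)
  then show ?thesis using norm_ge_zero order_trans by blast
qed

lemma dual_le_of_nrm:
  assumes "f \<in> vecs (dual E)" "nrm (dual E) f \<le> C" "x \<in> vecs E"
  shows "norm (f x) \<le> C * nrm E x"
  using dual_le_nrm[OF assms(1,3)] mult_right_mono[OF assms(2) nrm_nonneg[OF assms(3)]] by simp

lemma dual_eq_zero:
  assumes "f \<in> vecs (dual E)" "nrm (dual E) f \<le> 0" shows "f = 0"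
proof
  fix x show "f x = 0 x"
    using dual_le_of_nrm[OF assms, of x] dual_outside[OF assms(1), of x] by (cases "x \<in> vecs E") auto
qed

lemma zero_mem_dual: "(0 :: 'v \<Rightarrow> 'k) \<in> vecs (dual E)"
  by (rule dualI[where C = 0]) auto

lemma add_mem_dual:
  assumes f: "f \<in> vecs (dual E)" and g: "g \<in> vecs (dual E)"
  shows "f + g \<in> vecs (dual E)"
proof (rule dualI[where C = "nrm (dual E) f + nrm (dual E) g"])
  fix x assume x: "x \<in> vecs E"
  show "norm ((f + g) x) \<le> (nrm (dual E) f + nrm (dual E) g) * nrm E x"
    using dual_le_nrm[OF f x] dual_le_nrm[OF g x] norm_triangle_ineq[of "f x" "g x"]
    by (simp add: algebra_simps)
qed (auto simp: dual_add[OF f] dual_add[OF g] dual_smul[OF f] dual_smul[OF g]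
       dual_outside[OF f] dual_outside[OF g] algebra_simps)

lemma smul_mem_dual:
  assumes f: "f \<in> vecs (dual E)"
  shows "(\<lambda>x. c * f x) \<in> vecs (dual E)"
proof (rule dualI[where C = "norm c * nrm (dual E) f"])
  fix x assume x: "x \<in> vecs E"
  show "norm (c * f x) \<le> norm c * nrm (dual E) f * nrm E x"
    using dual_le_nrm[OF f x] mult_left_mono[of _ _ "norm c"] by (simp add: norm_mult mult.assoc)
qed (auto simp: dual_add[OF f] dual_smul[OF f] dual_outside[OF f] algebra_simps)

lemma diff_mem_dual:
  assumes "f \<in> vecs (dual E)" "g \<in> vecs (dual E)"
  shows "f - g \<in> vecs (dual E)"
  using add_mem_dual[OF assms(1) smul_mem_dual[OF assms(2), of "-1"]]
  by (simp add: plus_fun_def fun_diff_def)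

lemma nrm_smul_dual_le:
  assumes f: "f \<in> vecs (dual E)"
  shows "nrm (dual E) (\<lambda>x. c * f x) \<le> norm c * nrm (dual E) f"
  using dual_le_nrm[OF f] dual_nrm_nonneg[OF f]
  by (intro dual_nrm_leI) (auto simp: norm_mult mult.assoc intro!: mult_left_mono)

lemma nrm_smul_dual:
  assumes f: "f \<in> vecs (dual E)"
  shows "nrm (dual E) (\<lambda>x. c * f x) = norm c * nrm (dual E) f"
proof (cases "c = 0")
  case True
  then show ?thesis using nrm_smul_dual_le[OF f, of 0] dual_nrm_nonneg[OF smul_mem_dual[OF f, of 0]] by simp
next
  case False
  have "nrm (dual E) f \<le> norm (inverse c) * nrm (dual E) (\<lambda>x. c * f x)"
    using nrm_smul_dual_le[OF smul_mem_dual[OF f, of c], of "inverse c"] False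
    by (simp flip: mult.assoc)
  then have "norm c * nrm (dual E) f \<le> norm c * (norm (inverse c) * nrm (dual E) (\<lambda>x. c * f x))"
    by (rule mult_left_mono) simp
  also have "\<dots> = nrm (dual E) (\<lambda>x. c * f x)"
    using False by (simp add: norm_inverse)
  finally show ?thesis using nrm_smul_dual_le[OF f, of c] by simp
qed

lemma nrm_add_dual:
  assumes f: "f \<in> vecs (dual E)" and g: "g \<in> vecs (dual E)"
  shows "nrm (dual E) (f + g) \<le> nrm (dual E) f + nrm (dual E) g"
proof (rule dual_nrm_leI)
  fix x assume x: "x \<in> vecs E"
  show "norm ((f + g) x) \<le> (nrm (dual E) f + nrm (dual E) g) * nrm E x"
    using dual_le_nrm[OF f x] dual_le_nrm[OF g x] norm_triangle_ineq[of "f x" "g x"]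
    by (simp add: algebra_simps)
qed (use dual_nrm_nonneg[OF f] dual_nrm_nonneg[OF g] in simp)

lemma normed_space_dual: "normed_space (dual E)"
proof
  show "nrm (dual E) 0 = 0"
    using dual_nrm_leI[of 0 0] dual_nrm_nonneg[OF zero_mem_dual] by auto
qed (auto simp: zero_mem_dual add_mem_dual smul_mem_dual nrm_smul_dual nrm_add_dual dual_nrm_nonneg)

lemma unit_ball_dual_iff:
  "f \<in> unit_ball (dual E) \<longleftrightarrow>
     (\<forall>x\<in>vecs E. \<forall>y\<in>vecs E. f (x + y) = f x + f y) \<and>
     (\<forall>c. \<forall>x\<in>vecs E. f (smul E c x) = c * f x) \<and>
     (\<forall>x\<in>vecs E. norm (f x) \<le> nrm E x) \<and> (\<forall>x. x \<notin> vecs E \<longrightarrow> f x = 0)" (is "?L \<longleftrightarrow> ?R")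
proof
  assume ?L
  then have f: "f \<in> vecs (dual E)" "nrm (dual E) f \<le> 1" by (auto simp: unit_ball_def)
  show ?R using dual_le_of_nrm[OF f] dual_add[OF f(1)] dual_smul[OF f(1)] dual_outside[OF f(1)] by auto
next
  assume R: ?R
  then have "f \<in> vecs (dual E)" by (intro dualI[where C = 1]) auto
  moreover have "nrm (dual E) f \<le> 1" using R by (intro dual_nrm_leI) auto
  ultimately show ?L by (simp add: unit_ball_def)
qed

lemma unit_ball_dual_le: "f \<in> unit_ball (dual E) \<Longrightarrow> x \<in> vecs E \<Longrightarrow> norm (f x) \<le> nrm E x"
  by (simp add: unit_ball_dual_iff)

lemma closed_norm_le_dual: "closed {g :: 'v \<Rightarrow> 'k. norm (g x - a) \<le> r}"
  by (intro closed_Collect_le continuous_intros continuous_on_product_coordinates)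

lemma closed_unit_ball_dual: "closed (unit_ball (dual E))"
proof -
  have "unit_ball (dual E) =
     (\<Inter>x\<in>vecs E. \<Inter>y\<in>vecs E. {f. f (x + y) = f x + f y}) \<inter>
     (\<Inter>c. \<Inter>x\<in>vecs E. {f. f (smul E c x) = c * f x}) \<inter>
     (\<Inter>x\<in>vecs E. {f. norm (f x) \<le> nrm E x}) \<inter> (\<Inter>x\<in>-vecs E. {f. f x = 0})"
    by (auto simp: unit_ball_dual_iff)
  also have "closed \<dots>"
    by (intro closed_Int closed_INT ballI closed_Collect_eq closed_Collect_le
        continuous_intros continuous_on_product_coordinates)
  finally show ?thesis .
qed

text \<open>
  The Banach-Alaoglu theorem: the weak* topology of the dual is that of pointwise convergence,
  and the dual ball is a closed part of a product of compact balls of scalars.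
\<close>

lemma compact_unit_ball_dual: "compact (unit_ball (dual E))"
proof -
  have "compact (PiE UNIV (\<lambda>x. cball (0::'k) \<bar>nrm E x\<bar>))"
    using compactin_PiE[where X = "\<lambda>_. euclidean :: 'k topology" and I = UNIV
        and S = "\<lambda>x. cball 0 \<bar>nrm E x\<bar>"]
    by (simp add: euclidean_product_topology)
  moreover have "unit_ball (dual E) \<subseteq> PiE UNIV (\<lambda>x. cball (0::'k) \<bar>nrm E x\<bar>)"
  proof (intro subsetI PiE_I)
    fix f x assume "f \<in> unit_ball (dual E)"
    then show "f x \<in> cball (0::'k) \<bar>nrm E x\<bar>"
      by (cases "x \<in> vecs E") (auto simp: unit_ball_dual_iff intro: order_trans)
  qed auto
  ultimately show ?thesis
    using closed_unit_ball_dual compact_Int_closed inf.absorb_iff2 by metis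
qed

lemma ball_dual_eq_INT:
  assumes f: "f \<in> unit_ball (dual E)" and "0 \<le> r"
  shows "{g \<in> unit_ball (dual E). nrm (dual E) (g - f) \<le> r} =
     unit_ball (dual E) \<inter> (\<Inter>x\<in>vecs E. {g. norm (g x - f x) \<le> r * nrm E x})"
proof -
  have "nrm (dual E) (g - f) \<le> r \<longleftrightarrow> (\<forall>x\<in>vecs E. norm (g x - f x) \<le> r * nrm E x)"
    if g: "g \<in> unit_ball (dual E)" for g
  proof
    have mem: "g - f \<in> vecs (dual E)" using f g by (auto simp: unit_ball_def diff_mem_dual)
    assume "nrm (dual E) (g - f) \<le> r"
    from dual_le_of_nrm[OF mem this] show "\<forall>x\<in>vecs E. norm (g x - f x) \<le> r * nrm E x" by simp
  next
    assume "\<forall>x\<in>vecs E. norm (g x - f x) \<le> r * nrm E x"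
    then show "nrm (dual E) (g - f) \<le> r" using \<open>0 \<le> r\<close> by (intro dual_nrm_leI) auto
  qed
  then show ?thesis by auto
qed

lemma closed_ball_dual:
  assumes "f \<in> unit_ball (dual E)" and "0 \<le> r"
  shows "closed {g \<in> unit_ball (dual E). nrm (dual E) (g - f) \<le> r}"
  unfolding ball_dual_eq_INT[OF assms]
  by (intro closed_Int closed_INT ballI closed_unit_ball_dual closed_norm_le_dual)

lemma canon_mem_bidual: "x \<in> vecs E \<Longrightarrow> canon E x \<in> vecs (bidual E)"
  by (rule dualI[where C = "nrm E x"])
    (use dual_le_nrm in \<open>auto simp: canon_def add_mem_dual smul_mem_dual mult.commute[of "nrm E x"]\<close>)

lemma canon_apply: "f \<in> vecs (dual E) \<Longrightarrow> canon E x f = f x"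
  by (simp add: canon_def)

lemma canon_add: "x \<in> vecs E \<Longrightarrow> y \<in> vecs E \<Longrightarrow> canon E (x + y) = canon E x + canon E y"
  by (auto simp: canon_def dual_add fun_eq_iff)

lemma canon_smul: "x \<in> vecs E \<Longrightarrow> canon E (smul E c x) = (\<lambda>f. c * canon E x f)"
  by (auto simp: canon_def dual_smul fun_eq_iff)

lemma nrm_canon_le:
  assumes "x \<in> vecs E" shows "nrm (bidual E) (canon E x) \<le> nrm E x"
proof -
  interpret D: normed_space "dual E" by (rule normed_space_dual)
  show ?thesis
    using dual_le_nrm[OF _ assms] nrm_nonneg[OF assms]
    by (intro D.dual_nrm_leI) (auto simp: canon_def mult.commute)
qed

end

lemma normed_space_type_space:
  fixes sm :: "'k::real_or_complex \<Rightarrow> 'a::real_normed_vector \<Rightarrow> 'a"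
  assumes "\<And>c x. norm (sm c x) = norm c * norm x"
  shows "normed_space (type_space sm)"
  by standard (auto simp: type_space_def assms norm_triangle_ineq)


section \<open>Separation from a closed subspace\<close>

definition sublinear_on :: "(real \<Rightarrow> 'b \<Rightarrow> 'b) \<Rightarrow> 'b::ab_group_add set \<Rightarrow> ('b \<Rightarrow> real) \<Rightarrow> bool" where
  "sublinear_on sc C q \<longleftrightarrow>
     (\<forall>x\<in>C. \<forall>y\<in>C. q (x + y) \<le> q x + q y) \<and> (\<forall>t>0. \<forall>x\<in>C. q (sc t x) = t * q x) \<and>
     (\<forall>x. x \<notin> C \<longrightarrow> q x = 0)"

lemma sublinear_onD:
  assumes "sublinear_on sc C q"
  shows "x \<in> C \<Longrightarrow> y \<in> C \<Longrightarrow> q (x + y) \<le> q x + q y"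
    and "0 < t \<Longrightarrow> x \<in> C \<Longrightarrow> q (sc t x) = t * q x"
    and "x \<notin> C \<Longrightarrow> q x = 0"
  using assms by (auto simp: sublinear_on_def)

locale real_subspace = module sc for sc :: "real \<Rightarrow> 'b::ab_group_add \<Rightarrow> 'b" +
  fixes C :: "'b set"
  assumes subspace_C: "subspace C"
begin

lemma C_0: "0 \<in> C" and C_add: "x \<in> C \<Longrightarrow> y \<in> C \<Longrightarrow> x + y \<in> C"
  and C_sc: "x \<in> C \<Longrightarrow> sc t x \<in> C" and C_neg: "x \<in> C \<Longrightarrow> - x \<in> C"
  using subspace_C by (auto simp: subspace_0 subspace_add subspace_scale subspace_neg)

lemma sublinear_zero:
  assumes "sublinear_on sc C q" shows "q 0 = 0"
  using sublinear_onD(2)[OF assms, of 2 0] C_0 by simp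

lemma sublinear_neg:
  assumes "sublinear_on sc C q" "x \<in> C" shows "- q (- x) \<le> q x"
  using sublinear_onD(1)[OF assms(1), of x "- x"] assms(2) C_neg sublinear_zero[OF assms(1)]
  by fastforce

text \<open>
  A sublinear functional can be pushed down in the direction of a given vector until it is
  linear on the line through it; this is the one-dimensional step of the Hahn-Banach theorem.
\<close>

lemma sublinear_push_down:
  assumes q: "sublinear_on sc C q" and x0: "x0 \<in> C"
  shows "\<exists>q'. sublinear_on sc C q' \<and> (\<forall>x. q' x \<le> q x) \<and> q' (- x0) \<le> - q x0"
proof -
  define a where "a f t = q (f + sc t x0) - t * q x0" for f t
  define q' where "q' f = (if f \<in> C then INF t\<in>{0..}. a f t else 0)" for f
  note add = sublinear_onD(1)[OF q] and hom = sublinear_onD(2)[OF q]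
  have lower: "- q (- f) \<le> a f t" if f: "f \<in> C" and "t \<ge> 0" for f t
  proof -
    have "q (sc t x0) = t * q x0"
      using hom[of t x0] x0 \<open>t \<ge> 0\<close> sublinear_zero[OF q] by (cases "t = 0") auto
    moreover have "q ((f + sc t x0) + (- f)) \<le> q (f + sc t x0) + q (- f)"
      using f x0 by (intro add) (auto intro: C_add C_sc C_neg)
    ultimately show ?thesis by (simp add: a_def algebra_simps)
  qed
  then have bdd: "bdd_below (a f ` {0..})" if "f \<in> C" for f
    using that by (intro bdd_belowI2[where m = "- q (- f)"]) auto
  have le_a: "q' f \<le> a f t" if "f \<in> C" "t \<ge> 0" for f t
    using that bdd by (auto simp: q'_def intro!: cINF_lower)
  have ge: "c \<le> q' f" if "f \<in> C" "\<And>t. t \<ge> 0 \<Longrightarrow> c \<le> a f t" for c f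
    using that by (auto simp: q'_def intro!: cINF_greatest)
  have sub: "q' (f + g) \<le> q' f + q' g" if f: "f \<in> C" and g: "g \<in> C" for f g
  proof -
    have *: "q' (f + g) \<le> a f s + a g t" if "s \<ge> 0" "t \<ge> 0" for s t
    proof -
      have "q ((f + sc s x0) + (g + sc t x0)) \<le> q (f + sc s x0) + q (g + sc t x0)"
        using f g x0 by (intro add) (auto intro: C_add C_sc)
      moreover have "(f + sc s x0) + (g + sc t x0) = (f + g) + sc (s + t) x0"
        by (simp add: scale_left_distrib algebra_simps)
      ultimately have "a (f + g) (s + t) \<le> a f s + a g t"
        by (simp add: a_def algebra_simps)
      then show ?thesis using le_a[of "f + g" "s + t"] f g that C_add by fastforce
    qed
    have "q' (f + g) - a f s \<le> q' g" if "s \<ge> 0" for s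
      using *[OF that] by (intro ge g) (simp add: algebra_simps)
    then have "q' (f + g) - q' g \<le> q' f"
      by (intro ge f) (simp add: algebra_simps)
    then show ?thesis by simp
  qed
  have hom_le: "q' (sc c f) \<le> c * q' f" if c: "c > 0" and f: "f \<in> C" for c f
  proof -
    have "q' (sc c f) / c \<le> a f t" if "t \<ge> 0" for t
    proof -
      have "q' (sc c f) \<le> a (sc c f) (c * t)" using that c f by (intro le_a C_sc) auto
      also have "sc c f + sc (c * t) x0 = sc c (f + sc t x0)"
        by (simp add: scale_right_distrib)
      then have "a (sc c f) (c * t) = c * a f t"
        unfolding a_def using hom[OF c, of "f + sc t x0"] f x0 C_add C_sc by (simp add: algebra_simps)
      finally show ?thesis using c by (simp add: field_simps)
    qed
    then have "q' (sc c f) / c \<le> q' f" by (intro ge f)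
    then show ?thesis using c by (simp add: field_simps)
  qed
  have "q' (sc c f) = c * q' f" if c: "c > 0" and f: "f \<in> C" for c f
  proof (rule antisym[OF hom_le[OF that]])
    have "q' (sc (1/c) (sc c f)) \<le> (1/c) * q' (sc c f)"
      using c f C_sc by (intro hom_le) auto
    then show "c * q' f \<le> q' (sc c f)" using c by (simp add: field_simps)
  qed
  with sub have "sublinear_on sc C q'" by (auto simp: sublinear_on_def q'_def)
  moreover have "q' x \<le> q x" for x
    using le_a[of x 0] sublinear_onD(3)[OF q, of x] by (cases "x \<in> C") (auto simp: a_def q'_def)
  moreover have "q' (- x0) \<le> - q x0"
    using le_a[of "- x0" 1] x0 C_neg sublinear_zero[OF q] by (simp add: a_def)
  ultimately show ?thesis by blast
qed

text \<open>
  By Zorn's lemma there is a minimal sublinear functional below a given one. Since it cannot be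
  pushed down any further, it is linear.
\<close>

lemma linear_below_sublinear:
  assumes q: "sublinear_on sc C q"
  obtains u where "\<And>x. u x \<le> q x" and "\<And>x y. x \<in> C \<Longrightarrow> y \<in> C \<Longrightarrow> u (x + y) = u x + u y"
    and "\<And>t x. x \<in> C \<Longrightarrow> u (sc t x) = t * u x"
proof -
  define A where "A = {a. sublinear_on sc C a \<and> (\<forall>x. a x \<le> q x)}"
  define R where "R a b \<longleftrightarrow> (\<forall>x. b x \<le> a x)" for a b :: "'b \<Rightarrow> real"
  have "\<exists>m\<in>A. \<forall>a\<in>A. R m a \<longrightarrow> a = m"
  proof (rule predicate_Zorn)
    show "partial_order_on A (relation_of R A)"
      by (auto simp: partial_order_on_def preorder_on_def refl_on_def trans_def antisym_def
          relation_of_def R_def intro: order_trans) (auto intro!: ext antisym)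
  next
    fix Ch assume Ch: "Ch \<in> Chains (relation_of R A)"
    then have ChA: "a \<in> A" if "a \<in> Ch" for a
      using that by (auto simp: Chains_def relation_of_def)
    have tot: "R a b \<or> R b a" if "a \<in> Ch" "b \<in> Ch" for a b
      using Ch that by (auto simp: Chains_def relation_of_def)
    show "\<exists>u\<in>A. \<forall>a\<in>Ch. R a u"
    proof (cases "Ch = {}")
      case True
      then show ?thesis using q by (auto simp: A_def)
    next
      case False
      define u where "u x = (INF a\<in>Ch. a x)" for x
      have lower: "- q (- x) \<le> a x" if "x \<in> C" "a \<in> Ch" for x a
        using sublinear_neg[of a x] ChA[OF that(2)] that(1) unfolding A_def
        by (smt (verit) mem_Collect_eq)
      have bdd: "bdd_below ((\<lambda>a. a x) ` Ch)" for x
      proof (cases "x \<in> C")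
        case True
        then show ?thesis using lower by (intro bdd_belowI2[where m = "- q (- x)"]) auto
      next
        case False
        then have "a x = 0" if "a \<in> Ch" for a
          using ChA[OF that] sublinear_onD(3)[of sc C a x] by (simp add: A_def)
        then show ?thesis by (intro bdd_belowI2[where m = 0]) (metis order_refl)
      qed
      have u_le: "u x \<le> a x" if "a \<in> Ch" for a x
        using that bdd by (auto simp: u_def intro!: cINF_lower)
      have u_ge: "c \<le> u x" if "\<And>a. a \<in> Ch \<Longrightarrow> c \<le> a x" for c x
        using that False by (auto simp: u_def intro!: cINF_greatest)
      have "u (x + y) \<le> u x + u y" if x: "x \<in> C" and y: "y \<in> C" for x y
      proof -
        have *: "u (x + y) \<le> a x + b y" if ab: "a \<in> Ch" "b \<in> Ch" for a b
        proof -
          obtain c where c: "c \<in> Ch" "\<And>x. c x \<le> a x" "\<And>x. c x \<le> b x"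
            using tot[OF ab] ab unfolding R_def by blast
          have "u (x + y) \<le> c (x + y)" by (rule u_le[OF c(1)])
          also have "\<dots> \<le> c x + c y"
            using ChA[OF c(1)] x y by (auto simp: A_def sublinear_on_def)
          also have "\<dots> \<le> a x + b y" using c by (simp add: add_mono)
          finally show ?thesis .
        qed
        have "u (x + y) - a x \<le> u y" if "a \<in> Ch" for a
          using *[OF that] by (intro u_ge) (simp add: algebra_simps)
        then have "u (x + y) - u y \<le> u x"
          by (intro u_ge) (simp add: algebra_simps)
        then show ?thesis by simp
      qed
      moreover have "u (sc t x) = t * u x" if t: "t > 0" and x: "x \<in> C" for t x
      proof (rule antisym)
        have hom: "a (sc t x) = t * a x" if "a \<in> Ch" for a
          using ChA[OF that] t x by (auto simp: A_def sublinear_on_def)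
        have "u (sc t x) / t \<le> u x"
        proof (rule u_ge)
          fix a assume a: "a \<in> Ch"
          show "u (sc t x) / t \<le> a x"
            using u_le[OF a, of "sc t x"] hom[OF a] t by (simp add: field_simps)
        qed
        then show "u (sc t x) \<le> t * u x" using t by (simp add: field_simps)
        show "t * u x \<le> u (sc t x)"
          using u_le t by (intro u_ge) (simp add: hom)
      qed
      moreover have "u x = 0" if "x \<notin> C" for x
      proof -
        have "a x = 0" if "a \<in> Ch" for a
          using ChA[OF that] \<open>x \<notin> C\<close> by (auto simp: A_def sublinear_on_def)
        then have "u x = (INF a\<in>Ch. 0)" unfolding u_def by (intro INF_cong) auto
        then show ?thesis using False by simp
      qed
      moreover obtain a0 where "a0 \<in> Ch" using False by auto
      then have "u x \<le> q x" for x
        using u_le[of a0 x] ChA[of a0] by (auto simp: A_def intro: order_trans)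
      ultimately have "u \<in> A" by (auto simp: A_def sublinear_on_def)
      then show ?thesis using u_le by (auto simp: R_def)
    qed
  qed
  then obtain m where m: "m \<in> A" and min: "\<And>a. a \<in> A \<Longrightarrow> (\<And>x. a x \<le> m x) \<Longrightarrow> a = m"
    by (auto simp: R_def)
  have m_sub: "sublinear_on sc C m" and m_le: "\<And>x. m x \<le> q x"
    using m by (auto simp: A_def)
  have neg: "m (- x) = - m x" if x: "x \<in> C" for x
  proof -
    obtain q' where q': "sublinear_on sc C q'" "\<And>x. q' x \<le> m x" "q' (- x) \<le> - m x"
      using sublinear_push_down[OF m_sub x] by blast
    have "q' \<in> A"
      unfolding A_def using q'(1,2) m_le order_trans by blast
    then have "q' = m" using q'(2) by (rule min)
    then show ?thesis using q'(3) sublinear_neg[OF m_sub x] by simp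
  qed
  have hom: "m (sc t x) = t * m x" if x: "x \<in> C" for t x
  proof -
    consider "t > 0" | "t = 0" | "- t > 0" by linarith
    then show ?thesis
    proof cases
      case 3
      have "m (sc (- t) x) = - t * m x" using sublinear_onD(2)[OF m_sub 3 x] .
      then show ?thesis using neg[OF C_sc[OF x, of t]] by (simp add: scale_minus_left)
    qed (use sublinear_onD(2)[OF m_sub] x sublinear_zero[OF m_sub] in auto)
  qed
  have "m (x + y) = m x + m y" if x: "x \<in> C" and y: "y \<in> C" for x y
  proof (rule antisym)
    show "m (x + y) \<le> m x + m y" using sublinear_onD(1)[OF m_sub x y] .
    have "m ((x + y) + (- y)) \<le> m (x + y) + m (- y)"
      using x y by (intro sublinear_onD(1)[OF m_sub]) (auto intro: C_add C_neg)
    then show "m x + m y \<le> m (x + y)" using neg[OF y] by simp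
  qed
  then show ?thesis using that[of m] m_le hom by blast
qed

text \<open>
  Pushing the sublinear functional down along \<open>x0\<close> first forces every linear functional below it
  to take at least the original value at \<open>x0\<close>.
\<close>

lemma linear_below_sublinear_at:
  assumes q: "sublinear_on sc C q" and x0: "x0 \<in> C"
  obtains u where "\<And>x. u x \<le> q x" and "\<And>x y. x \<in> C \<Longrightarrow> y \<in> C \<Longrightarrow> u (x + y) = u x + u y"
    and "\<And>t x. x \<in> C \<Longrightarrow> u (sc t x) = t * u x" and "q x0 \<le> u x0"
proof -
  obtain q' where q': "sublinear_on sc C q'" "\<And>x. q' x \<le> q x" "q' (- x0) \<le> - q x0"
    using sublinear_push_down[OF q x0] by blast
  obtain u where u: "\<And>x. u x \<le> q' x" "\<And>x y. x \<in> C \<Longrightarrow> y \<in> C \<Longrightarrow> u (x + y) = u x + u y"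
    "\<And>t x. x \<in> C \<Longrightarrow> u (sc t x) = t * u x"
    using linear_below_sublinear[OF q'(1)] by blast
  have "- u x0 \<le> - q x0"
    using u(3)[OF x0, of "-1"] u(1)[of "- x0"] q'(3) by (simp add: scale_minus_left)
  then show ?thesis
    using that[of u] u q'(2) order_trans by (metis neg_le_iff_le)
qed

end

lemma scalar_cases [case_names Real_scalars Complex_scalars]:
  assumes "(\<And>c::'k::real_or_complex. \<exists>r. c = of_real r) \<Longrightarrow> thesis"
    and "\<And>i::'k. i * i = -1 \<Longrightarrow> (\<And>c::'k. \<exists>a b. c = of_real a + of_real b * i) \<Longrightarrow> thesis"
  shows thesis
proof -
  obtain h :: "'k \<Rightarrow> complex" where add: "\<And>x y. h (x + y) = h x + h y"
    and mult: "\<And>x y. h (x * y) = h x * h y" and iso: "\<And>x. norm (h x) = norm x"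
    and range: "range h = \<real> \<or> range h = UNIV"
    using isometric_real_or_complex by blast
  interpret h: additive h by standard (rule add)
  have inj: "x = y" if "h x = h y" for x y
    using that iso[of "x - y"] h.diff[of x y] by simp
  have "norm (h 1) = 1" using iso[of 1] by simp
  then have h1: "h 1 = 1" using mult[of 1 1] by auto
  \<comment> \<open>A complex number is real if it is as far from 0 and from 1 as some real number.\<close>
  have hr: "h (of_real r) = of_real r" for r
  proof -
    define w where "w = h (of_real r)"
    have "norm w = \<bar>r\<bar>" "norm (w - 1) = \<bar>r - 1\<bar>"
      using iso[of "of_real r"] iso[of "of_real (r - 1)"] norm_of_real[of "r - 1", where 'a = 'k]
      by (simp_all add: w_def h.diff h1)
    then have "(Re w)\<^sup>2 + (Im w)\<^sup>2 = r\<^sup>2" "(Re w - 1)\<^sup>2 + (Im w)\<^sup>2 = (r - 1)\<^sup>2"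
      using cmod_power2[of w] cmod_power2[of "w - 1"] by simp_all
    then have "Re w = r" "Im w = 0" by (simp_all add: power2_eq_square algebra_simps)
    then show ?thesis unfolding w_def[symmetric] by (simp add: complex_eq_iff)
  qed
  from range show thesis
  proof
    assume R: "range h = \<real>"
    have "\<exists>r. c = of_real r" for c :: 'k
    proof -
      obtain r where "h c = of_real r" using R by (metis Reals_cases rangeI)
      then show ?thesis using inj[of c "of_real r"] hr by auto
    qed
    then show thesis by (rule assms(1))
  next
    assume R: "range h = UNIV"
    then obtain i where i: "h i = \<i>" by (metis surj_def)
    have "h (i * i) = h (- 1)" by (simp add: mult i h1 h.minus)
    then have "i * i = -1" by (rule inj)
    moreover have "\<exists>a b. c = of_real a + of_real b * i" for c :: 'k
    proof -
      have "h c = h (of_real (Re (h c)) + of_real (Im (h c)) * i)"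
        by (simp add: add mult hr i complex_eq_iff)
      then show ?thesis using inj by blast
    qed
    ultimately show thesis by (rule assms(2))
  qed
qed

context normed_space
begin

text \<open>
  A vector at positive distance from a subspace is detected by a continuous linear form that
  vanishes on the subspace: the distance is a sublinear functional, and a real linear functional
  below it is the real part of a scalar one.
\<close>

lemma separation_from_subspace:
  assumes "module (smul E)"
    and V: "V \<subseteq> vecs E" "0 \<in> V" "\<And>v w. v \<in> V \<Longrightarrow> w \<in> V \<Longrightarrow> v + w \<in> V"
      "\<And>c v. v \<in> V \<Longrightarrow> smul E c v \<in> V"
    and x0: "x0 \<in> vecs E" and "d > 0" and dist: "\<And>v. v \<in> V \<Longrightarrow> d \<le> nrm E (x0 - v)"
  obtains z where "z \<in> vecs (dual E)" "z x0 \<noteq> 0" "\<And>v. v \<in> V \<Longrightarrow> z v = 0"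
proof -
  interpret K: module "smul E" by fact
  define sc where "sc r x = smul E (of_real r) x" for r x
  interpret sc: real_subspace sc "vecs E"
  proof
    show "module.subspace sc (vecs E)"
      by (subst module.subspace_def)
        (unfold_locales, auto simp: sc_def K.scale_right_distrib K.scale_left_distrib)
  qed (auto simp: sc_def K.scale_right_distrib K.scale_left_distrib)
  have diff_mem: "x - y \<in> vecs E" if "x \<in> vecs E" "y \<in> vecs E" for x y
    using sc.C_add[OF that(1) sc.C_neg[OF that(2)]] by simp
  have V_neg: "- v \<in> V" if "v \<in> V" for v
    using V(4)[OF that, of "-1"] by (simp add: K.scale_minus_left)
  define p where "p x = (if x \<in> vecs E then INF v\<in>V. nrm E (x - v) else 0)" for x
  have bdd: "bdd_below ((\<lambda>v. nrm E (x - v)) ` V)" if "x \<in> vecs E" for x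
    using that V(1) diff_mem nrm_nonneg by (intro bdd_belowI2[where m = 0]) auto
  have p_le: "p x \<le> nrm E (x - v)" if "x \<in> vecs E" "v \<in> V" for x v
    using that bdd by (auto simp: p_def intro!: cINF_lower)
  have p_ge: "c \<le> p x" if "x \<in> vecs E" "\<And>v. v \<in> V \<Longrightarrow> c \<le> nrm E (x - v)" for c x
    using that V(2) by (auto simp: p_def intro!: cINF_greatest)
  have p_add: "p (x + y) \<le> p x + p y" if x: "x \<in> vecs E" and y: "y \<in> vecs E" for x y
  proof -
    have *: "p (x + y) \<le> nrm E (x - v) + nrm E (y - w)" if vw: "v \<in> V" "w \<in> V" for v w
    proof -
      have "p (x + y) \<le> nrm E ((x + y) - (v + w))" using x y V vw by (intro p_le) auto
      also have "(x + y) - (v + w) = (x - v) + (y - w)" by simp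
      also have "nrm E \<dots> \<le> nrm E (x - v) + nrm E (y - w)"
        using x y V(1) vw by (intro nrm_add diff_mem) auto
      finally show ?thesis .
    qed
    have "p (x + y) - nrm E (x - v) \<le> p y" if "v \<in> V" for v
      using *[OF that] by (intro p_ge y) (simp add: algebra_simps)
    then have "p (x + y) - p y \<le> p x" by (intro p_ge x) (simp add: algebra_simps)
    then show ?thesis by simp
  qed
  have p_hom_le: "p (sc t x) \<le> t * p x" if t: "t > 0" and x: "x \<in> vecs E" for t x
  proof -
    have "p (sc t x) / t \<le> nrm E (x - v)" if v: "v \<in> V" for v
    proof -
      have "p (sc t x) \<le> nrm E (sc t x - sc t v)"
        using x v V by (intro p_le) (auto simp: sc_def)
      also have "sc t x - sc t v = smul E (of_real t) (x - v)"
        by (simp add: sc_def K.scale_right_diff_distrib)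
      also have "nrm E \<dots> = t * nrm E (x - v)"
        using x v V(1) t by (subst nrm_smul) (auto intro: diff_mem)
      finally show ?thesis using t by (simp add: field_simps)
    qed
    then have "p (sc t x) / t \<le> p x" by (intro p_ge x)
    then show ?thesis using t by (simp add: field_simps)
  qed
  have "p (sc t x) = t * p x" if t: "t > 0" and x: "x \<in> vecs E" for t x
  proof (rule antisym[OF p_hom_le[OF that]])
    have "p (sc (1/t) (sc t x)) \<le> (1/t) * p (sc t x)"
      using t x by (intro p_hom_le) (auto simp: sc_def)
    then show "t * p x \<le> p (sc t x)" using t by (simp add: field_simps)
  qed
  then have "sublinear_on sc (vecs E) p"
    using p_add by (auto simp: sublinear_on_def p_def)
  then obtain u where u_le: "\<And>x. u x \<le> p x"
    and u_add: "\<And>x y. x \<in> vecs E \<Longrightarrow> y \<in> vecs E \<Longrightarrow> u (x + y) = u x + u y"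
    and u_sc: "\<And>t x. x \<in> vecs E \<Longrightarrow> u (sc t x) = t * u x" and "p x0 \<le> u x0"
    using sc.linear_below_sublinear_at[OF _ x0] by blast
  have u_x0: "u x0 > 0"
    using p_ge[OF x0 dist] \<open>d > 0\<close> \<open>p x0 \<le> u x0\<close> by simp
  have neg: "u (- x) = - u x" if "x \<in> vecs E" for x
    using u_sc[OF that, of "-1"] by (simp add: sc_def)
  have u_V: "u v = 0" if "v \<in> V" for v
  proof -
    have "u v \<le> 0" if "v \<in> V" for v
      using u_le[of v] p_le[of v v] that V(1) by auto
    from this[OF that] this[OF V_neg[OF that]] show ?thesis using neg[of v] V(1) that by auto
  qed
  have u_abs: "\<bar>u x\<bar> \<le> nrm E x" if x: "x \<in> vecs E" for x
  proof -
    have "u x \<le> nrm E x" if "x \<in> vecs E" for x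
      using u_le[of x] p_le[OF that V(2)] by simp
    from this[OF x] this[OF sc.C_neg[OF x]] show ?thesis
      using neg[OF x] nrm_smul[OF x, of "-1"] by simp
  qed
  show thesis
  proof (cases rule: scalar_cases[where 'k = 'k])
    case Real_scalars
    define z where "z x = (if x \<in> vecs E then of_real (u x) else 0 :: 'k)" for x
    have "z \<in> vecs (dual E)"
    proof (rule dualI[where C = 1])
      fix c :: 'k and x assume x: "x \<in> vecs E"
      obtain r where "c = of_real r" using Real_scalars by blast
      then show "z (smul E c x) = c * z x" using u_sc[OF x, of r] x by (simp add: z_def sc_def)
    qed (auto simp: z_def u_add u_abs)
    then show thesis using u_x0 x0 u_V by (intro that[of z]) (auto simp: z_def)
  next
    case (Complex_scalars i)
    define z where
      "z x = (if x \<in> vecs E then of_real (u x) - i * of_real (u (smul E i x)) else 0 :: 'k)" for x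
    have "(norm i)\<^sup>2 = 1" using norm_mult[of i i] Complex_scalars(1) by (simp add: power2_eq_square)
    then have norm_i: "norm i = 1" by (simp add: power2_eq_1_iff) (use norm_ge_zero[of i] in linarith)
    have z_add: "z (x + y) = z x + z y" if "x \<in> vecs E" "y \<in> vecs E" for x y
      using that by (simp add: z_def K.scale_right_distrib u_add algebra_simps)
    have z_real: "z (smul E (of_real r) x) = of_real r * z x" if "x \<in> vecs E" for r x
    proof -
      have "smul E i (smul E (of_real r) x) = sc r (smul E i x)"
        by (simp add: sc_def mult.commute)
      then show ?thesis
        using that u_sc[of x r] u_sc[of "smul E i x" r]
        by (simp add: z_def algebra_simps) (simp add: sc_def)
    qed
    have z_i: "z (smul E i x) = i * z x" if "x \<in> vecs E" for x
    proof -
      have "smul E i (smul E i x) = - x"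
        using Complex_scalars(1) by (simp add: K.scale_minus_left)
      then show ?thesis
        using that neg[OF that] Complex_scalars(1) by (simp add: z_def algebra_simps flip: mult.assoc)
    qed
    have "z \<in> vecs (dual E)"
    proof (rule dualI[where C = 2])
      fix c :: 'k and x assume x: "x \<in> vecs E"
      obtain a b where c: "c = of_real a + of_real b * i" using Complex_scalars(2) by blast
      have "z (smul E c x) = z (smul E (of_real a) x + smul E (of_real b) (smul E i x))"
        by (simp only: c K.scale_left_distrib K.scale_scale)
      also have "\<dots> = c * z x"
        using x by (simp del: K.scale_scale add: z_add z_real z_i c algebra_simps)
      finally show "z (smul E c x) = c * z x" .
    next
      fix x assume x: "x \<in> vecs E"
      have "norm (z x) \<le> \<bar>u x\<bar> + \<bar>u (smul E i x)\<bar>"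
        using norm_triangle_ineq4[of "of_real (u x) :: 'k" "i * of_real (u (smul E i x))"] x norm_i
        by (simp add: z_def norm_mult)
      also have "\<dots> \<le> 2 * nrm E x"
        using u_abs[OF x] u_abs[of "smul E i x"] x nrm_smul[OF x, of i] norm_i by simp
      finally show "norm (z x) \<le> 2 * nrm E x" .
    qed (auto simp: z_add, simp add: z_def)
    moreover have "z v = 0" if "v \<in> V" for v
      using that V(1,4) by (auto simp: z_def u_V)
    moreover have "z x0 \<noteq> 0"
    proof
      assume "z x0 = 0"
      then have "of_real (u x0) = i * of_real (u (smul E i x0))" using x0 by (simp add: z_def)
      then have "of_real (u x0) * of_real (u x0) =
          (i * i) * (of_real (u (smul E i x0)) * of_real (u (smul E i x0)))"
        by (simp add: algebra_simps)
      then have "of_real (u x0 * u x0 + u (smul E i x0) * u (smul E i x0)) = (0 :: 'k)"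
        using Complex_scalars(1) by simp
      then have "u x0 * u x0 + u (smul E i x0) * u (smul E i x0) = 0"
        using of_real_eq_0_iff by blast
      then show False using u_x0 by (simp add: add_nonneg_eq_0_iff)
    qed
    ultimately show thesis using that by blast
  qed
qed

end


section \<open>The variation of a scalar measure\<close>

lemma scalar_measure_sums:
  assumes "scalar_measure M \<mu>" "range A \<subseteq> sets M" "disjoint_family A"
  shows "(\<lambda>i::nat. \<mu> (A i)) sums \<mu> (\<Union>i. A i)"
  using assms by (auto simp: scalar_measure_def)

lemma scalar_measure_empty:
  assumes "scalar_measure M \<mu>" shows "\<mu> {} = 0"
proof -
  have "(\<lambda>i::nat. \<mu> {}) sums \<mu> (\<Union>i::nat. {})"
    by (rule scalar_measure_sums[OF assms]) (auto simp: disjoint_family_on_def)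
  then have "summable (\<lambda>i::nat. \<mu> {})" by (rule sums_summable)
  then show ?thesis by (simp add: summable_const_iff)
qed

lemma scalar_measure_Un:
  assumes "scalar_measure M \<mu>" "A \<in> sets M" "B \<in> sets M" "A \<inter> B = {}"
  shows "\<mu> (A \<union> B) = \<mu> A + \<mu> B"
proof -
  have "(\<lambda>i. \<mu> (binaryset A B i)) sums \<mu> (\<Union>i. binaryset A B i)"
    using assms by (intro scalar_measure_sums)
      (auto simp: range_binaryset_eq disjoint_family_on_def binaryset_def)
  moreover have "(\<lambda>i. \<mu> (binaryset A B i)) sums (\<mu> A + \<mu> B)"
    by (rule binaryset_sums) (rule scalar_measure_empty[OF assms(1)])
  ultimately show ?thesis by (simp add: UN_binaryset_eq sums_unique2)
qed

lemma scalar_measure_finite_UN: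
  assumes mu: "scalar_measure M \<mu>" and "finite I" "\<And>i. i \<in> I \<Longrightarrow> A i \<in> sets M"
    "disjoint_family_on A I"
  shows "\<mu> (\<Union>i\<in>I. A i) = (\<Sum>i\<in>I. \<mu> (A i))"
  using assms(2-)
proof (induction I rule: finite_induct)
  case empty
  then show ?case by (simp add: scalar_measure_empty[OF mu])
next
  case (insert i I)
  have "\<mu> (A i \<union> (\<Union>i\<in>I. A i)) = \<mu> (A i) + \<mu> (\<Union>i\<in>I. A i)"
    using insert.prems insert.hyps
    by (intro scalar_measure_Un[OF mu]) (auto simp: disjoint_family_on_def)
  then show ?case
    using insert by (simp add: disjoint_family_on_def)
qed

lemma variation_upper:
  assumes mu: "scalar_measure M \<mu>" and "finite I" "\<And>i. i \<in> I \<Longrightarrow> A i \<in> sets M"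
    and disj: "disjoint_family_on A I" and S: "(\<Union>i\<in>I. A i) = S"
  shows "(\<Sum>i\<in>I. ennreal (norm (\<mu> (A i)))) \<le> variation M \<mu> S"
proof -
  define J where "J = {i\<in>I. A i \<noteq> {}}"
  have inj: "inj_on A J"
    using disj by (auto simp: inj_on_def J_def disjoint_family_on_def)
  have "(\<Sum>i\<in>I. ennreal (norm (\<mu> (A i)))) = (\<Sum>i\<in>J. ennreal (norm (\<mu> (A i))))"
    using \<open>finite I\<close> scalar_measure_empty[OF mu] by (intro sum.mono_neutral_right) (auto simp: J_def)
  also have "\<dots> = (\<Sum>B\<in>A ` J. ennreal (norm (\<mu> B)))"
    by (simp add: sum.reindex[OF inj])
  also have "\<dots> \<le> variation M \<mu> S"
    unfolding variation_def
  proof (rule SUP_upper, intro CollectI conjI)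
    show "disjoint (A ` J)"
      by (intro disjoint_family_on_disjoint_image disjoint_family_on_mono[OF _ disj])
        (auto simp: J_def)
    show "\<Union> (A ` J) = S" using S by (auto simp: J_def)
  qed (use \<open>finite I\<close> assms(3) in \<open>auto simp: J_def\<close>)
  finally show ?thesis .
qed

lemma variation_least:
  assumes "\<And>\<A>. finite \<A> \<Longrightarrow> \<A> \<subseteq> sets M \<Longrightarrow> disjoint \<A> \<Longrightarrow> \<Union>\<A> = S \<Longrightarrow>
      (\<Sum>A\<in>\<A>. ennreal (norm (\<mu> A))) \<le> c"
  shows "variation M \<mu> S \<le> c"
  unfolding variation_def using assms by (intro SUP_least) auto

lemma norm_le_variation:
  assumes "scalar_measure M \<mu>" "A \<in> sets M"
  shows "ennreal (norm (\<mu> A)) \<le> variation M \<mu> A"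
  using variation_upper[OF assms(1), of "{A}" "\<lambda>A. A" A] assms(2)
  by (simp add: disjoint_family_on_def)

lemma variation_superadditive:
  assumes mu: "scalar_measure M \<mu>" and ST: "S \<in> sets M" "T \<in> sets M" "S \<inter> T = {}"
  shows "variation M \<mu> S + variation M \<mu> T \<le> variation M \<mu> (S \<union> T)"
proof -
  define \<P> where "\<P> S = {\<A>. finite \<A> \<and> \<A> \<subseteq> sets M \<and> disjoint \<A> \<and> \<Union>\<A> = S}" for S
  have ne: "\<P> S \<noteq> {}" "\<P> T \<noteq> {}"
  proof -
    have "{S} \<in> \<P> S" "{T} \<in> \<P> T" using ST by (simp_all add: \<P>_def)
    then show "\<P> S \<noteq> {}" "\<P> T \<noteq> {}" by blast+
  qed
  have "(\<Sum>A\<in>\<A>. ennreal (norm (\<mu> A))) + (\<Sum>A\<in>\<B>. ennreal (norm (\<mu> A))) \<le> variation M \<mu> (S \<union> T)"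
    if A: "\<A> \<in> \<P> S" and B: "\<B> \<in> \<P> T" for \<A> \<B>
  proof -
    have "\<mu> A = 0" if "A \<in> \<A> \<inter> \<B>" for A
    proof -
      have "A \<subseteq> S \<inter> T" using that A B by (auto simp: \<P>_def)
      then show ?thesis using ST(3) scalar_measure_empty[OF mu] by simp
    qed
    then have "(\<Sum>A\<in>\<A>. ennreal (norm (\<mu> A))) + (\<Sum>A\<in>\<B>. ennreal (norm (\<mu> A))) =
        (\<Sum>A\<in>\<A> \<union> \<B>. ennreal (norm (\<mu> A)))"
      using sum.union_inter[of \<A> \<B> "\<lambda>A. ennreal (norm (\<mu> A))"] A B by (simp add: \<P>_def)
    also have "\<dots> \<le> variation M \<mu> (S \<union> T)"
      unfolding variation_def
    proof (rule SUP_upper, intro CollectI conjI)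
      show "disjoint (\<A> \<union> \<B>)"
        using A B ST(3) by (intro disjoint_union) (auto simp: \<P>_def)
    qed (use A B in \<open>auto simp: \<P>_def\<close>)
    finally show ?thesis .
  qed
  then have "(SUP \<A>\<in>\<P> S. \<Sum>A\<in>\<A>. ennreal (norm (\<mu> A))) +
      (SUP \<B>\<in>\<P> T. \<Sum>A\<in>\<B>. ennreal (norm (\<mu> A))) \<le> variation M \<mu> (S \<union> T)"
    unfolding ennreal_SUP_add_left[OF ne(1), symmetric] ennreal_SUP_add_right[OF ne(2)]
    by (intro SUP_least) auto
  then show ?thesis by (simp add: variation_def \<P>_def)
qed

lemma variation_mono:
  assumes mu: "scalar_measure M \<mu>" and "S \<in> sets M" "T \<in> sets M" "S \<subseteq> T"
  shows "variation M \<mu> S \<le> variation M \<mu> T"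
proof -
  have "variation M \<mu> S + variation M \<mu> (T - S) \<le> variation M \<mu> (S \<union> (T - S))"
    using assms(2-) by (intro variation_superadditive[OF mu]) auto
  also have "S \<union> (T - S) = T" using assms(4) by auto
  finally show ?thesis by (rule order_trans[rotated]) simp
qed

lemma variation_empty:
  assumes "scalar_measure M \<mu>" shows "variation M \<mu> {} = 0"
proof -
  have "variation M \<mu> {} \<le> 0"
  proof (rule variation_least)
    fix \<A> :: "'a set set" assume "\<Union>\<A> = {}"
    then have "\<A> \<subseteq> {{}}" by auto
    then show "(\<Sum>A\<in>\<A>. ennreal (norm (\<mu> A))) \<le> 0"
      using scalar_measure_empty[OF assms] by (simp add: sum_nonneg_eq_0_iff subset_singleton_iff) auto
  qed
  then show ?thesis by simp
qed

lemma ennreal_norm_sums_le: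
  fixes f :: "nat \<Rightarrow> 'a::real_normed_vector"
  assumes "f sums s" shows "ennreal (norm s) \<le> (\<Sum>i. ennreal (norm (f i)))"
proof (rule tendsto_upperbound)
  show "(\<lambda>n. ennreal (norm (\<Sum>i<n. f i))) \<longlonglongrightarrow> ennreal (norm s)"
    using assms by (intro tendsto_ennrealI tendsto_norm) (simp add: sums_def)
  have "ennreal (norm (\<Sum>i<n. f i)) \<le> (\<Sum>i. ennreal (norm (f i)))" for n
  proof -
    have "ennreal (norm (\<Sum>i<n. f i)) \<le> ennreal (\<Sum>i<n. norm (f i))"
      by (intro ennreal_leI norm_sum)
    also have "\<dots> = (\<Sum>i<n. ennreal (norm (f i)))" by simp
    also have "\<dots> \<le> (\<Sum>i. ennreal (norm (f i)))" by (intro sum_le_suminf) auto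
    finally show ?thesis .
  qed
  then show "\<forall>\<^sub>F n in sequentially. ennreal (norm (\<Sum>i<n. f i)) \<le> (\<Sum>i. ennreal (norm (f i)))"
    by simp
qed simp

text \<open>
  Cutting the members of a partition along a sequence of disjoint sets does not decrease the sum
  of absolute values, by countable additivity; this is countable subadditivity of the variation.
\<close>

lemma countably_additive_variation:
  assumes mu: "scalar_measure M \<mu>"
  shows "countably_additive (sets M) (variation M \<mu>)"
proof (rule countably_additiveI)
  fix S :: "nat \<Rightarrow> 'a set"
  assume S: "range S \<subseteq> sets M" "disjoint_family S" "(\<Union>i. S i) \<in> sets M"
  show "(\<Sum>i. variation M \<mu> (S i)) = variation M \<mu> (\<Union>i. S i)"
  proof (rule antisym)
    have "(\<Sum>i<n. variation M \<mu> (S i)) \<le> variation M \<mu> (\<Union>i<n. S i)" for n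
    proof (induction n)
      case 0
      then show ?case by (simp add: variation_empty[OF mu])
    next
      case (Suc n)
      have "(\<Union>i<n. S i) \<inter> S n = {}"
        using disjoint_family_onD[OF S(2), of _ n] by force
      then have "variation M \<mu> (\<Union>i<n. S i) + variation M \<mu> (S n) \<le> variation M \<mu> ((\<Union>i<n. S i) \<union> S n)"
        using S(1) by (intro variation_superadditive[OF mu]) auto
      then show ?case using Suc
        by (simp add: lessThan_Suc Un_commute add.commute)
          (rule order_trans[OF add_left_mono])
    qed
    also have "variation M \<mu> (\<Union>i<n. S i) \<le> variation M \<mu> (\<Union>i. S i)" for n
      using S by (intro variation_mono[OF mu]) auto
    finally show "(\<Sum>i. variation M \<mu> (S i)) \<le> variation M \<mu> (\<Union>i. S i)"
      by (intro suminf_le_const) auto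
  next
    show "variation M \<mu> (\<Union>i. S i) \<le> (\<Sum>i. variation M \<mu> (S i))"
    proof (rule variation_least)
      fix \<A> assume A: "finite \<A>" "\<A> \<subseteq> sets M" "disjoint \<A>" "\<Union>\<A> = (\<Union>i. S i)"
      have "ennreal (norm (\<mu> A)) \<le> (\<Sum>i. ennreal (norm (\<mu> (A \<inter> S i))))" if "A \<in> \<A>" for A
      proof -
        have "(\<lambda>i. \<mu> (A \<inter> S i)) sums \<mu> (\<Union>i. A \<inter> S i)"
          using S that A(2) by (intro scalar_measure_sums[OF mu]) (auto simp: disjoint_family_on_def)
        moreover have "(\<Union>i. A \<inter> S i) = A" using that A(4) by auto
        ultimately show ?thesis by (intro ennreal_norm_sums_le) simp
      qed
      then have "(\<Sum>A\<in>\<A>. ennreal (norm (\<mu> A))) \<le> (\<Sum>A\<in>\<A>. \<Sum>i. ennreal (norm (\<mu> (A \<inter> S i))))"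
        by (rule sum_mono)
      also have "\<dots> = (\<Sum>i. \<Sum>A\<in>\<A>. ennreal (norm (\<mu> (A \<inter> S i))))"
        by (intro suminf_sum[symmetric]) simp
      also have "\<dots> \<le> (\<Sum>i. variation M \<mu> (S i))"
      proof (intro suminf_le allI summableI)
        fix i
        show "(\<Sum>A\<in>\<A>. ennreal (norm (\<mu> (A \<inter> S i)))) \<le> variation M \<mu> (S i)"
          using A S(1) by (intro variation_upper[OF mu])
            (auto simp: disjoint_family_on_def disjoint_def)
      qed
      finally show "(\<Sum>A\<in>\<A>. ennreal (norm (\<mu> A))) \<le> (\<Sum>i. variation M \<mu> (S i))" .
    qed
  qed
qed

definition variation_measure :: "'b measure \<Rightarrow> ('b set \<Rightarrow> 'k::real_or_complex) \<Rightarrow> 'b measure" where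
  "variation_measure M \<mu> = measure_of (space M) (sets M) (variation M \<mu>)"

lemma sets_variation_measure [simp, measurable_cong]:
  "sets (variation_measure M \<mu>) = sets M"
  and space_variation_measure [simp]: "space (variation_measure M \<mu>) = space M"
  by (simp_all add: variation_measure_def)

lemma emeasure_variation_measure:
  assumes "scalar_measure M \<mu>" "A \<in> sets M"
  shows "emeasure (variation_measure M \<mu>) A = variation M \<mu> A"
  unfolding variation_measure_def
  by (rule emeasure_measure_of_sigma)
    (auto simp: sets.sigma_algebra_axioms positive_def assms variation_empty countably_additive_variation)

locale bv_measure =
  fixes M :: "'b measure" and \<mu> :: "'b set \<Rightarrow> 'k::real_or_complex"
  assumes scalar_measure: "scalar_measure M \<mu>"
    and variation_finite: "variation M \<mu> (space M) < \<infinity>"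
begin

abbreviation m where "m \<equiv> variation_measure M \<mu>"

sublocale m: finite_measure m
  by standard (use variation_finite in \<open>simp add: emeasure_variation_measure[OF scalar_measure]\<close>)

lemma variation_eq: "A \<in> sets M \<Longrightarrow> variation M \<mu> A = ennreal (measure m A)"
  using emeasure_variation_measure[OF scalar_measure, of A] m.emeasure_eq_measure by simp

lemma norm_le_measure: "A \<in> sets M \<Longrightarrow> norm (\<mu> A) \<le> measure m A"
  using norm_le_variation[OF scalar_measure, of A] by (simp add: variation_eq)

end


section \<open>Integration of bounded functions against a scalar measure\<close>

definition simple_integral_wrt ::
    "'b measure \<Rightarrow> ('b set \<Rightarrow> 'k::real_or_complex) \<Rightarrow> ('b \<Rightarrow> 'k) \<Rightarrow> 'k" where
  "simple_integral_wrt M \<mu> s = (\<Sum>y\<in>s ` space M. y * \<mu> (s -` {y} \<inter> space M))"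

definition bounded_measurable :: "'b measure \<Rightarrow> ('b \<Rightarrow> 'k::real_or_complex) \<Rightarrow> bool" where
  "bounded_measurable M f \<longleftrightarrow> f \<in> borel_measurable M \<and> bounded (f ` space M)"

definition scalar_integral ::
    "'b measure \<Rightarrow> ('b set \<Rightarrow> 'k::real_or_complex) \<Rightarrow> ('b \<Rightarrow> 'k) \<Rightarrow> 'k" where
  "scalar_integral M \<mu> f = (THE I. has_scalar_integral M \<mu> f I)"

lemma bounded_measurableI:
  assumes "f \<in> borel_measurable M" "\<And>x. x \<in> space M \<Longrightarrow> norm (f x) \<le> C"
  shows "bounded_measurable M f"
  using assms by (auto simp: bounded_measurable_def intro!: boundedI)

lemma bounded_measurable_bound:
  assumes "bounded_measurable M f"
  obtains C where "\<And>x. x \<in> space M \<Longrightarrow> norm (f x) \<le> C"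
  using assms by (auto simp: bounded_measurable_def bounded_iff)

lemma bounded_measurable_add:
  assumes "bounded_measurable M f" "bounded_measurable M g"
  shows "bounded_measurable M (\<lambda>x. f x + g x)"
  using assms by (auto simp: bounded_measurable_def intro: bounded_plus_comp)

lemma bounded_measurable_cmult:
  assumes "bounded_measurable M f" shows "bounded_measurable M (\<lambda>x. c * f x)"
proof -
  obtain C where "\<And>x. x \<in> space M \<Longrightarrow> norm (f x) \<le> C"
    using bounded_measurable_bound[OF assms] by blast
  then show ?thesis using assms
    by (intro bounded_measurableI[where C = "norm c * C"])
      (auto simp: bounded_measurable_def norm_mult intro!: mult_left_mono)
qed

lemma bounded_measurable_simple:
  "simple_function M s \<Longrightarrow> bounded_measurable M s"
  by (auto simp: bounded_measurable_def borel_measurable_simple_function simple_function_def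
      intro: finite_imp_bounded)

text \<open>
  A bounded set of scalars has finite nets of any fineness; sending each point to the first
  point of the net close to its value gives a simple function.
\<close>

lemma simple_function_approximation:
  fixes f :: "'b \<Rightarrow> 'k::real_or_complex"
  assumes f: "bounded_measurable M f" and "e > 0"
  obtains s where "simple_function M s" "\<And>x. x \<in> space M \<Longrightarrow> norm (s x - f x) < e"
proof -
  have [measurable]: "f \<in> borel_measurable M" using f by (simp add: bounded_measurable_def)
  have "compact (closure (f ` space M))"
    using f by (simp add: bounded_measurable_def compact_closure)
  then obtain T where "finite T" "closure (f ` space M) \<subseteq> (\<Union>c\<in>T. ball c e)"
    using \<open>e > 0\<close> unfolding compact_eq_totally_bounded by blast
  moreover obtain cs where "set cs = T" using finite_list[OF \<open>finite T\<close>] by blast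
  ultimately have cs: "\<exists>c\<in>set cs. norm (c - f x) < e" if "x \<in> space M" for x
    using closure_subset[of "f ` space M"] that unfolding subset_iff ball_def dist_norm by blast
  define idx where "idx x = (LEAST j. j < length cs \<and> norm (cs ! j - f x) < e)" for x
  have idx: "idx x < length cs \<and> norm (cs ! idx x - f x) < e" if "x \<in> space M" for x
    unfolding idx_def by (rule LeastI_ex) (use cs[OF that] in \<open>auto simp: in_set_conv_nth\<close>)
  have "idx \<in> measurable M (count_space UNIV)"
    unfolding idx_def by measurable
  moreover have "finite (idx ` space M)"
    by (rule finite_subset[of _ "{..<length cs}"]) (use idx in blast, simp)
  ultimately have "simple_function M idx"
    by (simp add: simple_function_def measurable_sets[where A = "count_space UNIV"])
  then have "simple_function M (\<lambda>x. cs ! idx x)"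
    by (rule simple_function_compose1)
  then show thesis using that idx by blast
qed

context bv_measure
begin

lemma measure_sets_simple:
  "simple_function M u \<Longrightarrow> u -` A \<inter> space M \<in> sets M"
  by (rule simple_functionD)

text \<open>
  A simple integral can be computed along any finite-valued map through which the integrand
  factors. For pairs of simple functions this is additivity.
\<close>

lemma simple_integral_compose:
  assumes u: "simple_function M u"
  shows "simple_integral_wrt M \<mu> (\<lambda>x. F (u x)) =
    (\<Sum>c\<in>u ` space M. F c * \<mu> (u -` {c} \<inter> space M))"
proof -
  have fin: "finite (u ` space M)" using u by (rule simple_functionD)
  have "\<mu> ((\<lambda>x. F (u x)) -` {y} \<inter> space M) =
      (\<Sum>c\<in>{c \<in> u ` space M. F c = y}. \<mu> (u -` {c} \<inter> space M))" for y
  proof -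
    have "(\<lambda>x. F (u x)) -` {y} \<inter> space M =
        (\<Union>c\<in>{c \<in> u ` space M. F c = y}. u -` {c} \<inter> space M)" by auto
    also have "\<mu> \<dots> = (\<Sum>c\<in>{c \<in> u ` space M. F c = y}. \<mu> (u -` {c} \<inter> space M))"
      using fin by (intro scalar_measure_finite_UN[OF scalar_measure] measure_sets_simple[OF u])
        (auto simp: disjoint_family_on_def)
    finally show ?thesis .
  qed
  then have "simple_integral_wrt M \<mu> (\<lambda>x. F (u x)) =
      (\<Sum>y\<in>F ` (u ` space M). \<Sum>c\<in>{c \<in> u ` space M. F c = y}. F c * \<mu> (u -` {c} \<inter> space M))"
    by (auto simp: simple_integral_wrt_def image_image sum_distrib_left intro!: sum.cong)
  then show ?thesis
    using sum.image_gen[OF fin, of "\<lambda>c. F c * \<mu> (u -` {c} \<inter> space M)" F] by simp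
qed

lemma simple_integral_add:
  assumes "simple_function M s" "simple_function M t"
  shows "simple_integral_wrt M \<mu> (\<lambda>x. s x + t x) =
    simple_integral_wrt M \<mu> s + simple_integral_wrt M \<mu> t"
proof -
  have u: "simple_function M (\<lambda>x. (s x, t x))" using assms by (rule simple_function_Pair)
  show ?thesis
    using simple_integral_compose[OF u, of "\<lambda>(a, b). a + b"] simple_integral_compose[OF u, of fst]
      simple_integral_compose[OF u, of snd]
    by (simp add: case_prod_beta distrib_right sum.distrib)
qed

lemma simple_integral_cmult:
  assumes "simple_function M s"
  shows "simple_integral_wrt M \<mu> (\<lambda>x. c * s x) = c * simple_integral_wrt M \<mu> s"
  using simple_integral_compose[OF assms, of "\<lambda>y. c * y"] simple_integral_compose[OF assms, of "\<lambda>y. y"]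
  by (simp add: sum_distrib_left mult.assoc)

lemma integrable_norm_bounded:
  assumes "bounded_measurable M f" shows "integrable m (\<lambda>x. norm (f x))"
proof -
  obtain C where "\<And>x. x \<in> space M \<Longrightarrow> norm (f x) \<le> C"
    using bounded_measurable_bound[OF assms] by blast
  moreover have "(\<lambda>x. norm (f x)) \<in> borel_measurable m"
  proof -
    have "f \<in> borel_measurable m"
      using assms by (simp add: bounded_measurable_def measurable_cong_sets[of m M borel borel])
    then show ?thesis by measurable
  qed
  ultimately show ?thesis by (intro m.integrable_const_bound[where B = C]) auto
qed

lemma norm_simple_integral_le:
  assumes s: "simple_function M s"
  shows "norm (simple_integral_wrt M \<mu> s) \<le> (\<integral>x. norm (s x) \<partial>m)"
proof -
  have fin: "finite (s ` space M)" using s by (rule simple_functionD)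
  have "norm (simple_integral_wrt M \<mu> s) \<le>
      (\<Sum>y\<in>s ` space M. norm y * measure m (s -` {y} \<inter> space M))"
    unfolding simple_integral_wrt_def
    by (intro order_trans[OF norm_sum] sum_mono)
      (auto simp: norm_mult intro!: mult_left_mono norm_le_measure measure_sets_simple[OF s])
  also have "\<dots> = (\<integral>x. (\<Sum>y\<in>s ` space M. norm y * indicator (s -` {y} \<inter> space M) x) \<partial>m)"
    using measure_sets_simple[OF s] m.emeasure_finite
    by (subst Bochner_Integration.integral_sum)
      (auto intro!: integrable_mult_right integrable_real_indicator simp: m.emeasure_finite less_top[symmetric])
  also have "\<dots> = (\<integral>x. norm (s x) \<partial>m)"
  proof (rule Bochner_Integration.integral_cong[OF refl])
    fix x assume x: "x \<in> space m"
    have "(\<Sum>y\<in>s ` space M. norm y * indicator (s -` {y} \<inter> space M) x) =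
        (\<Sum>y\<in>s ` space M. if y = s x then norm y else 0)"
      using x by (intro sum.cong) (auto simp: indicator_def)
    then show "(\<Sum>y\<in>s ` space M. norm y * indicator (s -` {y} \<inter> space M) x) = norm (s x)"
      using x fin by simp
  qed
  finally show ?thesis .
qed

lemma has_scalar_integral_iff:
  "has_scalar_integral M \<mu> f I \<longleftrightarrow>
     (\<exists>s. (\<forall>n. simple_function M (s n)) \<and> uniform_limit (space M) s f sequentially \<and>
          (\<lambda>n. simple_integral_wrt M \<mu> (s n)) \<longlonglongrightarrow> I)"
  by (simp add: has_scalar_integral_def simple_integral_wrt_def)

lemma bounded_measurable_uniform_limit:
  assumes s: "\<And>n. simple_function M (s n)" and lim: "uniform_limit (space M) s f sequentially"
  shows "bounded_measurable M f"
proof -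
  have "f \<in> borel_measurable M"
  proof (rule borel_measurable_LIMSEQ_metric)
    show "s n \<in> borel_measurable M" for n using s by (rule borel_measurable_simple_function)
    show "(\<lambda>n. s n x) \<longlonglongrightarrow> f x" if "x \<in> space M" for x
      using tendsto_uniform_limitI[OF lim that] .
  qed
  obtain n where n: "\<And>x. x \<in> space M \<Longrightarrow> dist (s n x) (f x) < 1"
    using uniform_limitD[OF lim, of 1] by (auto simp: eventually_sequentially)
  obtain C where C: "\<And>x. x \<in> space M \<Longrightarrow> norm (s n x) \<le> C"
    using bounded_measurable_bound[OF bounded_measurable_simple[OF s[of n]]] by blast
  have "norm (f x) \<le> C + 1" if "x \<in> space M" for x
    using n[OF that] C[OF that] norm_triangle_ineq2[of "f x" "s n x"] by (simp add: dist_norm norm_minus_commute)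
  then show ?thesis using \<open>f \<in> borel_measurable M\<close> by (intro bounded_measurableI) auto
qed

lemma has_scalar_integral_bounded_measurable:
  "has_scalar_integral M \<mu> f I \<Longrightarrow> bounded_measurable M f"
  by (auto simp: has_scalar_integral_iff intro: bounded_measurable_uniform_limit)

lemma has_scalar_integral_add:
  assumes "has_scalar_integral M \<mu> f I" "has_scalar_integral M \<mu> g J"
  shows "has_scalar_integral M \<mu> (\<lambda>x. f x + g x) (I + J)"
proof -
  from assms obtain s t where "\<And>n. simple_function M (s n)" "\<And>n. simple_function M (t n)"
    and "uniform_limit (space M) s f sequentially" "uniform_limit (space M) t g sequentially"
    and "(\<lambda>n. simple_integral_wrt M \<mu> (s n)) \<longlonglongrightarrow> I" "(\<lambda>n. simple_integral_wrt M \<mu> (t n)) \<longlonglongrightarrow> J"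
    by (auto simp: has_scalar_integral_iff)
  then show ?thesis
    unfolding has_scalar_integral_iff
    by (intro exI[of _ "\<lambda>n x. s n x + t n x"])
      (auto simp: simple_integral_add intro: simple_function_add uniform_limit_add tendsto_add)
qed

lemma has_scalar_integral_cmult:
  assumes "has_scalar_integral M \<mu> f I"
  shows "has_scalar_integral M \<mu> (\<lambda>x. c * f x) (c * I)"
proof -
  from assms obtain s where "\<And>n. simple_function M (s n)"
    and "uniform_limit (space M) s f sequentially"
    and "(\<lambda>n. simple_integral_wrt M \<mu> (s n)) \<longlonglongrightarrow> I"
    by (auto simp: has_scalar_integral_iff)
  then show ?thesis
    unfolding has_scalar_integral_iff
    by (intro exI[of _ "\<lambda>n x. c * s n x"])
      (auto simp: simple_integral_cmult intro: simple_function_compose1 tendsto_mult_left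
        bounded_linear.uniform_limit[OF bounded_linear_mult_right])
qed

lemma has_scalar_integral_simple:
  "simple_function M s \<Longrightarrow> has_scalar_integral M \<mu> s (simple_integral_wrt M \<mu> s)"
  unfolding has_scalar_integral_iff
  by (intro exI[of _ "\<lambda>_. s"]) (simp add: uniform_limit_iff)

lemma small_multiple_of_mass:
  assumes "e > 0"
  obtains \<delta> where "\<delta> > 0" "\<delta> * measure m (space m) < e"
proof
  have pos: "measure m (space m) + 1 > 0" using measure_nonneg[of m "space m"] by linarith
  show d: "e / (measure m (space m) + 1) > 0" using assms pos by simp
  have "e / (measure m (space m) + 1) * (measure m (space m) + 1) = e" using pos by simp
  then show "e / (measure m (space m) + 1) * measure m (space m) < e"
    using d unfolding distrib_left by linarith
qed

text \<open>
  This estimate reduces the quantitative study of scalar integrals to Bochner integrals against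
  the variation measure.
\<close>

lemma has_scalar_integral_norm_le:
  assumes "has_scalar_integral M \<mu> f I"
  shows "norm I \<le> (\<integral>x. norm (f x) \<partial>m)"
proof (rule field_le_epsilon)
  fix e :: real assume "e > 0"
  obtain \<delta> where d: "\<delta> > 0" "\<delta> * measure m (space m) < e"
    using small_multiple_of_mass[OF \<open>e > 0\<close>] .
  from assms obtain s where s: "\<And>n. simple_function M (s n)"
    and lim: "uniform_limit (space M) s f sequentially"
    and I: "(\<lambda>n. simple_integral_wrt M \<mu> (s n)) \<longlonglongrightarrow> I"
    by (auto simp: has_scalar_integral_iff)
  have f: "bounded_measurable M f" by (rule bounded_measurable_uniform_limit[OF s lim])
  have "\<forall>\<^sub>F n in sequentially. norm (simple_integral_wrt M \<mu> (s n)) \<le> (\<integral>x. norm (f x) \<partial>m) + e"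
    using uniform_limitD[OF lim d(1)]
  proof eventually_elim
    case (elim n)
    have "norm (simple_integral_wrt M \<mu> (s n)) \<le> (\<integral>x. norm (s n x) \<partial>m)"
      by (rule norm_simple_integral_le[OF s])
    also have "\<dots> \<le> (\<integral>x. norm (f x) + \<delta> \<partial>m)"
    proof (rule integral_mono)
      show "norm (s n x) \<le> norm (f x) + \<delta>" if "x \<in> space m" for x
        using elim that norm_triangle_ineq2[of "s n x" "f x"] by (auto simp: dist_norm)
    qed (auto intro!: Bochner_Integration.integrable_add integrable_norm_bounded bounded_measurable_simple s f)
    also have "\<dots> = (\<integral>x. norm (f x) \<partial>m) + \<delta> * measure m (space m)"
      using integrable_norm_bounded[OF f] by simp
    finally show ?case using d(2) by simp
  qed
  then show "norm I \<le> (\<integral>x. norm (f x) \<partial>m) + e"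
    using tendsto_norm[OF I] by (intro tendsto_upperbound[where F = sequentially]) auto
qed

lemma simple_integral_tendsto:
  assumes I: "has_scalar_integral M \<mu> f I" and s: "\<And>n. simple_function M (s n)"
    and lim: "uniform_limit (space M) s f sequentially"
  shows "(\<lambda>n. simple_integral_wrt M \<mu> (s n)) \<longlonglongrightarrow> I"
proof (rule LIMSEQ_I)
  fix e :: real assume "e > 0"
  obtain \<delta> where d: "\<delta> > 0" "\<delta> * measure m (space m) < e"
    using small_multiple_of_mass[OF \<open>e > 0\<close>] .
  obtain N where N: "\<And>n x. n \<ge> N \<Longrightarrow> x \<in> space M \<Longrightarrow> dist (s n x) (f x) < \<delta>"
    using uniform_limitD[OF lim d(1)] by (auto simp: eventually_sequentially)
  have "norm (simple_integral_wrt M \<mu> (s n) - I) < e" if "n \<ge> N" for n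
  proof -
    have diff: "has_scalar_integral M \<mu> (\<lambda>x. s n x + (-1) * f x) (simple_integral_wrt M \<mu> (s n) + (-1) * I)"
      by (intro has_scalar_integral_add has_scalar_integral_cmult has_scalar_integral_simple I s)
    have "norm (simple_integral_wrt M \<mu> (s n) - I) \<le> (\<integral>x. norm (s n x + (-1) * f x) \<partial>m)"
      using has_scalar_integral_norm_le[OF diff] by simp
    also have "\<dots> \<le> (\<integral>x. \<delta> \<partial>m)"
    proof (rule integral_mono)
      show "norm (s n x + (-1) * f x) \<le> \<delta>" if "x \<in> space m" for x
        using N[OF \<open>n \<ge> N\<close>, of x] that by (simp add: dist_norm)
    qed (use integrable_norm_bounded[OF has_scalar_integral_bounded_measurable[OF diff]] in simp_all)
    also have "\<dots> < e" using d(2) by (simp add: mult.commute)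
    finally show ?thesis .
  qed
  then show "\<exists>N. \<forall>n\<ge>N. norm (simple_integral_wrt M \<mu> (s n) - I) < e" by blast
qed

lemma has_scalar_integral_unique:
  assumes "has_scalar_integral M \<mu> f I" "has_scalar_integral M \<mu> f J"
  shows "I = J"
  using has_scalar_integral_norm_le[OF has_scalar_integral_add[OF assms(1)
      has_scalar_integral_cmult[OF assms(2), of "-1"]]] by simp

lemma has_scalar_integral_exists:
  assumes f: "bounded_measurable M f"
  shows "\<exists>I. has_scalar_integral M \<mu> f I"
proof -
  have "\<exists>s. simple_function M s \<and> (\<forall>x\<in>space M. norm (s x - f x) < inverse (real (Suc n)))" for n
    by (rule simple_function_approximation[OF f, of "inverse (real (Suc n))"]) (simp, blast)
  then obtain s where s: "\<And>n. simple_function M (s n)"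
    and near: "\<And>n x. x \<in> space M \<Longrightarrow> norm (s n x - f x) < inverse (real (Suc n))"
    by metis
  have lim: "uniform_limit (space M) s f sequentially"
  proof (rule uniform_limitI)
    fix e :: real assume "e > 0"
    then obtain N where N: "inverse (real (Suc N)) < e" using reals_Archimedean by blast
    have "dist (s n x) (f x) < e" if "n \<ge> N" "x \<in> space M" for n x
    proof -
      have "inverse (real (Suc n)) \<le> inverse (real (Suc N))" using that(1) by simp
      then show ?thesis using near[OF that(2), of n] N unfolding dist_norm by linarith
    qed
    then show "\<forall>\<^sub>F n in sequentially. \<forall>x\<in>space M. dist (s n x) (f x) < e"
      unfolding eventually_sequentially by blast
  qed
  have "Cauchy (\<lambda>n. simple_integral_wrt M \<mu> (s n))"
  proof (rule metric_CauchyI)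
    fix e :: real assume "e > 0"
    obtain \<delta> where d: "\<delta> > 0" "\<delta> * measure m (space m) < e / 2"
      using small_multiple_of_mass[of "e / 2"] \<open>e > 0\<close> by auto
    obtain N where N: "\<And>n x. n \<ge> N \<Longrightarrow> x \<in> space M \<Longrightarrow> dist (s n x) (f x) < \<delta>"
      using uniform_limitD[OF lim d(1)] by (auto simp: eventually_sequentially)
    have "dist (simple_integral_wrt M \<mu> (s i)) (simple_integral_wrt M \<mu> (s j)) < e"
      if "i \<ge> N" "j \<ge> N" for i j
    proof -
      have sf: "simple_function M (\<lambda>x. s i x + (-1) * s j x)"
        by (intro simple_function_add s simple_function_compose1[OF s])
      have "dist (simple_integral_wrt M \<mu> (s i)) (simple_integral_wrt M \<mu> (s j)) =
          norm (simple_integral_wrt M \<mu> (\<lambda>x. s i x + (-1) * s j x))"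
        using simple_integral_add[OF s[of i] simple_function_compose1[OF s[of j]], of "\<lambda>y. (-1) * y"]
          simple_integral_cmult[OF s[of j], of "-1"] by (simp add: dist_norm)
      also have "\<dots> \<le> (\<integral>x. norm (s i x + (-1) * s j x) \<partial>m)"
        by (rule norm_simple_integral_le[OF sf])
      also have "\<dots> \<le> (\<integral>x. 2 * \<delta> \<partial>m)"
      proof (rule integral_mono)
        show "norm (s i x + (-1) * s j x) \<le> 2 * \<delta>" if "x \<in> space m" for x
        proof -
          have "dist (s i x) (s j x) < \<delta> + \<delta>"
            using that N[OF \<open>i \<ge> N\<close>, of x] N[OF \<open>j \<ge> N\<close>, of x]
            by (intro dist_triangle_less_add[of _ "f x"]) (auto simp: dist_commute)
          then show ?thesis by (simp add: dist_norm)
        qed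
      qed (use integrable_norm_bounded[OF bounded_measurable_simple[OF sf]] in simp_all)
      also have "\<dots> < e" using d(2) by (simp add: mult.commute)
      finally show ?thesis .
    qed
    then show "\<exists>N. \<forall>i\<ge>N. \<forall>j\<ge>N. dist (simple_integral_wrt M \<mu> (s i)) (simple_integral_wrt M \<mu> (s j)) < e"
      by blast
  qed
  then obtain I where "(\<lambda>n. simple_integral_wrt M \<mu> (s n)) \<longlonglongrightarrow> I"
    using Cauchy_convergent_iff convergent_def by blast
  then show ?thesis using s lim by (auto simp: has_scalar_integral_iff)
qed

lemma has_scalar_integral_scalar_integral:
  "bounded_measurable M f \<Longrightarrow> has_scalar_integral M \<mu> f (scalar_integral M \<mu> f)"
  unfolding scalar_integral_def
  by (rule theI') (use has_scalar_integral_exists has_scalar_integral_unique in blast)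

lemma scalar_integral_eqI: "has_scalar_integral M \<mu> f I \<Longrightarrow> scalar_integral M \<mu> f = I"
  using has_scalar_integral_unique has_scalar_integral_scalar_integral
    has_scalar_integral_bounded_measurable by blast

lemma scalar_integral_add:
  assumes "bounded_measurable M f" "bounded_measurable M g"
  shows "scalar_integral M \<mu> (\<lambda>x. f x + g x) = scalar_integral M \<mu> f + scalar_integral M \<mu> g"
  using assms by (intro scalar_integral_eqI has_scalar_integral_add has_scalar_integral_scalar_integral)

lemma scalar_integral_cmult:
  assumes "bounded_measurable M f"
  shows "scalar_integral M \<mu> (\<lambda>x. c * f x) = c * scalar_integral M \<mu> f"
  using assms by (intro scalar_integral_eqI has_scalar_integral_cmult has_scalar_integral_scalar_integral)

lemma norm_scalar_integral_le:
  "bounded_measurable M f \<Longrightarrow> norm (scalar_integral M \<mu> f) \<le> (\<integral>x. norm (f x) \<partial>m)"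
  by (intro has_scalar_integral_norm_le has_scalar_integral_scalar_integral)

lemma scalar_integral_cong:
  assumes "\<And>x. x \<in> space M \<Longrightarrow> f x = g x"
  shows "scalar_integral M \<mu> f = scalar_integral M \<mu> g"
proof -
  have "has_scalar_integral M \<mu> f I \<longleftrightarrow> has_scalar_integral M \<mu> g I" for I
    unfolding has_scalar_integral_iff using assms
    by (intro arg_cong[where f = Ex] ext conj_cong refl uniform_limit_cong') auto
  then show ?thesis by (simp add: scalar_integral_def)
qed

end


section \<open>Images of scalar measures and regularity\<close>

text \<open>
  The restriction to \<open>A\<close> and the factor \<open>c\<close> allow different parts of a measure to be transported
  by different maps, with compensating weights.
\<close>

definition pushforward ::
    "('b set \<Rightarrow> 'k::real_or_complex) \<Rightarrow> 'k \<Rightarrow> 'b set \<Rightarrow> ('b \<Rightarrow> 'c) \<Rightarrow> 'c set \<Rightarrow> 'k" where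
  "pushforward \<mu> c A g E = c * \<mu> (A \<inter> g -` E)"

context bv_measure
begin

context
  fixes A :: "'b set" and g :: "'b \<Rightarrow> 'c" and M' :: "'c measure"
  assumes A: "A \<in> sets M" and g: "g \<in> measurable (restrict_space M A) M'"
begin

lemma pushforward_sets: "E \<in> sets M' \<Longrightarrow> A \<inter> g -` E \<in> sets M"
  using measurable_sets[OF g, of E] A sets.sets_into_space[OF A]
  by (auto simp: sets_restrict_space_iff space_restrict_space Int_absorb2 Int_commute)

lemma pushforward_space: "x \<in> A \<Longrightarrow> g x \<in> space M'"
  using measurable_space[OF g, of x] sets.sets_into_space[OF A] by (auto simp: space_restrict_space)

lemma scalar_measure_pushforward: "scalar_measure M' (pushforward \<mu> c A g)"
  unfolding scalar_measure_def
proof safe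
  fix E :: "nat \<Rightarrow> 'c set" assume E: "range E \<subseteq> sets M'" "disjoint_family E"
  have "(\<lambda>i. \<mu> (A \<inter> g -` E i)) sums \<mu> (\<Union>i. A \<inter> g -` E i)"
    using E pushforward_sets
    by (intro scalar_measure_sums[OF scalar_measure]) (auto simp: disjoint_family_on_def)
  moreover have "(\<Union>i. A \<inter> g -` E i) = A \<inter> g -` (\<Union>i. E i)" by auto
  ultimately show "(\<lambda>i. pushforward \<mu> c A g (E i)) sums pushforward \<mu> c A g (\<Union> (range E))"
    unfolding pushforward_def by (auto intro: sums_mult)
qed

lemma variation_pushforward_le:
  assumes S: "S \<in> sets M'"
  shows "variation M' (pushforward \<mu> c A g) S \<le> ennreal (norm c * measure m (A \<inter> g -` S))"
proof (rule variation_least)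
  fix \<A> assume P: "finite \<A>" "\<A> \<subseteq> sets M'" "disjoint \<A>" "\<Union>\<A> = S"
  have "(\<Sum>E\<in>\<A>. ennreal (norm (pushforward \<mu> c A g E))) =
      ennreal (norm c) * (\<Sum>E\<in>\<A>. ennreal (norm (\<mu> (A \<inter> g -` E))))"
    by (simp add: pushforward_def norm_mult ennreal_mult sum_distrib_left del: sum_ennreal)
  also have "\<dots> \<le> ennreal (norm c) * variation M \<mu> (A \<inter> g -` S)"
    using P pushforward_sets
    by (intro mult_left_mono variation_upper[OF scalar_measure])
      (auto simp: disjoint_family_on_def disjoint_def)
  also have "\<dots> = ennreal (norm c * measure m (A \<inter> g -` S))"
    by (simp add: variation_eq pushforward_sets[OF S] ennreal_mult)
  finally show "(\<Sum>E\<in>\<A>. ennreal (norm (pushforward \<mu> c A g E))) \<le>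
      ennreal (norm c * measure m (A \<inter> g -` S))" .
qed

lemma bv_measure_pushforward: "bv_measure M' (pushforward \<mu> c A g)"
  by standard (auto intro: scalar_measure_pushforward
      order.strict_trans1[OF variation_pushforward_le[OF sets.top]])

lemma measure_pushforward_le:
  assumes "S \<in> sets M'"
  shows "measure (variation_measure M' (pushforward \<mu> c A g)) S \<le> norm c * measure m (A \<inter> g -` S)"
proof -
  interpret P: bv_measure M' "pushforward \<mu> c A g" by (rule bv_measure_pushforward)
  show ?thesis
    using variation_pushforward_le[OF assms, of c] by (simp add: P.variation_eq[OF assms])
qed

lemma simple_integral_pushforward:
  fixes c :: 'k
  assumes s: "simple_function M' s"
  defines "t \<equiv> \<lambda>x. if x \<in> A then c * s (g x) else 0"
  shows "simple_function M t"
    and "simple_integral_wrt M' (pushforward \<mu> c A g) s = simple_integral_wrt M \<mu> t"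
proof -
  define u where "u x = (if x \<in> A then Some (s (g x)) else None)" for x
  define F where "F = (\<lambda>None \<Rightarrow> 0 | Some y \<Rightarrow> c * y)"
  have range_u: "u ` space M \<subseteq> insert None (Some ` s ` space M')"
    using pushforward_space by (auto simp: u_def)
  have pre: "u -` {Some y} \<inter> space M = A \<inter> g -` (s -` {y} \<inter> space M')" for y
    using pushforward_space sets.sets_into_space[OF A] by (auto simp: u_def split: if_splits)
  have fin: "finite (s ` space M')" using s by (rule simple_functionD)
  have u: "simple_function M u"
    unfolding simple_function_def
  proof
    show "finite (u ` space M)" by (rule finite_subset[OF range_u]) (simp add: fin)
    have "u -` {None} \<inter> space M = space M - A" by (auto simp: u_def split: if_splits)
    moreover have "u -` {Some y} \<inter> space M \<in> sets M" for y
      unfolding pre by (intro pushforward_sets simple_functionD[OF s])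
    ultimately show "\<forall>x\<in>u ` space M. u -` {x} \<inter> space M \<in> sets M"
      using A by (metis option.exhaust sets.compl_sets)
  qed
  have t: "t = (\<lambda>x. F (u x))" by (auto simp: t_def F_def u_def)
  show "simple_function M t" unfolding t by (rule simple_function_compose1[OF u])
  have "simple_integral_wrt M \<mu> t = (\<Sum>y\<in>u ` space M. F y * \<mu> (u -` {y} \<inter> space M))"
    unfolding t by (rule simple_integral_compose[OF u])
  also have "\<dots> = (\<Sum>y\<in>insert None (Some ` s ` space M'). F y * \<mu> (u -` {y} \<inter> space M))"
  proof (rule sum.mono_neutral_left[OF _ range_u])
    show "\<forall>y\<in>insert None (Some ` s ` space M') - u ` space M. F y * \<mu> (u -` {y} \<inter> space M) = 0"
    proof
      fix y assume "y \<in> insert None (Some ` s ` space M') - u ` space M"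
      then have "u -` {y} \<inter> space M = {}" by auto
      then show "F y * \<mu> (u -` {y} \<inter> space M) = 0"
        by (simp only: scalar_measure_empty[OF scalar_measure] mult_zero_right)
    qed
  qed (use fin in simp)
  also have "\<dots> = (\<Sum>y\<in>s ` space M'. c * y * \<mu> (A \<inter> g -` (s -` {y} \<inter> space M')))"
    using fin by (subst sum.insert) (auto simp: F_def sum.reindex pre)
  also have "\<dots> = simple_integral_wrt M' (pushforward \<mu> c A g) s"
    by (simp add: simple_integral_wrt_def pushforward_def ac_simps)
  finally show "simple_integral_wrt M' (pushforward \<mu> c A g) s = simple_integral_wrt M \<mu> t" ..
qed

lemma scalar_integral_pushforward:
  assumes f: "bounded_measurable M' f"
  shows "bounded_measurable M (\<lambda>x. if x \<in> A then c * f (g x) else 0)" (is "?th1")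
    and "scalar_integral M' (pushforward \<mu> c A g) f =
      scalar_integral M \<mu> (\<lambda>x. if x \<in> A then c * f (g x) else 0)" (is "?th2")
proof -
  interpret P: bv_measure M' "pushforward \<mu> c A g" by (rule bv_measure_pushforward)
  obtain s where s: "\<And>n. simple_function M' (s n)"
    and lim: "uniform_limit (space M') s f sequentially"
    and I: "(\<lambda>n. simple_integral_wrt M' (pushforward \<mu> c A g) (s n)) \<longlonglongrightarrow>
      scalar_integral M' (pushforward \<mu> c A g) f"
    using P.has_scalar_integral_scalar_integral[OF f] by (auto simp: P.has_scalar_integral_iff)
  define t where "t n x = (if x \<in> A then c * s n (g x) else 0)" for n x
  have "uniform_limit (space M) t (\<lambda>x. if x \<in> A then c * f (g x) else 0) sequentially"
  proof (rule uniform_limitI)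
    fix e :: real assume "e > 0"
    then have "\<forall>\<^sub>F n in sequentially. \<forall>y\<in>space M'. dist (s n y) (f y) < e / (norm c + 1)"
      using uniform_limitD[OF lim, of "e / (norm c + 1)"] norm_ge_zero[of c] by (simp add: add_nonneg_pos)
    then show "\<forall>\<^sub>F n in sequentially. \<forall>x\<in>space M. dist (t n x) (if x \<in> A then c * f (g x) else 0) < e"
    proof eventually_elim
      case (elim n)
      show ?case
      proof
        fix x assume "x \<in> space M"
        have "norm (c * (s n (g x) - f (g x))) < e" if "x \<in> A"
        proof -
          have "norm (c * (s n (g x) - f (g x))) \<le> (norm c + 1) * norm (s n (g x) - f (g x))"
            by (simp add: norm_mult distrib_right)
          also have "\<dots> < (norm c + 1) * (e / (norm c + 1))"
            using elim pushforward_space[OF that] norm_ge_zero[of c]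
            by (intro mult_strict_left_mono) (auto simp: dist_norm add_nonneg_pos)
          also have "\<dots> = e" using norm_ge_zero[of c] by (simp add: add_nonneg_eq_0_iff)
          finally show ?thesis .
        qed
        then show "dist (t n x) (if x \<in> A then c * f (g x) else 0) < e"
          using \<open>e > 0\<close> by (simp add: t_def dist_norm right_diff_distrib)
      qed
    qed
  qed
  then have "has_scalar_integral M \<mu> (\<lambda>x. if x \<in> A then c * f (g x) else 0)
      (scalar_integral M' (pushforward \<mu> c A g) f)"
    unfolding has_scalar_integral_iff
    using simple_integral_pushforward[OF s] I by (intro exI[of _ t]) (simp add: t_def[abs_def])
  then show ?th1 ?th2
    using has_scalar_integral_bounded_measurable scalar_integral_eqI by force+
qed

end

end

definition compact_inner_regular :: "'b::topological_space measure \<Rightarrow> bool" where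
  "compact_inner_regular N \<longleftrightarrow>
     (\<forall>A\<in>sets N. \<forall>e>0. \<exists>K. compact K \<and> K \<subseteq> A \<and> measure N (A - K) < e)"

lemma compact_in_sets:
  fixes K :: "'b::t2_space set"
  assumes "compact K" "K \<subseteq> B" shows "K \<in> sets (restrict_space borel B)"
  using assms by (auto simp: sets_restrict_space image_iff intro!: bexI[of _ K] borel_closed compact_imp_closed)

lemma ennreal_pos_half:
  fixes e :: ennreal assumes "e > 0"
  obtains r :: real where "r > 0" "ennreal (r + r) \<le> e"
proof (cases e)
  case (real x)
  then show thesis using assms that[of "x / 2"] by simp
qed (use that[of 1] in simp)

text \<open>
  Outer regularity is inner regularity of the complements, because the
  complement of a compact set is relatively open.
\<close>

lemma regular_borel_bv_iff:
  fixes B :: "'b::t2_space set"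
  defines "M \<equiv> restrict_space borel B"
  shows "regular_borel_bv B \<mu> \<longleftrightarrow> bv_measure M \<mu> \<and> compact_inner_regular (variation_measure M \<mu>)"
proof
  assume reg: "regular_borel_bv B \<mu>"
  have space_M: "space M = B" by (simp add: M_def space_restrict_space)
  interpret bv_measure M \<mu>
    using reg by unfold_locales (simp_all add: regular_borel_bv_def space_M flip: M_def)
  have reg': "\<forall>A\<in>sets M. \<forall>e>0. \<exists>K U. compact K \<and> openin (top_of_set B) U \<and> K \<subseteq> A \<and>
      A \<subseteq> U \<and> variation M \<mu> (U - K) < e"
    using reg by (simp add: regular_borel_bv_def flip: M_def)
  have "\<exists>K. compact K \<and> K \<subseteq> A \<and> measure m (A - K) < e" if A: "A \<in> sets M" and "e > 0" for A e
  proof -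
    have "0 < ennreal e" using \<open>e > 0\<close> by simp
    from reg'[THEN bspec, OF A, THEN spec, THEN mp, OF this]
    obtain K U where KU: "compact K" "openin (top_of_set B) U" "K \<subseteq> A" "A \<subseteq> U"
      "variation M \<mu> (U - K) < ennreal e"
      by blast
    obtain T where "open T" "U = B \<inter> T" using KU(2) unfolding openin_open by blast
    then have U: "U \<in> sets M" by (simp add: M_def sets_restrict_space)
    have K: "K \<in> sets M"
      unfolding M_def using KU(1,3) sets.sets_into_space[OF A] space_M by (intro compact_in_sets) auto
    have "measure m (A - K) \<le> measure m (U - K)"
      using A U K KU by (intro m.finite_measure_mono) auto
    also have "\<dots> < e"
      using KU(5) U K variation_eq[of "U - K"] \<open>e > 0\<close> by (simp add: ennreal_less_iff)
    finally show ?thesis using KU by blast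
  qed
  then show "bv_measure M \<mu> \<and> compact_inner_regular (variation_measure M \<mu>)"
    using bv_measure_axioms by (auto simp: compact_inner_regular_def)
next
  assume "bv_measure M \<mu> \<and> compact_inner_regular (variation_measure M \<mu>)"
  then interpret bv_measure M \<mu> + reg: bv_measure M \<mu> by auto
  have reg: "\<exists>K. compact K \<and> K \<subseteq> A \<and> measure m (A - K) < e" if "A \<in> sets M" "e > 0" for A e
    using \<open>bv_measure M \<mu> \<and> compact_inner_regular (variation_measure M \<mu>)\<close> that
    by (auto simp: compact_inner_regular_def)
  have space_M: "space M = B" by (simp add: M_def space_restrict_space)
  have "\<exists>K U. compact K \<and> openin (top_of_set B) U \<and> K \<subseteq> A \<and> A \<subseteq> U \<and> variation M \<mu> (U - K) < e"
    if A: "A \<in> sets M" and "e > 0" for A and e :: ennreal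
  proof -
    obtain r :: real where r: "r > 0" "ennreal (r + r) \<le> e" using ennreal_pos_half[OF \<open>e > 0\<close>] .
    obtain K where K: "compact K" "K \<subseteq> A" "measure m (A - K) < r" using reg[OF A r(1)] by blast
    obtain L where L: "compact L" "L \<subseteq> B - A" "measure m (B - A - L) < r"
      using reg[OF _ r(1), of "B - A"] A space_M by (metis sets.compl_sets)
    have sub: "A \<subseteq> B" using sets.sets_into_space[OF A] space_M by simp
    have KL: "K \<in> sets M" "L \<in> sets M"
      unfolding M_def using K L sub by (auto intro: compact_in_sets)
    have B: "B \<in> sets M" using sets.top[of M] space_M by simp
    have "openin (top_of_set B) (B - L)"
      using L(1) by (auto simp: openin_open Diff_eq intro!: exI[of _ "- L"] compact_imp_closed)
    moreover have "variation M \<mu> (B - L - K) < e"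
    proof -
      have "measure m (B - L - K) \<le> measure m ((A - K) \<union> (B - A - L))"
        using A B KL by (intro m.finite_measure_mono) auto
      also have "\<dots> \<le> measure m (A - K) + measure m (B - A - L)"
        using A B KL by (intro measure_Un_le) auto
      also have "\<dots> < r + r" using K L by simp
      finally have "ennreal (measure m (B - L - K)) < ennreal (r + r)" using r(1) by (simp add: ennreal_less_iff)
      then show ?thesis using r(2) KL B by (simp add: variation_eq)
    qed
    ultimately show ?thesis using K L sub by (intro exI[of _ K] exI[of _ "B - L"]) auto
  qed
  then show "regular_borel_bv B \<mu>"
    using scalar_measure variation_finite
    by (simp add: regular_borel_bv_def space_M flip: M_def)
qed

text \<open>
  The image of a regular measure is regular if the map is continuous on compact sets carrying
  almost all of the mass: it maps compact subsets of these to compact sets.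
\<close>

lemma regular_borel_bv_pushforward:
  fixes B :: "'b::t2_space set" and B' :: "'c::t2_space set"
  defines "M \<equiv> restrict_space borel B" and "M' \<equiv> restrict_space borel B'"
  assumes reg: "regular_borel_bv B \<mu>" and A: "A \<in> sets M"
    and g: "g \<in> measurable (restrict_space M A) M'"
    and lusin: "\<And>e. e > 0 \<Longrightarrow> \<exists>C. compact C \<and> C \<subseteq> A \<and> continuous_on C g \<and>
      measure (variation_measure M \<mu>) (A - C) < e"
  shows "regular_borel_bv B' (pushforward \<mu> c A g)"
proof -
  interpret bv_measure M \<mu> using reg by (simp add: regular_borel_bv_iff M_def)
  interpret P: bv_measure M' "pushforward \<mu> c A g" using A g by (rule bv_measure_pushforward)
  have inner: "\<exists>K. compact K \<and> K \<subseteq> A \<and> measure m (A - K) < e" if "A \<in> sets M" "e > 0" for A e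
    using reg that by (auto simp: regular_borel_bv_iff compact_inner_regular_def M_def)
  have sub: "A \<subseteq> B" using sets.sets_into_space[OF A] by (simp add: M_def space_restrict_space)
  have "\<exists>K. compact K \<and> K \<subseteq> E \<and> measure P.m (E - K) < e" if E: "E \<in> sets M'" and "e > 0" for E e
  proof -
    define r where "r = e / (2 * (norm c + 1))"
    have pos: "norm c + 1 > 0" by (simp add: add_nonneg_pos)
    have r: "r > 0" using \<open>e > 0\<close> pos by (simp add: r_def)
    have gE: "A \<inter> g -` E \<in> sets M" using A g E by (rule pushforward_sets)
    obtain K where K: "compact K" "K \<subseteq> A \<inter> g -` E" "measure m (A \<inter> g -` E - K) < r"
      using inner[OF gE r] by blast
    obtain C where C: "compact C" "C \<subseteq> A" "continuous_on C g" "measure m (A - C) < r"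
      using lusin[OF r] by blast
    have KC: "K \<in> sets M" "C \<in> sets M"
      unfolding M_def using K C sub by (auto intro!: compact_in_sets)
    have comp: "compact (g ` (K \<inter> C))"
      using C K by (intro compact_continuous_image)
        (auto intro: continuous_on_subset compact_Int)
    have image: "g ` (K \<inter> C) \<subseteq> E" using K by auto
    have "E \<subseteq> B'" using sets.sets_into_space[OF E] by (simp add: M'_def space_restrict_space)
    then have gKC: "g ` (K \<inter> C) \<in> sets M'"
      unfolding M'_def using comp image by (intro compact_in_sets) auto
    have pre: "A \<inter> g -` (E - g ` (K \<inter> C)) \<in> sets M"
      using E gKC by (intro pushforward_sets[OF A g]) auto
    have "measure P.m (E - g ` (K \<inter> C)) \<le> norm c * measure m (A \<inter> g -` (E - g ` (K \<inter> C)))"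
      using E gKC by (intro measure_pushforward_le[OF A g]) auto
    also have "measure m (A \<inter> g -` (E - g ` (K \<inter> C))) \<le> measure m ((A \<inter> g -` E - K) \<union> (A - C))"
      using gE KC A pre by (intro m.finite_measure_mono) auto
    also have "\<dots> \<le> measure m (A \<inter> g -` E - K) + measure m (A - C)"
      using gE KC A by (intro measure_Un_le) auto
    also have "\<dots> \<le> 2 * r" using K C by simp
    finally have "measure P.m (E - g ` (K \<inter> C)) \<le> norm c * (2 * r)"
      by (simp add: mult_left_mono)
    also have "\<dots> < (norm c + 1) * (2 * r)" using r by simp
    also have "\<dots> = e" unfolding r_def using pos by (simp add: field_simps)
    finally show ?thesis using comp image by blast
  qed
  then show ?thesis
    using P.bv_measure_axioms
    by (auto simp: regular_borel_bv_iff compact_inner_regular_def simp flip: M'_def)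
qed

lemma regular_borel_bv_pushforward_continuous:
  fixes B :: "'b::t2_space set" and B' :: "'c::t2_space set"
  defines "M \<equiv> restrict_space borel B" and "M' \<equiv> restrict_space borel B'"
  assumes reg: "regular_borel_bv B \<mu>" and A: "A \<in> sets M"
    and g: "continuous_on A g" "g ` A \<subseteq> B'"
  shows "g \<in> measurable (restrict_space M A) M'"
    and "regular_borel_bv B' (pushforward \<mu> c A g)"
proof -
  have sub: "A \<subseteq> B" using sets.sets_into_space[OF A] by (simp add: M_def space_restrict_space)
  have sets_eq: "sets (restrict_space M A) = sets (restrict_space borel A)"
    using sub by (simp add: M_def sets_restrict_restrict_space Int_absorb1)
  then show meas: "g \<in> measurable (restrict_space M A) M'"
    using g borel_measurable_continuous_on_restrict[OF g(1)] sub
    unfolding measurable_cong_sets[OF sets_eq refl] M'_def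
    by (intro measurable_restrict_space2) (auto simp: space_restrict_space)
  show "regular_borel_bv B' (pushforward \<mu> c A g)"
  proof (rule regular_borel_bv_pushforward[OF reg])
    fix e :: real assume "e > 0"
    then show "\<exists>C. compact C \<and> C \<subseteq> A \<and> continuous_on C g \<and>
        measure (variation_measure (restrict_space borel B) \<mu>) (A - C) < e"
      using reg A continuous_on_subset[OF g(1)]
      unfolding regular_borel_bv_iff compact_inner_regular_def M_def sets_variation_measure by blast
  qed (use A meas in \<open>simp_all add: M_def M'_def\<close>)
qed

lemma scalar_measure_add:
  assumes "scalar_measure M \<mu>" "scalar_measure M \<nu>"
  shows "scalar_measure M (\<lambda>A. \<mu> A + \<nu> A)"
  using assms by (auto simp: scalar_measure_def intro: sums_add)

lemma variation_add_le:
  assumes "scalar_measure M \<mu>" "scalar_measure M \<nu>"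
  shows "variation M (\<lambda>A. \<mu> A + \<nu> A) S \<le> variation M \<mu> S + variation M \<nu> S"
proof (rule variation_least)
  fix \<A> assume P: "finite \<A>" "\<A> \<subseteq> sets M" "disjoint \<A>" "\<Union>\<A> = S"
  have "(\<Sum>A\<in>\<A>. ennreal (norm (\<mu> A + \<nu> A))) \<le>
      (\<Sum>A\<in>\<A>. ennreal (norm (\<mu> A)) + ennreal (norm (\<nu> A)))"
    by (intro sum_mono) (simp add: norm_triangle_ineq flip: ennreal_plus)
  also have "\<dots> \<le> variation M \<mu> S + variation M \<nu> S"
    unfolding sum.distrib using P
    by (intro add_mono variation_upper assms) (auto simp: disjoint_family_on_def disjoint_def)
  finally show "(\<Sum>A\<in>\<A>. ennreal (norm (\<mu> A + \<nu> A))) \<le> variation M \<mu> S + variation M \<nu> S" .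
qed

lemma bv_measure_add:
  assumes "bv_measure M \<mu>" "bv_measure M \<nu>"
  shows "bv_measure M (\<lambda>A. \<mu> A + \<nu> A)"
proof -
  interpret a: bv_measure M \<mu> by fact
  interpret b: bv_measure M \<nu> by fact
  have "variation M \<mu> (space M) + variation M \<nu> (space M) < \<infinity>"
    using a.variation_finite b.variation_finite by simp
  then show ?thesis
    by (intro bv_measure.intro scalar_measure_add a.scalar_measure b.scalar_measure
      order.strict_trans1[OF variation_add_le])
qed

lemma measure_add_le:
  assumes "bv_measure M \<mu>" "bv_measure M \<nu>" "S \<in> sets M"
  shows "measure (variation_measure M (\<lambda>A. \<mu> A + \<nu> A)) S \<le>
    measure (variation_measure M \<mu>) S + measure (variation_measure M \<nu>) S"
proof -
  interpret a: bv_measure M \<mu> by fact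
  interpret b: bv_measure M \<nu> by fact
  interpret c: bv_measure M "\<lambda>A. \<mu> A + \<nu> A" by (rule bv_measure_add[OF assms(1,2)])
  show ?thesis
    using variation_add_le[OF a.scalar_measure b.scalar_measure, of S] assms(3)
    by (simp add: a.variation_eq b.variation_eq c.variation_eq flip: ennreal_plus)
qed

lemma scalar_integral_measure_add:
  assumes "bv_measure M \<mu>" "bv_measure M \<nu>" "bounded_measurable M f"
  shows "scalar_integral M (\<lambda>A. \<mu> A + \<nu> A) f = scalar_integral M \<mu> f + scalar_integral M \<nu> f"
proof -
  interpret a: bv_measure M \<mu> by fact
  interpret b: bv_measure M \<nu> by fact
  interpret c: bv_measure M "\<lambda>A. \<mu> A + \<nu> A" by (rule bv_measure_add[OF assms(1,2)])
  obtain s where s: "\<And>n. simple_function M (s n)" and lim: "uniform_limit (space M) s f sequentially"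
    using a.has_scalar_integral_scalar_integral[OF assms(3)] by (auto simp: a.has_scalar_integral_iff)
  have "(\<lambda>n. simple_integral_wrt M (\<lambda>A. \<mu> A + \<nu> A) (s n)) =
      (\<lambda>n. simple_integral_wrt M \<mu> (s n) + simple_integral_wrt M \<nu> (s n))"
    by (simp add: simple_integral_wrt_def distrib_left sum.distrib)
  then have "(\<lambda>n. simple_integral_wrt M (\<lambda>A. \<mu> A + \<nu> A) (s n)) \<longlonglongrightarrow>
      scalar_integral M \<mu> f + scalar_integral M \<nu> f"
    using a.simple_integral_tendsto[OF a.has_scalar_integral_scalar_integral[OF assms(3)] s lim]
      b.simple_integral_tendsto[OF b.has_scalar_integral_scalar_integral[OF assms(3)] s lim]
    by (simp add: tendsto_add)
  then show ?thesis
    using s lim by (intro c.scalar_integral_eqI) (auto simp: c.has_scalar_integral_iff)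
qed

lemma regular_borel_bv_add:
  fixes B :: "'b::t2_space set"
  assumes "regular_borel_bv B \<mu>" "regular_borel_bv B \<nu>"
  shows "regular_borel_bv B (\<lambda>A. \<mu> A + \<nu> A)"
proof -
  define M where "M = restrict_space borel B"
  interpret a: bv_measure M \<mu> using assms(1) by (simp add: regular_borel_bv_iff M_def)
  interpret b: bv_measure M \<nu> using assms(2) by (simp add: regular_borel_bv_iff M_def)
  have bv: "bv_measure M (\<lambda>A. \<mu> A + \<nu> A)"
    by (rule bv_measure_add) unfold_locales
  have "\<exists>K. compact K \<and> K \<subseteq> A \<and> measure (variation_measure M (\<lambda>A. \<mu> A + \<nu> A)) (A - K) < e"
    if A: "A \<in> sets M" and "e > 0" for A e
  proof -
    have "e / 2 > 0" using \<open>e > 0\<close> by simp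
    then obtain K L where K: "compact K" "K \<subseteq> A" "measure a.m (A - K) < e / 2"
      and L: "compact L" "L \<subseteq> A" "measure b.m (A - L) < e / 2"
      using assms A unfolding regular_borel_bv_iff compact_inner_regular_def M_def[symmetric]
      by (metis sets_variation_measure)
    have "A \<subseteq> B" using sets.sets_into_space[OF A] by (simp add: M_def space_restrict_space)
    then have KL: "K \<in> sets M" "L \<in> sets M"
      unfolding M_def using K L by (auto intro: compact_in_sets)
    have "measure (variation_measure M (\<lambda>A. \<mu> A + \<nu> A)) (A - (K \<union> L)) \<le>
        measure a.m (A - (K \<union> L)) + measure b.m (A - (K \<union> L))"
      using A KL by (intro measure_add_le) (unfold_locales, auto)
    also have "\<dots> \<le> measure a.m (A - K) + measure b.m (A - L)"
      using A KL by (intro add_mono a.m.finite_measure_mono b.m.finite_measure_mono) auto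
    also have "\<dots> < e" using K L by simp
    finally show ?thesis using K L by (intro exI[of _ "K \<union> L"]) (auto intro: compact_Un)
  qed
  then show ?thesis
    using bv by (auto simp: regular_borel_bv_iff compact_inner_regular_def simp flip: M_def)
qed


section \<open>Polarization\<close>

definition symmetric_multilinear ::
    "('k::real_or_complex, 'v::ab_group_add) nspace \<Rightarrow> nat \<Rightarrow> ('v list \<Rightarrow> 'k) \<Rightarrow> bool" where
  "symmetric_multilinear E k D \<longleftrightarrow>
     (\<forall>xs\<in>lists (vecs E). length xs = k \<longrightarrow>
        (\<forall>i<k. linear_form E (\<lambda>x. D (xs[i := x]))) \<and>
        (\<forall>ys. mset ys = mset xs \<longrightarrow> D ys = D xs))"

lemma symmetric_multilinear_linear:
  "symmetric_multilinear E k D \<Longrightarrow> xs \<in> lists (vecs E) \<Longrightarrow> length xs = k \<Longrightarrow> i < k \<Longrightarrow>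
     linear_form E (\<lambda>x. D (xs[i := x]))"
  unfolding symmetric_multilinear_def by blast

lemma symmetric_multilinear_mset:
  "symmetric_multilinear E k D \<Longrightarrow> xs \<in> lists (vecs E) \<Longrightarrow> length xs = k \<Longrightarrow> mset ys = mset xs \<Longrightarrow>
     D ys = D xs"
  unfolding symmetric_multilinear_def by blast

lemma symmetric_form_iff:
  "symmetric_form E k A \<longleftrightarrow> symmetric_multilinear E k A \<and>
     (\<exists>C. \<forall>xs\<in>lists (vecs E). length xs = k \<longrightarrow> norm (A xs) \<le> C * prod_list (map (nrm E) xs))"
  unfolding symmetric_form_def symmetric_multilinear_def by (rule refl)

lemma symmetric_multilinear_diff:
  assumes "symmetric_multilinear E k A" "symmetric_multilinear E k B"
  shows "symmetric_multilinear E k (\<lambda>xs. A xs - B xs)"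
  unfolding symmetric_multilinear_def
proof (intro ballI impI conjI allI)
  fix xs i assume "xs \<in> lists (vecs E)" "length xs = k" "i < k"
  from assms[THEN symmetric_multilinear_linear, OF this]
  show "linear_form E (\<lambda>x. A (xs[i := x]) - B (xs[i := x]))"
    unfolding linear_form_def by (simp add: right_diff_distrib)
next
  fix xs ys assume "xs \<in> lists (vecs E)" "length xs = k" "mset ys = mset xs"
  from assms[THEN symmetric_multilinear_mset, OF this] show "A ys - B ys = A xs - B xs" by simp
qed

lemma symmetric_multilinear_Cons:
  assumes D: "symmetric_multilinear E (Suc n) D" and y: "y \<in> vecs E"
  shows "symmetric_multilinear E n (\<lambda>zs. D (y # zs))"
  unfolding symmetric_multilinear_def
proof (intro ballI impI conjI allI)
  fix xs i assume "xs \<in> lists (vecs E)" "length xs = n" "i < n"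
  then show "linear_form E (\<lambda>x. D (y # xs[i := x]))"
    using symmetric_multilinear_linear[OF D, of "y # xs" "Suc i"] y by simp
next
  fix xs ys assume "xs \<in> lists (vecs E)" "length xs = n" "mset ys = mset xs"
  then show "D (y # ys) = D (y # xs)"
    using symmetric_multilinear_mset[OF D, of "y # xs" "y # ys"] y by simp
qed

lemma sum_choose_Suc:
  fixes f :: "nat \<Rightarrow> 'a::comm_semiring_1"
  shows "(\<Sum>i\<le>Suc m. of_nat (Suc m choose i) * f i) =
    (\<Sum>i\<le>m. of_nat (m choose i) * f i) + (\<Sum>i\<le>m. of_nat (m choose i) * f (Suc i))"
proof -
  have "(\<Sum>i\<le>Suc m. of_nat (Suc m choose i) * f i) =
      f 0 + (\<Sum>i\<le>m. of_nat (m choose Suc i) * f (Suc i)) + (\<Sum>i\<le>m. of_nat (m choose i) * f (Suc i))"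
    by (simp add: sum.atMost_Suc_shift distrib_right sum.distrib add_ac del: sum.atMost_Suc)
  also have "f 0 + (\<Sum>i\<le>m. of_nat (m choose Suc i) * f (Suc i)) = (\<Sum>i\<le>Suc m. of_nat (m choose i) * f i)"
    by (subst sum.atMost_Suc_shift) simp
  also have "\<dots> = (\<Sum>i\<le>m. of_nat (m choose i) * f i)" by (simp add: binomial_eq_0)
  finally show ?thesis .
qed

context normed_space
begin

lemma symmetric_multilinear_binomial:
  assumes D: "symmetric_multilinear E k D" and x: "x \<in> vecs E" and y: "y \<in> vecs E"
    and "a + b + m = k"
  shows "D (replicate a x @ replicate b y @ replicate m (x + smul E t y)) =
    (\<Sum>i\<le>m. of_nat (m choose i) * (t ^ i * D (replicate (k - (b + i)) x @ replicate (b + i) y)))"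
  using \<open>a + b + m = k\<close>
proof (induction m arbitrary: a b)
  case 0
  then show ?case by auto
next
  case (Suc m)
  let ?w = "x + smul E t y"
  define L where "L v = replicate a x @ replicate b y @ v # replicate m ?w" for v
  have w: "?w \<in> vecs E" using x y by simp
  have L_mem: "L v \<in> lists (vecs E)" if "v \<in> vecs E" for v
    using x y w that by (auto simp: L_def)
  have len: "length (L v) = k" for v using Suc.prems by (simp add: L_def)
  have upd: "(L x)[a + b := v] = L v" for v
    by (simp add: L_def list_update_append)
  have lin: "linear_form E (\<lambda>v. D (L v))"
    using symmetric_multilinear_linear[OF D L_mem[OF x] len, of "a + b"] Suc.prems by (simp add: upd)
  have "D (L ?w) = D (L x) + t * D (L y)"
    using linear_form_add[OF lin x, of "smul E t y"] linear_form_smul[OF lin y] y by simp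
  also have "D (L x) = D (replicate (Suc a) x @ replicate b y @ replicate m ?w)"
    using symmetric_multilinear_mset[OF D L_mem[OF x] len,
        of "replicate (Suc a) x @ replicate b y @ replicate m ?w"] by (simp add: L_def)
  also have "\<dots> = (\<Sum>i\<le>m. of_nat (m choose i) * (t ^ i * D (replicate (k - (b + i)) x @ replicate (b + i) y)))"
    using Suc.prems by (intro Suc.IH) simp
  also have "D (L y) = D (replicate a x @ replicate (Suc b) y @ replicate m ?w)"
    using symmetric_multilinear_mset[OF D L_mem[OF y] len,
        of "replicate a x @ replicate (Suc b) y @ replicate m ?w"] by (simp add: L_def)
  also have "\<dots> = (\<Sum>i\<le>m. of_nat (m choose i) * (t ^ i * D (replicate (k - (Suc b + i)) x @ replicate (Suc b + i) y)))"
    using Suc.prems by (intro Suc.IH) simp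
  finally show ?case
    by (subst sum_choose_Suc) (simp add: L_def sum_distrib_left mult_ac)
qed

text \<open>
  A symmetric form is determined by its diagonal: the coefficient of \<open>t\<close> in the polynomial
  \<open>t \<mapsto> D (x + t y, \<dots>, x + t y)\<close> is a multiple of \<open>D (y, x, \<dots>, x)\<close>, so one argument after the
  other can be made arbitrary.
\<close>

lemma polarization:
  assumes "symmetric_multilinear E k D" and "\<And>x. x \<in> vecs E \<Longrightarrow> D (replicate k x) = 0"
    and "xs \<in> lists (vecs E)" "length xs = k"
  shows "D xs = 0"
  using assms
proof (induction k arbitrary: D xs)
  case 0
  then show ?case using zero_mem by fastforce
next
  case (Suc n)
  from Suc.prems obtain y zs where xs: "xs = y # zs" "y \<in> vecs E" "zs \<in> lists (vecs E)" "length zs = n"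
    by (cases xs) auto
  have "D (y # zs) = 0"
  proof (rule Suc.IH[where D = "\<lambda>zs. D (y # zs)"])
    show "symmetric_multilinear E n (\<lambda>zs. D (y # zs))"
      by (rule symmetric_multilinear_Cons[OF Suc.prems(1) xs(2)])
    fix x assume x: "x \<in> vecs E"
    have "(\<Sum>i\<le>Suc n. (of_nat (Suc n choose i) * D (replicate (Suc n - i) x @ replicate i y)) * t ^ i) = 0" for t
      using symmetric_multilinear_binomial[OF Suc.prems(1) x xs(2), of 0 0 "Suc n" t]
        Suc.prems(2)[of "x + smul E t y"] x xs(2) by (simp add: mult_ac del: replicate_Suc sum.atMost_Suc)
    then have "of_nat (Suc n choose 1) * D (replicate (Suc n - 1) x @ replicate 1 y) = 0"
      using polyfun_eq_0[of "\<lambda>i. of_nat (Suc n choose i) * D (replicate (Suc n - i) x @ replicate i y)" "Suc n"]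
      by (metis (no_types, lifting) One_nat_def Suc_le_mono le0)
    then have "D (replicate n x @ [y]) = 0"
      by (simp add: field_simps del: of_nat_Suc)
    then show "D (y # replicate n x) = 0"
      using symmetric_multilinear_mset[OF Suc.prems(1), of "replicate n x @ [y]" "y # replicate n x"] x xs(2)
      by (simp add: lists_eq_set subset_iff)
  qed (use xs in auto)
  then show ?case by (simp add: xs)
qed

lemma associated_form_unique:
  assumes "associated_form E k P A" "associated_form E k P B" "xs \<in> lists (vecs E)" "length xs = k"
  shows "A xs = B xs"
proof -
  have "(\<lambda>xs. A xs - B xs) xs = 0"
    by (rule polarization[where k = k])
      (use assms in \<open>auto simp: associated_form_def symmetric_form_iff intro: symmetric_multilinear_diff\<close>)
  then show ?thesis by simp
qed

end


section \<open>The symmetric form and the polynomial of a measure on the dual ball\<close>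

abbreviation dual_ball_space :: "('k::real_or_complex, 'v::ab_group_add) nspace \<Rightarrow> ('v \<Rightarrow> 'k) measure" where
  "dual_ball_space E \<equiv> restrict_space borel (unit_ball (dual E))"

definition form_of_measure ::
    "('k::real_or_complex, 'v::ab_group_add) nspace \<Rightarrow> (('v \<Rightarrow> 'k) set \<Rightarrow> 'k) \<Rightarrow> 'v list \<Rightarrow> 'k" where
  "form_of_measure E \<mu> xs = scalar_integral (dual_ball_space E) \<mu> (\<lambda>\<phi>. prod_list (map \<phi> xs))"

lemma prod_list_update_one:
  fixes ys :: "'a::comm_monoid_mult list"
  shows "i < length ys \<Longrightarrow> prod_list (ys[i := a]) = a * prod_list (ys[i := 1])"
proof (induction ys arbitrary: i)
  case (Cons y ys)
  then show ?case by (cases i) (auto simp: mult_ac)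
qed simp

lemma space_dual_ball_space [simp]: "space (dual_ball_space E) = unit_ball (dual E)"
  by (simp add: space_restrict_space)

lemma borel_measurable_dual_ball_space:
  "continuous_on UNIV f \<Longrightarrow> f \<in> borel_measurable (dual_ball_space E)"
  by (intro measurable_restrict_space1 borel_measurable_continuous_onI)

lemma continuous_on_prod_list_eval:
  "continuous_on UNIV (\<lambda>\<phi>::'v \<Rightarrow> 'k::real_or_complex. prod_list (map \<phi> xs))"
  by (induction xs) (auto intro!: continuous_intros continuous_on_product_coordinates)

context normed_space
begin

lemma norm_prod_list_eval_le:
  assumes "\<phi> \<in> unit_ball (dual E)" "xs \<in> lists (vecs E)"
  shows "norm (prod_list (map \<phi> xs)) \<le> prod_list (map (nrm E) xs)"
  using assms(2)
proof induction
  case (Cons x xs)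
  then show ?case
    using unit_ball_dual_le[OF assms(1)] by (auto simp: norm_mult intro!: mult_mono nrm_nonneg)
qed simp

lemma prod_list_nrm_nonneg: "xs \<in> lists (vecs E) \<Longrightarrow> 0 \<le> prod_list (map (nrm E) xs)"
  by (induction xs rule: lists.induct) (auto intro!: mult_nonneg_nonneg nrm_nonneg)

lemma bounded_measurable_eval:
  assumes "xs \<in> lists (vecs E)"
  shows "bounded_measurable (dual_ball_space E) (\<lambda>\<phi>. c * prod_list (map \<phi> xs))"
  using norm_prod_list_eval_le[OF _ assms]
  by (intro bounded_measurable_cmult bounded_measurableI borel_measurable_dual_ball_space
      continuous_on_prod_list_eval) auto

lemma bounded_measurable_eval': "xs \<in> lists (vecs E) \<Longrightarrow>
    bounded_measurable (dual_ball_space E) (\<lambda>\<phi>. prod_list (map \<phi> xs))"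
  using bounded_measurable_eval[of xs 1] by simp

lemma bounded_measurable_power:
  assumes "x \<in> vecs E" shows "bounded_measurable (dual_ball_space E) (\<lambda>\<phi>. \<phi> x ^ k)"
  using bounded_measurable_eval'[of "replicate k x"] assms
  by (simp add: map_replicate_const prod_list_replicate lists_eq_set subset_iff)

lemma symmetric_form_of_measure:
  assumes "bv_measure (dual_ball_space E) \<mu>"
  shows "symmetric_form E k (form_of_measure E \<mu>)"
proof -
  interpret bv_measure "dual_ball_space E" \<mu> by fact
  have "symmetric_multilinear E k (form_of_measure E \<mu>)"
    unfolding symmetric_multilinear_def
  proof (intro ballI impI conjI allI)
    fix xs i assume xs: "xs \<in> lists (vecs E)" "length xs = k" "i < k"
    define R where "R \<phi> = prod_list ((map \<phi> xs)[i := 1])" for \<phi> :: "'v \<Rightarrow> 'k"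
    have split: "prod_list (map \<phi> (xs[i := x])) = \<phi> x * R \<phi>" for \<phi> x
      unfolding map_update R_def using xs by (subst prod_list_update_one) auto
    have bm: "bounded_measurable (dual_ball_space E) (\<lambda>\<phi>. \<phi> x * R \<phi>)" if "x \<in> vecs E" for x
      using bounded_measurable_eval'[of "xs[i := x]"] xs that
      by (auto simp: split dest!: set_update_subset_insert[THEN subsetD])
    show "linear_form E (\<lambda>x. form_of_measure E \<mu> (xs[i := x]))"
      unfolding linear_form_def form_of_measure_def split
    proof (intro conjI ballI allI)
      fix x y assume x: "x \<in> vecs E" and y: "y \<in> vecs E"
      show "scalar_integral (dual_ball_space E) \<mu> (\<lambda>\<phi>. \<phi> (x + y) * R \<phi>) =
          scalar_integral (dual_ball_space E) \<mu> (\<lambda>\<phi>. \<phi> x * R \<phi>) +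
          scalar_integral (dual_ball_space E) \<mu> (\<lambda>\<phi>. \<phi> y * R \<phi>)"
        unfolding scalar_integral_add[OF bm[OF x] bm[OF y], symmetric]
        using x y by (intro scalar_integral_cong) (simp add: unit_ball_dual_iff distrib_right)
    next
      fix c x assume x: "x \<in> vecs E"
      show "scalar_integral (dual_ball_space E) \<mu> (\<lambda>\<phi>. \<phi> (smul E c x) * R \<phi>) =
          c * scalar_integral (dual_ball_space E) \<mu> (\<lambda>\<phi>. \<phi> x * R \<phi>)"
        unfolding scalar_integral_cmult[OF bm[OF x], symmetric]
        using x by (intro scalar_integral_cong) (simp add: unit_ball_dual_iff mult.assoc)
    qed
  next
    fix xs ys :: "'v list" assume "mset ys = mset xs"
    then have "mset (map \<phi> ys) = mset (map \<phi> xs)" for \<phi> :: "'v \<Rightarrow> 'k" by simp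
    then have "prod_list (map \<phi> ys) = prod_list (map \<phi> xs)" for \<phi> :: "'v \<Rightarrow> 'k"
      by (metis prod_mset_prod_list)
    then show "form_of_measure E \<mu> ys = form_of_measure E \<mu> xs" by (simp add: form_of_measure_def)
  qed
  moreover have "norm (form_of_measure E \<mu> xs) \<le> measure m (space m) * prod_list (map (nrm E) xs)"
    if xs: "xs \<in> lists (vecs E)" for xs
  proof -
    have "norm (form_of_measure E \<mu> xs) \<le> (\<integral>\<phi>. norm (prod_list (map \<phi> xs)) \<partial>m)"
      unfolding form_of_measure_def by (rule norm_scalar_integral_le[OF bounded_measurable_eval'[OF xs]])
    also have "\<dots> \<le> (\<integral>\<phi>. prod_list (map (nrm E) xs) \<partial>m)"
      using norm_prod_list_eval_le[OF _ xs]
      by (intro integral_mono integrable_norm_bounded[OF bounded_measurable_eval'[OF xs]]) auto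
    finally show ?thesis by simp
  qed
  ultimately show ?thesis unfolding symmetric_form_iff by blast
qed

lemma form_of_measure_diagonal:
  "form_of_measure E \<mu> (replicate k x) = scalar_integral (dual_ball_space E) \<mu> (\<lambda>\<phi>. \<phi> x ^ k)"
  by (simp add: form_of_measure_def prod_list_replicate)

lemma representing_measures_iff:
  "\<mu> \<in> representing_measures E k P \<longleftrightarrow> regular_borel_bv (unit_ball (dual E)) \<mu> \<and>
     (\<forall>x\<in>vecs E. scalar_integral (dual_ball_space E) \<mu> (\<lambda>\<phi>. \<phi> x ^ k) = P x)"
proof (cases "regular_borel_bv (unit_ball (dual E)) \<mu>")
  case True
  then interpret bv_measure "dual_ball_space E" \<mu> by (simp add: regular_borel_bv_iff)
  have "has_scalar_integral (dual_ball_space E) \<mu> (\<lambda>\<phi>. \<phi> x ^ k) (P x) \<longleftrightarrow>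
      scalar_integral (dual_ball_space E) \<mu> (\<lambda>\<phi>. \<phi> x ^ k) = P x" if "x \<in> vecs E" for x
    using scalar_integral_eqI has_scalar_integral_scalar_integral[OF bounded_measurable_power[OF that]]
    by metis
  then show ?thesis using True by (simp add: representing_measures_def)
qed (simp add: representing_measures_def)

lemma associated_form_of_measure:
  assumes "\<mu> \<in> representing_measures E k P"
  shows "associated_form E k P (form_of_measure E \<mu>)"
  using assms unfolding representing_measures_iff regular_borel_bv_iff
  by (auto simp: associated_form_def symmetric_form_of_measure form_of_measure_diagonal)

lemma integral_polynomials_iff:
  "P \<in> integral_polynomials E k \<longleftrightarrow> representing_measures E k P \<noteq> {} \<and> (\<forall>x. x \<notin> vecs E \<longrightarrow> P x = 0)"
  using associated_form_of_measure
  by (auto simp: integral_polynomials_def homogeneous_polynomial_def)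

lemma integral_norm_eq:
  "integral_norm E k P =
     (INF \<mu>\<in>representing_measures E k P.
        measure (variation_measure (dual_ball_space E) \<mu>) (unit_ball (dual E)))"
  unfolding integral_norm_def
proof (rule INF_cong[OF refl])
  fix \<mu> assume "\<mu> \<in> representing_measures E k P"
  then interpret bv_measure "dual_ball_space E" \<mu>
    by (simp add: representing_measures_iff regular_borel_bv_iff)
  show "enn2real (variation (dual_ball_space E) \<mu> (unit_ball (dual E))) = measure m (unit_ball (dual E))"
    using variation_eq[OF sets.top] by simp
qed

lemma integral_norm_le:
  assumes "\<mu> \<in> representing_measures E k P"
  shows "integral_norm E k P \<le> measure (variation_measure (dual_ball_space E) \<mu>) (unit_ball (dual E))"
  unfolding integral_norm_eq using assms by (intro cINF_lower bdd_belowI2[where m = 0]) auto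

lemma integral_norm_approx:
  assumes "P \<in> integral_polynomials E k" "e > 0"
  obtains \<mu> where "\<mu> \<in> representing_measures E k P"
    "measure (variation_measure (dual_ball_space E) \<mu>) (unit_ball (dual E)) < integral_norm E k P + e"
proof -
  have "Inf ((\<lambda>\<mu>. measure (variation_measure (dual_ball_space E) \<mu>) (unit_ball (dual E))) `
      representing_measures E k P) < integral_norm E k P + e"
    using \<open>e > 0\<close> by (simp add: integral_norm_eq)
  then show thesis
    using cInf_lessD[of "_ ` representing_measures E k P"] assms(1) that
    by (fastforce simp: integral_polynomials_iff)
qed

end


section \<open>The Aron-Berner extension as an iterated evaluation\<close>

lemma tendsto_eval_nhds: "((\<lambda>h. h x) \<longlongrightarrow> g x) (nhds g)"
  for g :: "'v \<Rightarrow> 'k::topological_space"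
proof (rule tendsto_at_iff_tendsto_nhds[of "\<lambda>h. h x" g, THEN iffD1])
  show "(\<lambda>h. h x) \<midarrow>g\<rightarrow> g x"
    using continuous_on_product_coordinates[of x] unfolding continuous_on_def by blast
qed

text \<open>
  A continuous form is a continuous linear form in each variable, so each weak* limit in the
  definition of the Aron-Berner extension is the value of a functional of the bidual at such a
  linear form; the innermost limit is the last variable.
\<close>

fun iterated_eval :: "(('v \<Rightarrow> 'k) \<Rightarrow> 'k) list \<Rightarrow> ('v list \<Rightarrow> 'k) \<Rightarrow> 'k" where
  "iterated_eval [] A = A []"
| "iterated_eval (z # zs) A = z (\<lambda>x. iterated_eval zs (\<lambda>xs. A (x # xs)))"

lemma iterated_eval_cong:
  "(\<And>xs. length xs = length zs \<Longrightarrow> A xs = B xs) \<Longrightarrow> iterated_eval zs A = iterated_eval zs B"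
proof (induction zs arbitrary: A B)
  case (Cons z zs)
  have "iterated_eval zs (\<lambda>xs. A (x # xs)) = iterated_eval zs (\<lambda>xs. B (x # xs))" for x
    using Cons.prems by (intro Cons.IH) simp
  then show ?case by simp
qed simp

locale total_normed_space = normed_space E
  for E :: "('k::real_or_complex, 'v::ab_group_add) nspace" +
  assumes vecs_UNIV: "vecs E = UNIV"
begin

definition bounded_multilinear :: "nat \<Rightarrow> real \<Rightarrow> ('v list \<Rightarrow> 'k) \<Rightarrow> bool" where
  "bounded_multilinear n C A \<longleftrightarrow>
     (\<forall>xs. length xs = n \<longrightarrow> (\<forall>i<n. linear_form E (\<lambda>x. A (xs[i := x]))) \<and>
        norm (A xs) \<le> C * prod_list (map (nrm E) xs))"

lemma bounded_multilinear_linear: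
  "bounded_multilinear n C A \<Longrightarrow> length xs = n \<Longrightarrow> i < n \<Longrightarrow> linear_form E (\<lambda>x. A (xs[i := x]))"
  unfolding bounded_multilinear_def by blast

lemma bounded_multilinear_bound:
  "bounded_multilinear n C A \<Longrightarrow> length xs = n \<Longrightarrow> norm (A xs) \<le> C * prod_list (map (nrm E) xs)"
  unfolding bounded_multilinear_def by blast

lemma bounded_multilinearI:
  assumes "\<And>xs i. length xs = n \<Longrightarrow> i < n \<Longrightarrow> linear_form E (\<lambda>x. A (xs[i := x]))"
    and "\<And>xs. length xs = n \<Longrightarrow> norm (A xs) \<le> C * prod_list (map (nrm E) xs)"
  shows "bounded_multilinear n C A"
  using assms unfolding bounded_multilinear_def by blast

lemma bounded_multilinear_of_symmetric_form:
  assumes "symmetric_form E n A"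
  obtains C where "bounded_multilinear n C A"
  using assms unfolding symmetric_form_def bounded_multilinear_def vecs_UNIV lists_UNIV by blast

lemma bounded_multilinear_Cons:
  assumes "bounded_multilinear (Suc n) C A"
  shows "bounded_multilinear n (C * nrm E x) (\<lambda>xs. A (x # xs))"
proof (rule bounded_multilinearI)
  fix xs :: "'v list" and i assume "length xs = n" "i < n"
  then show "linear_form E (\<lambda>y. A (x # xs[i := y]))"
    using bounded_multilinear_linear[OF assms, of "x # xs" "Suc i"] by simp
next
  fix xs :: "'v list" assume "length xs = n"
  then show "norm (A (x # xs)) \<le> C * nrm E x * prod_list (map (nrm E) xs)"
    using bounded_multilinear_bound[OF assms, of "x # xs"] by (simp add: mult.assoc)
qed

lemma bounded_multilinear_abs:
  assumes "bounded_multilinear n C A" shows "bounded_multilinear n \<bar>C\<bar> A"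
proof (rule bounded_multilinearI)
  fix xs :: "'v list" assume "length xs = n"
  then have "norm (A xs) \<le> C * prod_list (map (nrm E) xs)" by (rule bounded_multilinear_bound[OF assms])
  also have "\<dots> \<le> \<bar>C\<bar> * prod_list (map (nrm E) xs)"
    using prod_list_nrm_nonneg[of xs] by (intro mult_right_mono) (auto simp: vecs_UNIV)
  finally show "norm (A xs) \<le> \<bar>C\<bar> * prod_list (map (nrm E) xs)" .
qed (rule bounded_multilinear_linear[OF assms])

lemma bounded_multilinear_head:
  assumes "bounded_multilinear (Suc n) C A" "length xs = n"
  shows "A ((x + y) # xs) = A (x # xs) + A (y # xs)" "A (smul E c x # xs) = c * A (x # xs)"
  using bounded_multilinear_linear[OF assms(1), of "x # xs" 0] assms(2)
  by (auto simp: linear_form_def vecs_UNIV)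

lemma bounded_multilinear_lincomb:
  assumes A: "bounded_multilinear n C A" and B: "bounded_multilinear n D B"
  shows "bounded_multilinear n (C + norm c * D) (\<lambda>xs. A xs + c * B xs)"
proof (rule bounded_multilinearI)
  fix xs :: "'v list" and i assume "length xs = n" "i < n"
  from bounded_multilinear_linear[OF A this] bounded_multilinear_linear[OF B this]
  show "linear_form E (\<lambda>x. A (xs[i := x]) + c * B (xs[i := x]))"
    unfolding linear_form_def by (simp add: algebra_simps)
next
  fix xs :: "'v list" assume xs: "length xs = n"
  have "norm (A xs + c * B xs) \<le> norm (A xs) + norm c * norm (B xs)"
    by (metis norm_mult norm_triangle_ineq)
  also have "\<dots> \<le> C * prod_list (map (nrm E) xs) + norm c * (D * prod_list (map (nrm E) xs))"
    using bounded_multilinear_bound[OF A xs] bounded_multilinear_bound[OF B xs]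
    by (intro add_mono mult_left_mono) auto
  finally show "norm (A xs + c * B xs) \<le> (C + norm c * D) * prod_list (map (nrm E) xs)"
    by (simp add: algebra_simps)
qed

abbreviation bidual_lists where "bidual_lists \<equiv> lists (vecs (bidual E))"

text \<open>
  Linearity in the form is what makes each partial evaluation a continuous linear form in the
  remaining variable, so that the next functional can be applied to it.
\<close>

lemma iterated_eval_linear_bounded:
  assumes "zs \<in> bidual_lists"
  shows "(\<forall>A B C D c. bounded_multilinear (length zs) C A \<longrightarrow> bounded_multilinear (length zs) D B \<longrightarrow>
      iterated_eval zs (\<lambda>xs. A xs + c * B xs) = iterated_eval zs A + c * iterated_eval zs B) \<and>
    (\<forall>A C. bounded_multilinear (length zs) C A \<longrightarrow> 0 \<le> C \<longrightarrow>
      norm (iterated_eval zs A) \<le> C * prod_list (map (nrm (bidual E)) zs)) \<and>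
    (\<forall>A C. bounded_multilinear (Suc (length zs)) C A \<longrightarrow> 0 \<le> C \<longrightarrow>
      (\<lambda>x. iterated_eval zs (\<lambda>xs. A (x # xs))) \<in> vecs (dual E) \<and>
      nrm (dual E) (\<lambda>x. iterated_eval zs (\<lambda>xs. A (x # xs))) \<le> C * prod_list (map (nrm (bidual E)) zs))"
    (is "?lin zs \<and> ?bound zs \<and> ?mem zs")
  using assms
proof (induction zs rule: lists.induct)
  interpret D: normed_space "dual E" by (rule normed_space_dual)
  interpret DD: normed_space "bidual E" by (rule D.normed_space_dual)
  have step: "?mem zs" if zs: "zs \<in> bidual_lists" and lin: "?lin zs" and bound: "?bound zs" for zs
  proof (intro allI impI)
    fix A C assume A: "bounded_multilinear (Suc (length zs)) C A" and C: "0 \<le> C"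
    let ?f = "\<lambda>x. iterated_eval zs (\<lambda>xs. A (x # xs))"
    let ?P = "prod_list (map (nrm (bidual E)) zs)"
    have P: "0 \<le> ?P" by (rule DD.prod_list_nrm_nonneg[OF zs])
    note Ax = bounded_multilinear_Cons[OF A]
    have "?f (x + y) = ?f x + ?f y" for x y
    proof -
      have "?f (x + y) = iterated_eval zs (\<lambda>xs. A (x # xs) + 1 * A (y # xs))"
        by (intro iterated_eval_cong) (simp add: bounded_multilinear_head[OF A])
      then show ?thesis using lin[rule_format, OF Ax Ax, of x 1 y] by simp
    qed
    moreover have "?f (smul E c x) = c * ?f x" for c x
    proof -
      have zero: "bounded_multilinear (length zs) 0 (\<lambda>_. 0)"
        by (rule bounded_multilinearI) (auto simp: linear_form_def)
      have zero_eval: "iterated_eval zs (\<lambda>_. 0) = 0"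
        using bound[rule_format, OF zero] by simp
      have "?f (smul E c x) = iterated_eval zs (\<lambda>xs. 0 + c * A (x # xs))"
        by (intro iterated_eval_cong) (simp add: bounded_multilinear_head[OF A])
      then show ?thesis using lin[rule_format, OF zero Ax, of c x] zero_eval by simp
    qed
    moreover have le: "norm (?f x) \<le> C * ?P * nrm E x" for x
      using bound[rule_format, OF Ax, of x] C nrm_nonneg[of x] by (simp add: vecs_UNIV mult_ac)
    ultimately have "?f \<in> vecs (dual E)"
      by (intro dualI[where C = "C * ?P"]) (auto simp: vecs_UNIV)
    then show "?f \<in> vecs (dual E) \<and> nrm (dual E) ?f \<le> C * ?P"
      using dual_nrm_leI[of ?f "C * ?P"] le C P by simp
  qed
  {
    case Nil
    have lin: "?lin []" by simp
    have bound: "?bound []" using bounded_multilinear_bound by fastforce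
    from step[OF _ lin bound] lin bound show ?case by simp
  next
    case (Cons z zs)
    then have z: "z \<in> vecs (bidual E)" and zs: "zs \<in> bidual_lists" and IHl: "?lin zs" and IHb: "?bound zs"
      and IHm: "?mem zs" by auto
    have P: "0 \<le> prod_list (map (nrm (bidual E)) zs)" by (rule DD.prod_list_nrm_nonneg[OF zs])
    have mem: "(\<lambda>x. iterated_eval zs (\<lambda>xs. A (x # xs))) \<in> vecs (dual E)"
      if "bounded_multilinear (Suc (length zs)) C A" for C A
      using IHm[rule_format, OF bounded_multilinear_abs[OF that]] by simp
    have lin: "?lin (z # zs)"
    proof (intro allI impI)
      fix A B C D c
      assume "bounded_multilinear (length (z # zs)) C A" "bounded_multilinear (length (z # zs)) D B"
      then have A: "bounded_multilinear (Suc (length zs)) C A"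
        and B: "bounded_multilinear (Suc (length zs)) D B" by simp_all
      let ?f = "\<lambda>x. iterated_eval zs (\<lambda>xs. A (x # xs))" and ?g = "\<lambda>x. iterated_eval zs (\<lambda>xs. B (x # xs))"
      have "(\<lambda>x. iterated_eval zs (\<lambda>xs. A (x # xs) + c * B (x # xs))) = ?f + (\<lambda>x. c * ?g x)"
        using IHl[rule_format, OF bounded_multilinear_Cons[OF A] bounded_multilinear_Cons[OF B]]
        by (intro ext) simp
      then show "iterated_eval (z # zs) (\<lambda>xs. A xs + c * B xs) =
          iterated_eval (z # zs) A + c * iterated_eval (z # zs) B"
        using dual_add[OF z mem[OF A] smul_mem_dual[OF mem[OF B]]] dual_smul[OF z mem[OF B]] by simp
    qed
    have bound: "?bound (z # zs)"
    proof (intro allI impI)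
      fix A C assume "bounded_multilinear (length (z # zs)) C A" and C: "0 \<le> C"
      then have A: "bounded_multilinear (Suc (length zs)) C A" by simp
      let ?f = "\<lambda>x. iterated_eval zs (\<lambda>xs. A (x # xs))"
      have f: "?f \<in> vecs (dual E)" "nrm (dual E) ?f \<le> C * prod_list (map (nrm (bidual E)) zs)"
        using IHm[rule_format, OF A C] by auto
      have "norm (z ?f) \<le> nrm (bidual E) z * nrm (dual E) ?f" by (rule D.dual_le_nrm[OF z f(1)])
      also have "\<dots> \<le> nrm (bidual E) z * (C * prod_list (map (nrm (bidual E)) zs))"
        using f(2) D.dual_nrm_nonneg[OF z] by (rule mult_left_mono)
      finally show "norm (iterated_eval (z # zs) A) \<le> C * prod_list (map (nrm (bidual E)) (z # zs))"
        by (simp add: mult_ac)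
    qed
    have "z # zs \<in> bidual_lists" using z zs by simp
    from step[OF this lin bound] lin bound show ?case by blast
  }
qed

lemma iterated_eval_lincomb:
  assumes "zs \<in> bidual_lists" "bounded_multilinear (length zs) C A" "bounded_multilinear (length zs) D B"
  shows "iterated_eval zs (\<lambda>xs. A xs + c * B xs) = iterated_eval zs A + c * iterated_eval zs B"
  using iterated_eval_linear_bounded[OF assms(1)] assms(2,3) by blast

lemma norm_iterated_eval_le:
  assumes "zs \<in> bidual_lists" "bounded_multilinear (length zs) C A" "0 \<le> C"
  shows "norm (iterated_eval zs A) \<le> C * prod_list (map (nrm (bidual E)) zs)"
  using iterated_eval_linear_bounded[OF assms(1)] assms(2,3) by blast

lemma iterated_eval_mem_dual:
  assumes "zs \<in> bidual_lists" "bounded_multilinear (Suc (length zs)) C A"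
  shows "(\<lambda>x. iterated_eval zs (\<lambda>xs. A (x # xs))) \<in> vecs (dual E)"
  using iterated_eval_linear_bounded[OF assms(1)] bounded_multilinear_abs[OF assms(2)] abs_ge_zero by blast

lemma iterated_limit_iff:
  assumes "zs \<in> bidual_lists" "bounded_multilinear (length zs) C A" "list_all2 (weak_star_net E) Fs zs"
  shows "iterated_limit Fs A l \<longleftrightarrow> l = iterated_eval zs A"
  using assms
proof (induction zs arbitrary: Fs A C l rule: list.induct)
  case Nil
  then show ?case by simp
next
  case (Cons z zs)
  then obtain F Fs' where Fs: "Fs = F # Fs'" "weak_star_net E F z" "list_all2 (weak_star_net E) Fs' zs"
    by (auto simp: list_all2_Cons2)
  have zs: "zs \<in> bidual_lists" and A: "bounded_multilinear (Suc (length zs)) C A"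
    using Cons.prems(1,2) by simp_all
  let ?f = "\<lambda>x. iterated_eval zs (\<lambda>xs. A (x # xs))"
  have IH: "iterated_limit Fs' (\<lambda>xs. A (x # xs)) l \<longleftrightarrow> l = ?f x" for x l
    by (rule Cons.IH[OF zs bounded_multilinear_Cons[OF A] Fs(3)])
  have f: "?f \<in> vecs (dual E)" by (rule iterated_eval_mem_dual[OF zs A])
  then have lim: "(?f \<longlongrightarrow> z ?f) F"
  proof -
    have "((\<lambda>x. canon E x ?f) \<longlongrightarrow> z ?f) F" using Fs(2) f unfolding weak_star_net_def by blast
    then show ?thesis by (simp only: canon_apply[OF f])
  qed
  have "F \<noteq> bot" using Fs(2) by (simp add: weak_star_net_def)
  have "iterated_limit Fs A l \<longleftrightarrow> (?f \<longlongrightarrow> l) F"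
  proof
    assume "iterated_limit Fs A l"
    then obtain h where "\<forall>\<^sub>F x in F. h x = ?f x" "(h \<longlongrightarrow> l) F"
      unfolding Fs(1) iterated_limit.simps IH by blast
    then show "(?f \<longlongrightarrow> l) F" using tendsto_cong[of h ?f F l] by simp
  next
    assume "(?f \<longlongrightarrow> l) F"
    then show "iterated_limit Fs A l"
      unfolding Fs(1) iterated_limit.simps IH by (intro exI[of _ ?f] conjI always_eventually allI refl)
  qed
  also have "\<dots> \<longleftrightarrow> l = z ?f" using lim tendsto_unique[OF \<open>F \<noteq> bot\<close>] by blast
  finally show ?case by simp
qed

lemma linear_form_diff: "linear_form E f \<Longrightarrow> f (x - y) = f x - f y"
  using linear_form_add[of E f "x - y" y] by (simp add: vecs_UNIV)

text \<open>
  If one of the forms takes a nonzero value where the others vanish, a multiple of it can be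
  subtracted to pass to fewer forms.
\<close>

lemma linear_combination_of_kernel:
  assumes "finite G" and "\<And>f. f \<in> G \<Longrightarrow> linear_form E f" and "linear_form E g"
    and "\<And>y. (\<forall>f\<in>G. f y = 0) \<Longrightarrow> g y = 0"
  shows "\<exists>c. \<forall>y. g y = (\<Sum>f\<in>G. c f * f y)"
  using assms
proof (induction G arbitrary: g rule: finite_induct)
  case empty
  then show ?case by simp
next
  case (insert f0 G)
  note lin = insert.prems(1)
  show ?case
  proof (cases "\<exists>y. (\<forall>f\<in>G. f y = 0) \<and> f0 y \<noteq> 0")
    case False
    then obtain c where c: "\<And>y. g y = (\<Sum>f\<in>G. c f * f y)"
      using insert.IH[OF lin insert.prems(2)] insert.prems(3) by blast
    have "g y = (\<Sum>f\<in>insert f0 G. (c(f0 := 0)) f * f y)" for y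
      using insert.hyps c[of y] by (auto intro!: sum.cong)
    then show ?thesis by blast
  next
    case True
    then obtain y0 where y0: "\<And>f. f \<in> G \<Longrightarrow> f y0 = 0" "f0 y0 \<noteq> 0" by blast
    define a where "a = g y0 / f0 y0"
    have lin_h: "linear_form E (\<lambda>y. g y - a * f0 y)"
      using insert.prems(2) lin[of f0] unfolding linear_form_def by (simp add: algebra_simps)
    have "g y - a * f0 y = 0" if y: "\<forall>f\<in>G. f y = 0" for y
    proof -
      define v where "v = y - smul E (f0 y / f0 y0) y0"
      have fv: "f v = f y - f0 y / f0 y0 * f y0" if "linear_form E f" for f
        using that by (simp add: v_def linear_form_diff linear_form_smul vecs_UNIV)
      have gv: "g v = g y - f0 y / f0 y0 * g y0" by (rule fv[OF insert.prems(2)])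
      have "f0 v = 0" using fv[of f0] lin[of f0] y0(2) by simp
      moreover have "f v = 0" if "f \<in> G" for f using fv[of f] lin[of f] that y y0(1)[of f] by simp
      ultimately have "\<forall>f\<in>insert f0 G. f v = 0" by blast
      then have "g v = 0" using insert.prems(3) by blast
      then show ?thesis using gv by (simp add: a_def)
    qed
    then obtain c where c: "\<And>y. g y - a * f0 y = (\<Sum>f\<in>G. c f * f y)"
      using insert.IH[OF lin lin_h] by blast
    have "g y = (\<Sum>f\<in>insert f0 G. (c(f0 := a)) f * f y)" for y
    proof -
      have "(\<Sum>f\<in>G. (c(f0 := a)) f * f y) = (\<Sum>f\<in>G. c f * f y)"
        using insert.hyps by (intro sum.cong) auto
      then show ?thesis using insert.hyps c[of y] by (simp add: algebra_simps)
    qed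
    then show ?thesis by blast
  qed
qed

lemma bidual_sum:
  assumes z: "z \<in> vecs (bidual E)" and "finite G" "G \<subseteq> vecs (dual E)"
  shows "(\<lambda>y. \<Sum>f\<in>G. c f * f y) \<in> vecs (dual E) \<and> z (\<lambda>y. \<Sum>f\<in>G. c f * f y) = (\<Sum>f\<in>G. c f * z f)"
  using assms(2,3)
proof (induction G rule: finite_induct)
  case empty
  interpret D: normed_space "dual E" by (rule normed_space_dual)
  have "(\<lambda>y. \<Sum>f\<in>{}. c f * f y) = (0 :: 'v \<Rightarrow> 'k)" by auto
  then show ?case using zero_mem_dual D.linear_form_zero[OF dual_linear[OF z]] by simp
next
  case (insert f G)
  let ?S = "\<lambda>y. \<Sum>f\<in>G. c f * f y"
  have "(\<lambda>y. \<Sum>f\<in>insert f G. c f * f y) = (\<lambda>y. c f * f y) + ?S"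
    using insert.hyps by auto
  moreover have "(\<lambda>y. c f * f y) \<in> vecs (dual E)" "?S \<in> vecs (dual E)"
    using insert smul_mem_dual by auto
  ultimately show ?case
    using insert dual_add[OF z] dual_smul[OF z, of f "c f"] add_mem_dual by simp
qed

text \<open>
  Helly's lemma in its algebraic form. The nets in the definition of the Aron-Berner extension
  carry no bound, so interpolating finitely many values is enough to construct them.
\<close>

lemma bidual_interpolation:
  assumes z: "z \<in> vecs (bidual E)" and "finite G" "G \<subseteq> vecs (dual E)"
  shows "\<exists>x. \<forall>f\<in>G. f x = z f"
  using assms(2,3)
proof (induction G rule: finite_induct)
  case empty
  then show ?case by simp
next
  case (insert g G)
  then obtain x where x: "\<And>f. f \<in> G \<Longrightarrow> f x = z f" by auto
  have lin: "linear_form E f" if "f \<in> insert g G" for f using insert.prems that dual_linear by blast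
  show ?case
  proof (cases "\<exists>y. (\<forall>f\<in>G. f y = 0) \<and> g y \<noteq> 0")
    case True
    then obtain y where y: "\<And>f. f \<in> G \<Longrightarrow> f y = 0" "g y \<noteq> 0" by blast
    define x' where "x' = x + smul E ((z g - g x) / g y) y"
    have "f x' = f x + (z g - g x) / g y * f y" if "f \<in> insert g G" for f
      using lin[OF that] by (simp add: x'_def linear_form_add linear_form_smul vecs_UNIV)
    then have "g x' = z g" "\<And>f. f \<in> G \<Longrightarrow> f x' = z f"
      using x y by (metis add_diff_cancel_left' diff_add_cancel insertI1 nonzero_eq_divide_eq,
        metis add.right_neutral insertI2 mult_zero_right)
    then have "\<forall>f\<in>insert g G. f x' = z f" by blast
    then show ?thesis by blast
  next
    case False
    then obtain c where c: "\<And>y. g y = (\<Sum>f\<in>G. c f * f y)"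
      using linear_combination_of_kernel[OF insert.hyps(1), of g] lin by blast
    then have "g = (\<lambda>y. \<Sum>f\<in>G. c f * f y)" by auto
    then have "z g = (\<Sum>f\<in>G. c f * z f)"
      using bidual_sum[OF z insert.hyps(1)] insert.prems by simp
    also have "\<dots> = g x" unfolding c using x by (intro sum.cong) auto
    finally show ?thesis using x by (intro exI[of _ x]) auto
  qed
qed

lemma weak_star_net_exists:
  assumes z: "z \<in> vecs (bidual E)" shows "\<exists>F. weak_star_net E F z"
proof -
  define F where "F = filtercomap (canon E) (nhds z)"
  have "F \<noteq> bot"
    unfolding F_def
  proof (rule filtercomap_neq_bot)
    fix Q assume "eventually Q (nhds z)"
    then obtain U where U: "open U" "z \<in> U" "\<And>y. y \<in> U \<Longrightarrow> Q y" by (auto simp: eventually_nhds)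
    then obtain V where V: "z \<in> Pi\<^sub>E UNIV V" "finite {i. V i \<noteq> UNIV}" "Pi\<^sub>E UNIV V \<subseteq> U"
      unfolding open_fun_def by (auto dest!: product_topology_open_contains_basis)
    obtain x where x: "\<And>f. f \<in> {f. V f \<noteq> UNIV} \<inter> vecs (dual E) \<Longrightarrow> f x = z f"
      using bidual_interpolation[OF z, of "{f. V f \<noteq> UNIV} \<inter> vecs (dual E)"] V(2) by auto
    have "canon E x f \<in> V f" for f
    proof (cases "f \<in> vecs (dual E)")
      case True
      then show ?thesis using x[of f] V(1) by (cases "V f = UNIV") (auto simp: canon_apply PiE_iff)
    next
      case False
      then show ?thesis using V(1) dual_outside[OF z False] by (simp add: canon_def PiE_iff) metis
    qed
    then have "canon E x \<in> U" using V(3) by (auto simp: PiE_iff)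
    then show "\<exists>x. Q (canon E x)" using U(3) by blast
  qed
  moreover have "((\<lambda>x. canon E x f) \<longlongrightarrow> z f) F" for f
  proof -
    show ?thesis
      unfolding F_def by (rule filterlim_compose[OF tendsto_eval_nhds filterlim_filtercomap])
  qed
  ultimately show ?thesis by (auto simp: weak_star_net_def vecs_UNIV)
qed

lemma form_extension_eq:
  assumes zs: "zs \<in> bidual_lists" and A: "bounded_multilinear (length zs) C A"
  shows "form_extension E A zs = iterated_eval zs A"
proof -
  obtain N where "\<And>z. z \<in> vecs (bidual E) \<Longrightarrow> weak_star_net E (N z) z"
    using weak_star_net_exists by metis
  then have "list_all2 (weak_star_net E) (map N zs) zs"
    using zs by (auto simp: list_all2_conv_all_nth lists_eq_set subset_iff)
  then show ?thesis
    unfolding form_extension_def using iterated_limit_iff[OF zs A]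
    by (intro the_equality) blast+
qed

lemma aron_berner_eq:
  assumes A: "associated_form E k P A" and z: "z \<in> vecs (bidual E)"
  shows "aron_berner E k P z = iterated_eval (replicate k z) A"
proof -
  define A' where "A' = (SOME A. associated_form E k P A)"
  have A': "associated_form E k P A'" unfolding A'_def by (rule someI[of "associated_form E k P", OF A])
  then obtain C where C: "bounded_multilinear k C A'"
    using bounded_multilinear_of_symmetric_form by (auto simp: associated_form_def)
  have zs: "replicate k z \<in> bidual_lists" using z by (simp add: lists_eq_set subset_iff)
  have "aron_berner E k P z = iterated_eval (replicate k z) A'"
    using form_extension_eq[OF zs] C z by (simp add: aron_berner_def A'_def)
  also have "\<dots> = iterated_eval (replicate k z) A"
    using associated_form_unique[OF A' A] by (intro iterated_eval_cong) (simp add: vecs_UNIV)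
  finally show ?thesis .
qed

end


section \<open>The geometry of the third dual of an M-embedded space\<close>

lemma module_dual: "module (smul (dual E))"
  by standard (auto simp: fun_eq_iff algebra_simps)

lemma countable_dense_subset:
  fixes S :: "'b::second_countable_topology set"
  obtains D where "countable D" "D \<subseteq> S" "\<And>U. open U \<Longrightarrow> U \<inter> S \<noteq> {} \<Longrightarrow> U \<inter> D \<noteq> {}"
proof -
  obtain \<B> :: "'b set set" where B: "countable \<B>" "topological_basis \<B>"
    using ex_countable_basis by blast
  define D where "D = (\<lambda>b. SOME x. x \<in> b \<inter> S) ` {b \<in> \<B>. b \<inter> S \<noteq> {}}"
  have pick: "(SOME x. x \<in> b \<inter> S) \<in> b \<inter> S" if "b \<inter> S \<noteq> {}" for b
    using that some_in_eq[of "b \<inter> S"] by blast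
  show thesis
  proof
    show "countable D" unfolding D_def using B(1) by auto
    show "D \<subseteq> S" unfolding D_def using pick by auto
    fix U :: "'b set" assume "open U" "U \<inter> S \<noteq> {}"
    then obtain x where "x \<in> U" "x \<in> S" by blast
    then obtain b where "b \<in> \<B>" "x \<in> b" "b \<subseteq> U"
      using topological_basisE[OF B(2) \<open>open U\<close>] by blast
    then show "U \<inter> D \<noteq> {}" using pick[of b] \<open>x \<in> S\<close> by (auto simp: D_def)
  qed
qed

lemma cluster_point:
  fixes f :: "nat \<Rightarrow> 'v \<Rightarrow> 'k::real_or_complex"
  assumes "compact K" "\<And>n. f n \<in> K"
  obtains g G where "g \<in> K" "G \<noteq> bot" "\<And>x. ((\<lambda>h. h x) \<longlongrightarrow> g x) G"
    "\<And>Q. \<forall>\<^sub>F n in sequentially. Q (f n) \<Longrightarrow> \<forall>\<^sub>F h in G. Q h"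
proof -
  have "filtermap f sequentially \<noteq> bot" "\<forall>\<^sub>F h in filtermap f sequentially. h \<in> K"
    using assms(2) by (simp_all add: filtermap_bot_iff eventually_filtermap)
  then obtain g where g: "g \<in> K" "inf (nhds g) (filtermap f sequentially) \<noteq> bot"
    using assms(1) unfolding compact_filter by blast
  show thesis
  proof (rule that[OF g])
    show "((\<lambda>h. h x) \<longlongrightarrow> g x) (inf (nhds g) (filtermap f sequentially))" for x
      by (rule tendsto_mono[OF inf_le1 tendsto_eval_nhds])
    show "\<forall>\<^sub>F h in inf (nhds g) (filtermap f sequentially). Q h" if "\<forall>\<^sub>F n in sequentially. Q (f n)" for Q
      using that by (intro filter_leD[OF inf_le2]) (simp add: eventually_filtermap)
  qed
qed

definition restriction ::
    "('k::real_or_complex, 'v::ab_group_add) nspace \<Rightarrow> ((('v \<Rightarrow> 'k) \<Rightarrow> 'k) \<Rightarrow> 'k) \<Rightarrow> 'v \<Rightarrow> 'k" where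
  "restriction E \<Phi> = (\<lambda>x. \<Phi> (canon E x))"

locale M_embedded = total_normed_space E
  for E :: "('k::real_or_complex, 'v::ab_group_add) nspace" +
  assumes M_ideal: "M_ideal (bidual E) (canon E ` vecs E)"
begin

sublocale D: normed_space "dual E" by (rule normed_space_dual)
sublocale DD: normed_space "bidual E" by (rule D.normed_space_dual)
sublocale DDD: normed_space "dual (bidual E)" by (rule DD.normed_space_dual)

lemma restriction_mem:
  assumes "\<Phi> \<in> vecs (dual (bidual E))"
  shows "restriction E \<Phi> \<in> vecs (dual E)"
    and "nrm (dual E) (restriction E \<Phi>) \<le> nrm (dual (bidual E)) \<Phi>"
proof -
  have le: "norm (restriction E \<Phi> x) \<le> nrm (dual (bidual E)) \<Phi> * nrm E x" for x
  proof -
    have "norm (restriction E \<Phi> x) \<le> nrm (dual (bidual E)) \<Phi> * nrm (bidual E) (canon E x)"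
      unfolding restriction_def by (intro DD.dual_le_nrm assms canon_mem_bidual) (simp add: vecs_UNIV)
    also have "\<dots> \<le> nrm (dual (bidual E)) \<Phi> * nrm E x"
      by (intro mult_left_mono nrm_canon_le DD.dual_nrm_nonneg assms) (simp add: vecs_UNIV)
    finally show ?thesis .
  qed
  show "restriction E \<Phi> \<in> vecs (dual E)"
  proof (rule dualI[where C = "nrm (dual (bidual E)) \<Phi>"])
    show "restriction E \<Phi> (x + y) = restriction E \<Phi> x + restriction E \<Phi> y" for x y
      unfolding restriction_def using canon_add[of x y] canon_mem_bidual
      by (simp add: vecs_UNIV dual_add[OF assms])
    show "restriction E \<Phi> (smul E c x) = c * restriction E \<Phi> x" for c x
      unfolding restriction_def using canon_smul[of x c] canon_mem_bidual[of x]
        dual_smul[OF assms, of "canon E x" c]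
      by (simp add: vecs_UNIV)
  qed (use le in \<open>auto simp: vecs_UNIV\<close>)
  show "nrm (dual E) (restriction E \<Phi>) \<le> nrm (dual (bidual E)) \<Phi>"
    using le by (intro dual_nrm_leI DD.dual_nrm_nonneg assms)
qed

lemma restriction_canon:
  assumes "\<phi> \<in> vecs (dual E)" shows "restriction E (canon (dual E) \<phi>) = \<phi>"
  using assms canon_mem_bidual by (auto simp: restriction_def canon_def vecs_UNIV fun_eq_iff)

text \<open>
  The L-complement of the annihilator of \<open>E\<close> in the third dual must be the canonical copy of the
  dual: a canonical functional has no larger norm than its restriction to \<open>E\<close>, which leaves no
  room for a component in the annihilator.
\<close>

lemma norm_restriction_add:
  assumes \<Phi>: "\<Phi> \<in> vecs (dual (bidual E))"
  shows "nrm (dual E) (restriction E \<Phi>) +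
      nrm (dual (bidual E)) (\<Phi> - canon (dual E) (restriction E \<Phi>)) \<le> nrm (dual (bidual E)) \<Phi>"
proof -
  let ?T = "dual (bidual E)" and ?N = "annihilator (bidual E) (canon E ` vecs E)"
  from M_ideal obtain W where W: "closed_subspace ?T W" and sum: "l1_direct_sum ?T ?N W"
    unfolding M_ideal_def by blast
  have WT: "W \<subseteq> vecs ?T" and sub: "module.subspace (smul ?T) W"
    using W by (auto simp: closed_subspace_def)
  interpret T: module "smul ?T" by (rule module_dual)
  have decomp: "\<exists>u w. u \<in> ?N \<and> w \<in> W \<and> \<Psi> = u + w \<and> nrm ?T \<Psi> = nrm ?T u + nrm ?T w"
    if "\<Psi> \<in> vecs ?T" for \<Psi>
  proof -
    have "\<Psi> \<in> {u + w | u w. u \<in> ?N \<and> w \<in> W}" using sum that by (simp add: l1_direct_sum_def)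
    then show ?thesis using sum unfolding l1_direct_sum_def by blast
  qed
  have restr_ann: "restriction E (u + w) = restriction E w" if "u \<in> ?N" for u w
    using that by (auto simp: annihilator_def restriction_def vecs_UNIV fun_eq_iff)
  have annT: "u \<in> vecs ?T" if "u \<in> ?N" for u using that by (simp add: annihilator_def)
  have canon_W: "canon (dual E) \<phi> \<in> W" if \<phi>: "\<phi> \<in> vecs (dual E)" for \<phi>
  proof -
    have mem: "canon (dual E) \<phi> \<in> vecs ?T" by (rule D.canon_mem_bidual[OF \<phi>])
    obtain u w where uw: "u \<in> ?N" "w \<in> W" "canon (dual E) \<phi> = u + w"
      "nrm ?T (canon (dual E) \<phi>) = nrm ?T u + nrm ?T w" using decomp[OF mem] by blast
    have "\<phi> = restriction E w"
      using restr_ann[OF uw(1), of w] restriction_canon[OF \<phi>] uw(3) by simp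
    then have "nrm (dual E) \<phi> \<le> nrm ?T w" using restriction_mem(2) uw(2) WT by auto
    then have "nrm ?T u \<le> 0" using uw(4) D.nrm_canon_le[OF \<phi>] by simp
    then have "u = 0" by (rule DD.dual_eq_zero[OF annT[OF uw(1)]])
    then show ?thesis using uw by simp
  qed
  obtain u w where uw: "u \<in> ?N" "w \<in> W" "\<Phi> = u + w" "nrm ?T \<Phi> = nrm ?T u + nrm ?T w"
    using decomp[OF \<Phi>] by blast
  have w: "w \<in> vecs ?T" using uw(2) WT by blast
  let ?\<phi> = "restriction E \<Phi>"
  have \<phi>: "?\<phi> \<in> vecs (dual E)" by (rule restriction_mem(1)[OF \<Phi>])
  have restr_w: "restriction E w = ?\<phi>" using restr_ann[OF uw(1), of w] uw(3) by simp
  have "canon (dual E) ?\<phi> - w \<in> W" using T.subspace_diff[OF sub canon_W[OF \<phi>] uw(2)] .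
  moreover have "canon (dual E) ?\<phi> - w \<in> ?N"
  proof -
    have "canon (dual E) ?\<phi> - w \<in> vecs ?T"
      using DD.diff_mem_dual[OF D.canon_mem_bidual[OF \<phi>] w] .
    moreover have "canon (dual E) ?\<phi> (canon E x) = w (canon E x)" for x
      using fun_cong[OF restriction_canon[OF \<phi>], of x] fun_cong[OF restr_w, of x]
      by (simp add: restriction_def)
    ultimately show ?thesis by (auto simp: annihilator_def)
  qed
  ultimately have "canon (dual E) ?\<phi> - w = 0"
    using sum unfolding l1_direct_sum_def by blast
  then have eq: "canon (dual E) ?\<phi> = w" by simp
  have "\<Phi> - canon (dual E) ?\<phi> = u" unfolding eq using uw(3) by simp
  moreover have "nrm (dual E) ?\<phi> \<le> nrm ?T w" using restriction_mem(2)[OF w] restr_w by simp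
  ultimately show ?thesis using uw(4) by simp
qed

section \<open>Separability and fragmentability of the dual\<close>

definition linear_comb :: "('k \<times> ('v \<Rightarrow> 'k)) list \<Rightarrow> 'v \<Rightarrow> 'k" where
  "linear_comb l = (\<lambda>x. \<Sum>(c, d)\<leftarrow>l. c * d x)"

lemma linear_comb_simps:
  "linear_comb [] = 0" "linear_comb ((c, d) # l) = (\<lambda>x. c * d x) + linear_comb l"
  "linear_comb (l @ l') = linear_comb l + linear_comb l'"
  by (auto simp: linear_comb_def)

lemma linear_comb_mem:
  assumes "D \<subseteq> vecs (dual E)"
  shows "l \<in> lists (UNIV \<times> D) \<Longrightarrow> linear_comb l \<in> vecs (dual E)"
proof (induction l rule: list.induct)
  case (Cons p l)
  obtain c d where p: "p = (c, d)" by (cases p)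
  have "(\<lambda>x. c * d x) + linear_comb l \<in> vecs (dual E)"
    using Cons assms p by (intro add_mem_dual smul_mem_dual) auto
  then show ?case unfolding p linear_comb_simps .
qed (simp add: linear_comb_simps zero_mem_dual)

lemma linear_comb_scale: "linear_comb (map (\<lambda>(a, d). (c * a, d)) l) = (\<lambda>x. c * linear_comb l x)"
  by (induction l) (auto simp: linear_comb_simps algebra_simps)

lemma linear_comb_approx:
  assumes D: "D \<subseteq> vecs (dual E)" and Q: "\<And>U::'k set. open U \<Longrightarrow> U \<noteq> {} \<Longrightarrow> \<exists>q\<in>Q. q \<in> U"
  shows "l \<in> lists (UNIV \<times> D) \<Longrightarrow> e > 0 \<Longrightarrow>
    \<exists>l'\<in>lists (Q \<times> D). nrm (dual E) (linear_comb l - linear_comb l') < e"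
proof (induction l arbitrary: e rule: list.induct)
  case Nil
  have "nrm (dual E) (linear_comb [] - linear_comb []) = 0"
    unfolding diff_self by (rule D.nrm_zero)
  then have "nrm (dual E) (linear_comb [] - linear_comb []) < e" using Nil by (simp only:)
  then show ?case by (rule bexI[of _ "[]"]) simp
next
  case (Cons p l)
  obtain c d where p: "p = (c, d)" by (cases p)
  have d: "d \<in> D" "d \<in> vecs (dual E)" and l: "l \<in> lists (UNIV \<times> D)"
    using Cons.prems D p by auto
  have nd: "0 \<le> nrm (dual E) d" by (rule dual_nrm_nonneg[OF d(2)])
  obtain l' where l': "l' \<in> lists (Q \<times> D)" "nrm (dual E) (linear_comb l - linear_comb l') < e / 2"
    using Cons.IH[OF l, of "e / 2"] Cons.prems half_gt_zero by blast
  define r where "r = e / (2 * (nrm (dual E) d + 1))"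
  have "r > 0" using Cons.prems nd by (simp add: r_def)
  then obtain q where q: "q \<in> Q" "q \<in> ball c r" using Q[of "ball c r"] by auto
  have "l' \<in> lists (UNIV \<times> D)" using l'(1) by (auto simp: lists_eq_set)
  then have lin: "linear_comb l \<in> vecs (dual E)" "linear_comb l' \<in> vecs (dual E)"
    using linear_comb_mem[OF D] l by blast+
  have "linear_comb ((c, d) # l) - linear_comb ((q, d) # l') =
      (\<lambda>x. (c - q) * d x) + (linear_comb l - linear_comb l')"
    by (auto simp: linear_comb_simps algebra_simps)
  then have "nrm (dual E) (linear_comb ((c, d) # l) - linear_comb ((q, d) # l')) \<le>
      norm (c - q) * nrm (dual E) d + nrm (dual E) (linear_comb l - linear_comb l')"
    using nrm_add_dual[OF smul_mem_dual[OF d(2), of "c - q"] diff_mem_dual[OF lin]]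
      nrm_smul_dual[OF d(2), of "c - q"] by simp
  also have "norm (c - q) * nrm (dual E) d \<le> r * (nrm (dual E) d + 1)"
    using q(2) nd \<open>r > 0\<close> by (intro mult_mono) (auto simp: dist_norm)
  also have "\<dots> = e / 2" using nd by (simp add: r_def field_simps)
  finally have "nrm (dual E) (linear_comb ((c, d) # l) - linear_comb ((q, d) # l')) < e"
    using l'(2) by linarith
  moreover have "(q, d) # l' \<in> lists (Q \<times> D)" using q d l' by auto
  ultimately show ?case unfolding p by blast
qed

text \<open>
  On a countable subset of the unit ball the dual is separable for uniform approximation. Take a
  countable set \<open>D\<close> that is dense for pointwise convergence, with control of the norms. A
  functional of least norm among those with prescribed values on the countable set is a pointwise
  limit of members of \<open>D\<close> of almost the same norm; any weak* limit of these in the third dual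
  cannot have norm larger than its restriction, so by the M-ideal property it is canonical.
  Hence the functional lies in the weak closure, and by separation in the norm closure, of the
  span of \<open>D\<close>.
\<close>

lemma countable_uniform_approximation:
  assumes N: "countable N" "N \<subseteq> unit_ball E"
  shows "\<exists>V. countable V \<and> (\<forall>\<phi>\<in>unit_ball (dual E). \<forall>e>0. \<exists>v\<in>V. \<forall>x\<in>N. norm (\<phi> x - v x) \<le> e)"
proof (cases "N = {}")
  case True
  then show ?thesis by (intro exI[of _ "{0}"]) auto
next
  case False
  define xs where "xs = from_nat_into N"
  have range_xs: "range xs = N" using N(1) False by (simp add: xs_def range_from_nat_into)
  define \<rho> where "\<rho> f i = f (xs i)" for f :: "'v \<Rightarrow> 'k" and i
  define S where "S q = {f \<in> vecs (dual E). nrm (dual E) f \<le> q}" for q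
  have "\<exists>D. countable D \<and> D \<subseteq> S q \<and> (\<forall>U. open U \<longrightarrow> (\<exists>f\<in>S q. \<rho> f \<in> U) \<longrightarrow> (\<exists>f\<in>D. \<rho> f \<in> U))" for q
  proof -
    obtain D' where D': "countable D'" "D' \<subseteq> \<rho> ` S q"
      "\<And>U. open U \<Longrightarrow> U \<inter> \<rho> ` S q \<noteq> {} \<Longrightarrow> U \<inter> D' \<noteq> {}"
      using countable_dense_subset[of "\<rho> ` S q"] by blast
    obtain D where D: "countable D" "D \<subseteq> S q" "D' = \<rho> ` D"
      using D'(1,2) countable_subset_image[of D' \<rho> "S q"] by blast
    then show ?thesis using D'(3) by (intro exI[of _ D]) blast
  qed
  then obtain Dq where Dq: "\<And>q. countable (Dq q)" "\<And>q. Dq q \<subseteq> S q"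
    "\<And>q U f. open U \<Longrightarrow> f \<in> S q \<Longrightarrow> \<rho> f \<in> U \<Longrightarrow> \<exists>f\<in>Dq q. \<rho> f \<in> U"
    by metis
  define D where "D = (\<Union>q\<in>\<rat>. Dq q)"
  have D: "countable D" "D \<subseteq> vecs (dual E)"
    using Dq(1,2) countable_rat by (auto simp: D_def S_def)
  obtain Q :: "'k set" where Q: "countable Q" "\<And>U. open U \<Longrightarrow> U \<noteq> {} \<Longrightarrow> \<exists>q\<in>Q. q \<in> U"
    using countable_dense_setE by blast
  define V where "V = linear_comb ` lists (Q \<times> D)"
  define V' where "V' = linear_comb ` lists (UNIV \<times> D)"
  have V': "V' \<subseteq> vecs (dual E)" using linear_comb_mem[OF D(2)] by (auto simp: V'_def)
  have DV': "D \<subseteq> V'"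
  proof
    fix d assume "d \<in> D"
    then show "d \<in> V'" unfolding V'_def
      by (intro image_eqI[of _ _ "[(1, d)]"]) (auto simp: linear_comb_simps)
  qed
  have V'_0: "0 \<in> V'" unfolding V'_def by (intro image_eqI[of _ _ "[]"]) (auto simp: linear_comb_simps)
  have V'_add: "v + w \<in> V'" if "v \<in> V'" "w \<in> V'" for v w
  proof -
    from that obtain l l' where "l \<in> lists (UNIV \<times> D)" "v = linear_comb l"
      "l' \<in> lists (UNIV \<times> D)" "w = linear_comb l'" by (auto simp: V'_def)
    then show ?thesis unfolding V'_def
      by (intro image_eqI[of _ _ "l @ l'"]) (auto simp: linear_comb_simps)
  qed
  have V'_smul: "smul (dual E) c v \<in> V'" if "v \<in> V'" for c v
  proof -
    from that obtain l where "l \<in> lists (UNIV \<times> D)" "v = linear_comb l" by (auto simp: V'_def)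
    then show ?thesis unfolding V'_def
      by (intro image_eqI[of _ _ "map (\<lambda>(a, d). (c * a, d)) l"]) (auto simp: linear_comb_scale)
  qed
  have "\<exists>v\<in>V. \<forall>x\<in>N. norm (\<phi> x - v x) \<le> e" if \<phi>: "\<phi> \<in> unit_ball (dual E)" and "e > 0" for \<phi> e
  proof -
    define R where "R = nrm (dual E) ` {\<theta> \<in> vecs (dual E). \<forall>x\<in>N. \<theta> x = \<phi> x}"
    define r where "r = Inf R"
    have \<phi>': "\<phi> \<in> vecs (dual E)" "nrm (dual E) \<phi> \<le> 1" using \<phi> by (auto simp: unit_ball_def)
    have R: "nrm (dual E) \<phi> \<in> R" using \<phi>' by (auto simp: R_def)
    have bdd: "bdd_below R" unfolding R_def by (intro bdd_belowI2[where m = 0]) (simp add: dual_nrm_nonneg)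
    have r_le: "r \<le> nrm (dual E) \<theta>" if "\<theta> \<in> vecs (dual E)" "\<And>x. x \<in> N \<Longrightarrow> \<theta> x = \<phi> x" for \<theta>
      unfolding r_def using that by (intro cInf_lower bdd) (auto simp: R_def)
    have r: "0 \<le> r" "r \<le> 1"
      using R bdd cInf_lower[OF R bdd] \<phi>'(2) unfolding r_def
      by (auto simp: R_def dual_nrm_nonneg intro!: cInf_greatest)
    have "\<exists>d\<in>D. nrm (dual E) d \<le> r + inverse (real (Suc n)) \<and>
        (\<forall>i\<le>n. norm (d (xs i) - \<phi> (xs i)) < inverse (real (Suc n)))" for n
    proof -
      have "Inf R < r + inverse (real (Suc n))" by (simp add: r_def)
      then obtain t where "t \<in> R" "t < r + inverse (real (Suc n))"
        using cInf_lessD[of R] R by blast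
      then obtain \<theta> where \<theta>: "\<theta> \<in> vecs (dual E)" "\<And>x. x \<in> N \<Longrightarrow> \<theta> x = \<phi> x"
        "nrm (dual E) \<theta> < r + inverse (real (Suc n))" by (auto simp: R_def)
      obtain q where q: "q \<in> \<rat>" "nrm (dual E) \<theta> < q" "q < r + inverse (real (Suc n))"
        using Rats_dense_in_real[OF \<theta>(3)] by blast
      define U where "U = {g :: nat \<Rightarrow> 'k. \<forall>i\<in>{..n}. g i \<in> ball (\<phi> (xs i)) (inverse (real (Suc n)))}"
      have "open U" unfolding U_def by (rule product_topology_basis') auto
      moreover have "\<rho> \<theta> \<in> U" using \<theta>(2) range_xs by (auto simp: U_def \<rho>_def)
      moreover have "\<theta> \<in> S q" using \<theta>(1) q(2) by (simp add: S_def)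
      ultimately obtain d where d: "d \<in> Dq q" "\<rho> d \<in> U" using Dq(3) by blast
      have "nrm (dual E) d \<le> q" using d(1) Dq(2) by (auto simp: S_def)
      then have "nrm (dual E) d \<le> r + inverse (real (Suc n))" using q(3) by simp
      moreover have "\<forall>i\<le>n. norm (d (xs i) - \<phi> (xs i)) < inverse (real (Suc n))"
        using d(2) by (auto simp: U_def \<rho>_def dist_norm norm_minus_commute)
      moreover have "d \<in> D" using d(1) q(1) by (auto simp: D_def)
      ultimately show ?thesis by blast
    qed
    then obtain d where d: "\<And>n. d n \<in> D" "\<And>n. nrm (dual E) (d n) \<le> r + inverse (real (Suc n))"
      and near: "\<And>n i. i \<le> n \<Longrightarrow> norm (d n (xs i) - \<phi> (xs i)) < inverse (real (Suc n))"
      by metis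
    have dmem: "d n \<in> vecs (dual E)" for n using d(1) D(2) by blast
    have lim: "(\<lambda>n. d n x) \<longlonglongrightarrow> \<phi> x" if "x \<in> N" for x
    proof -
      obtain i where x: "x = xs i" using \<open>x \<in> N\<close> range_xs by blast
      have "(\<lambda>n. d n x - \<phi> x) \<longlonglongrightarrow> 0"
      proof (rule Lim_null_comparison)
        show "\<forall>\<^sub>F n in sequentially. norm (d n x - \<phi> x) \<le> inverse (real (Suc n))"
          unfolding x using near less_imp_le by (intro eventually_sequentiallyI[of i]) blast
        show "(\<lambda>n. inverse (real (Suc n))) \<longlonglongrightarrow> 0" by (rule LIMSEQ_inverse_real_of_nat)
      qed
      then show ?thesis using LIM_zero_iff by blast
    qed
    let ?T = "dual (bidual E)"
    \<comment> \<open>The radius 2 suffices because \<open>r \<le> 1\<close> and the norms of the approximants exceed \<open>r\<close> by at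
      most 1.\<close>
    define K where "K = (\<lambda>\<Psi> z. 2 * \<Psi> z) ` unit_ball ?T"
    have "compact K" unfolding K_def
      by (intro compact_continuous_image DD.compact_unit_ball_dual continuous_on_coordinatewise_then_product
          continuous_intros continuous_on_subset[OF continuous_on_product_coordinates]) auto
    moreover have "canon (dual E) (d n) \<in> K" for n
    proof -
      have mem: "canon (dual E) (d n) \<in> vecs ?T" by (rule D.canon_mem_bidual[OF dmem])
      have "inverse (real (Suc n)) \<le> 1" by (simp add: inverse_le_1_iff)
      then have "nrm (dual E) (d n) \<le> 2" using d(2)[of n] r(2) by linarith
      then have "nrm ?T (canon (dual E) (d n)) \<le> 2" using D.nrm_canon_le[OF dmem[of n]] by linarith
      then have "(\<lambda>z. (1/2) * canon (dual E) (d n) z) \<in> unit_ball ?T"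
        using DD.smul_mem_dual[OF mem, of "1/2"] DD.nrm_smul_dual[OF mem, of "1/2"]
        by (simp add: unit_ball_def norm_divide)
      then show ?thesis unfolding K_def by (rule image_eqI[rotated]) (auto simp: fun_eq_iff)
    qed
    ultimately obtain \<Phi> G where \<Phi>: "\<Phi> \<in> K" "G \<noteq> bot" "\<And>z. ((\<lambda>\<Psi>. \<Psi> z) \<longlongrightarrow> \<Phi> z) G"
      and evG: "\<And>Q. \<forall>\<^sub>F n in sequentially. Q (canon (dual E) (d n)) \<Longrightarrow> \<forall>\<^sub>F \<Psi> in G. Q \<Psi>"
      using cluster_point[of K "\<lambda>n. canon (dual E) (d n)"] by metis
    have \<Phi>_lim: "\<Phi> z = a" if "z \<in> vecs (bidual E)" "(\<lambda>n. z (d n)) \<longlonglongrightarrow> a" for z a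
    proof (rule tendsto_unique[OF \<Phi>(2) \<Phi>(3)])
      show "((\<lambda>\<Psi>. \<Psi> z) \<longlongrightarrow> a) G"
      proof (rule tendstoI)
        fix e :: real assume "e > 0"
        then have "\<forall>\<^sub>F n in sequentially. dist (canon (dual E) (d n) z) a < e"
          using tendstoD[OF that(2)] that(1) by (simp add: canon_def)
        then show "\<forall>\<^sub>F \<Psi> in G. dist (\<Psi> z) a < e" by (rule evG)
      qed
    qed
    have \<Phi>T: "\<Phi> \<in> vecs ?T" using \<Phi>(1) DD.smul_mem_dual[of _ 2] by (auto simp: K_def unit_ball_def)
    have "norm (\<Phi> z) \<le> r * nrm (bidual E) z" if z: "z \<in> vecs (bidual E)" for z
    proof (rule field_le_epsilon)
      fix \<epsilon> :: real assume "\<epsilon> > 0"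
      have nz: "0 \<le> nrm (bidual E) z" by (rule D.dual_nrm_nonneg[OF z])
      have "(\<lambda>n. inverse (real (Suc n)) * nrm (bidual E) z) \<longlonglongrightarrow> 0 * nrm (bidual E) z"
        by (intro tendsto_mult_right LIMSEQ_inverse_real_of_nat)
      then have "\<forall>\<^sub>F n in sequentially. inverse (real (Suc n)) * nrm (bidual E) z < \<epsilon>"
        using \<open>\<epsilon> > 0\<close> by (intro order_tendstoD(2)) auto
      then have "\<forall>\<^sub>F n in sequentially. norm (canon (dual E) (d n) z) \<le> r * nrm (bidual E) z + \<epsilon>"
      proof eventually_elim
        case (elim n)
        have "norm (canon (dual E) (d n) z) = norm (z (d n))" using z by (simp add: canon_def)
        also have "\<dots> \<le> nrm (bidual E) z * nrm (dual E) (d n)" by (rule D.dual_le_nrm[OF z dmem])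
        also have "\<dots> \<le> nrm (bidual E) z * (r + inverse (real (Suc n)))"
          using d(2) nz by (rule mult_left_mono)
        also have "\<dots> = r * nrm (bidual E) z + inverse (real (Suc n)) * nrm (bidual E) z"
          by (simp add: algebra_simps)
        finally show ?case using elim by linarith
      qed
      then have "\<forall>\<^sub>F \<Psi> in G. norm (\<Psi> z) \<le> r * nrm (bidual E) z + \<epsilon>" by (rule evG)
      then show "norm (\<Phi> z) \<le> r * nrm (bidual E) z + \<epsilon>"
        by (rule tendsto_upperbound[OF tendsto_norm[OF \<Phi>(3)] _ \<Phi>(2)])
    qed
    then have nrm_\<Phi>: "nrm ?T \<Phi> \<le> r" using r(1) by (intro DD.dual_nrm_leI)
    define \<theta> where "\<theta> = restriction E \<Phi>"
    have \<theta>: "\<theta> \<in> vecs (dual E)" unfolding \<theta>_def by (rule restriction_mem(1)[OF \<Phi>T])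
    have \<theta>_eq: "\<theta> x = \<phi> x" if "x \<in> N" for x
      unfolding \<theta>_def restriction_def
      by (rule \<Phi>_lim) (use lim[OF that] dmem in \<open>simp_all add: canon_mem_bidual canon_apply vecs_UNIV\<close>)
    have "nrm ?T (\<Phi> - canon (dual E) \<theta>) \<le> 0"
      using norm_restriction_add[OF \<Phi>T] nrm_\<Phi> r_le[OF \<theta> \<theta>_eq] by (simp add: \<theta>_def)
    then have "\<Phi> - canon (dual E) \<theta> = 0"
      by (rule DD.dual_eq_zero[OF DD.diff_mem_dual[OF \<Phi>T D.canon_mem_bidual[OF \<theta>]]])
    then have \<Phi>_eq: "\<Phi> = canon (dual E) \<theta>" by simp
    have "\<exists>v\<in>V'. nrm (dual E) (\<theta> - v) < e / 2"
    proof (rule ccontr)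
      assume "\<not> ?thesis"
      then have far: "e / 2 \<le> nrm (dual E) (\<theta> - v)" if "v \<in> V'" for v using that by force
      obtain z where z: "z \<in> vecs (bidual E)" "z \<theta> \<noteq> 0" "\<And>v. v \<in> V' \<Longrightarrow> z v = 0"
        using D.separation_from_subspace[OF module_dual V' V'_0 V'_add V'_smul \<theta> _ far] \<open>e > 0\<close>
        by (metis half_gt_zero)
      have "z (d n) = 0" for n using z(3) d(1) DV' by blast
      then have "\<Phi> z = 0" using z(1) by (intro \<Phi>_lim) auto
      then show False using z(1,2) by (simp add: \<Phi>_eq canon_def)
    qed
    then obtain l where l: "l \<in> lists (UNIV \<times> D)" "nrm (dual E) (\<theta> - linear_comb l) < e / 2"
      by (auto simp: V'_def)
    obtain l' where l': "l' \<in> lists (Q \<times> D)" "nrm (dual E) (linear_comb l - linear_comb l') < e / 2"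
      using linear_comb_approx[OF D(2) Q(2) l(1), of "e / 2"] \<open>e > 0\<close> by auto
    have "l' \<in> lists (UNIV \<times> D)" using l'(1) by (auto simp: lists_eq_set)
    then have lin: "linear_comb l \<in> vecs (dual E)" "linear_comb l' \<in> vecs (dual E)"
      using linear_comb_mem[OF D(2)] l(1) by blast+
    have "norm (\<phi> x - linear_comb l' x) \<le> e" if "x \<in> N" for x
    proof -
      have x: "x \<in> vecs E" "nrm E x \<le> 1" using that N(2) by (auto simp: unit_ball_def)
      have le: "norm (f x) \<le> nrm (dual E) f" if "f \<in> vecs (dual E)" for f
        using dual_le_nrm[OF that x(1)] mult_left_le[OF x(2) dual_nrm_nonneg[OF that]] by linarith
      have "\<phi> x - linear_comb l' x = (\<theta> - linear_comb l) x + (linear_comb l - linear_comb l') x"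
        using \<theta>_eq[OF that] by simp
      then have "norm (\<phi> x - linear_comb l' x) \<le>
          norm ((\<theta> - linear_comb l) x) + norm ((linear_comb l - linear_comb l') x)"
        by (simp only: norm_triangle_ineq)
      then show ?thesis
        using le[OF diff_mem_dual[OF \<theta> lin(1)]] le[OF diff_mem_dual[OF lin]] l(2) l'(2) by linarith
    qed
    then show ?thesis using l'(1) by (auto simp: V_def)
  qed
  moreover have "countable V" unfolding V_def using Q(1) D(1) by (intro countable_image countable_lists) auto
  ultimately show ?thesis by blast
qed

end


context M_embedded
begin

primrec branch_prefix :: "(nat \<Rightarrow> bool) \<Rightarrow> nat \<Rightarrow> bool list" where
  "branch_prefix b 0 = []"
| "branch_prefix b (Suc n) = b n # branch_prefix b n"

lemma branch_prefix_cong: "(\<And>i. i < n \<Longrightarrow> b i = b' i) \<Longrightarrow> branch_prefix b n = branch_prefix b' n"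
  by (induction n) auto

lemma nrm_gt_obtain:
  assumes "f \<in> vecs (dual E)" "\<eta> < nrm (dual E) f"
  obtains x where "x \<in> unit_ball E" "\<eta> < norm (f x)"
proof -
  have "\<eta> < (SUP x\<in>unit_ball E. norm (f x))" using assms(2) by (simp add: dual_def)
  then show thesis
    using less_cSUP_iff[OF _ dual_bdd_above[OF assms(1)], of \<eta>] zero_in_unit_ball that by auto
qed

text \<open>
  If no relatively open part of a compact set is small in norm, repeated splitting gives a
  dyadic tree of open sets whose branches are uniformly separated by countably many vectors.
\<close>

lemma dyadic_tree:
  assumes S: "S \<subseteq> unit_ball (dual E)" "compact S" "S \<noteq> {}"
    and large: "\<And>U. open U \<Longrightarrow> U \<inter> S \<noteq> {} \<Longrightarrow> \<exists>\<phi>\<in>U \<inter> S. \<exists>\<psi>\<in>U \<inter> S. \<eta> < nrm (dual E) (\<phi> - \<psi>)"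
    and "\<eta> > 0"
  obtains N F where "countable N" "N \<subseteq> unit_ball E" "\<And>b::nat \<Rightarrow> bool. F b \<in> S"
    "\<And>b b'. b \<noteq> b' \<Longrightarrow> \<exists>x\<in>N. \<eta> / 3 < norm (F b x - F b' x)"
proof -
  have "\<exists>x \<phi> \<psi>. x \<in> unit_ball E \<and> \<phi> \<in> U \<inter> S \<and> \<psi> \<in> U \<inter> S \<and> \<eta> < norm (\<phi> x - \<psi> x)"
    if U: "open U" "U \<inter> S \<noteq> {}" for U
  proof -
    obtain \<phi> \<psi> where fg: "\<phi> \<in> U \<inter> S" "\<psi> \<in> U \<inter> S" "\<eta> < nrm (dual E) (\<phi> - \<psi>)"
      using large[OF U] by blast
    then have "\<phi> - \<psi> \<in> vecs (dual E)" using S(1) by (intro diff_mem_dual) (auto simp: unit_ball_def)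
    then obtain x where "x \<in> unit_ball E" "\<eta> < norm ((\<phi> - \<psi>) x)" using nrm_gt_obtain fg(3) by blast
    then show ?thesis using fg by auto
  qed
  then obtain X p q where pick: "\<And>U. open U \<Longrightarrow> U \<inter> S \<noteq> {} \<Longrightarrow>
      X U \<in> unit_ball E \<and> p U \<in> U \<inter> S \<and> q U \<in> U \<inter> S \<and> \<eta> < norm (p U (X U) - q U (X U))"
    by metis
  \<comment> \<open>In the addresses of the tree the most recent turn comes first.\<close>
  define c where "c U t = (if t then p U else q U)" for U and t :: bool
  define W where "W = rec_list UNIV (\<lambda>t _ U. {\<theta> \<in> U. norm (\<theta> (X U) - c U t (X U)) < \<eta> / 3})"
  have W_simps: "W [] = UNIV"
    "W (t # ts) = {\<theta> \<in> W ts. norm (\<theta> (X (W ts)) - c (W ts) t (X (W ts))) < \<eta> / 3}" for t ts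
    by (simp_all add: W_def)
  have W: "open (W ts) \<and> W ts \<inter> S \<noteq> {}" for ts
  proof (induction ts)
    case Nil
    then show ?case using S(3) by (simp add: W_simps)
  next
    case (Cons t ts)
    have "open {\<theta> :: 'v \<Rightarrow> 'k. norm (\<theta> (X (W ts)) - c (W ts) t (X (W ts))) < \<eta> / 3}"
      by (intro open_Collect_less continuous_intros continuous_on_product_coordinates)
    moreover have "W (t # ts) = W ts \<inter> {\<theta>. norm (\<theta> (X (W ts)) - c (W ts) t (X (W ts))) < \<eta> / 3}"
      by (auto simp: W_simps)
    ultimately have "open (W (t # ts))" using Cons by auto
    moreover have "c (W ts) t \<in> W (t # ts) \<inter> S"
      using pick[of "W ts"] Cons \<open>\<eta> > 0\<close> by (auto simp: W_simps c_def)
    ultimately show ?case by blast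
  qed
  note pickW = pick[OF conjunct1[OF W] conjunct2[OF W]]
  have "\<exists>\<theta>\<in>S. \<forall>n. norm (\<theta> (X (W (branch_prefix b n))) -
      c (W (branch_prefix b n)) (b n) (X (W (branch_prefix b n)))) \<le> \<eta> / 3" for b
  proof -
    have "\<exists>\<theta>. \<theta> \<in> W (branch_prefix b n) \<inter> S" for n using W by blast
    then obtain \<theta> where \<theta>: "\<And>n. \<theta> n \<in> W (branch_prefix b n) \<inter> S" by metis
    obtain \<theta>0 G where \<theta>0: "\<theta>0 \<in> S" "G \<noteq> bot" "\<And>x. ((\<lambda>h. h x) \<longlongrightarrow> \<theta>0 x) G"
      and ev: "\<And>Q. \<forall>\<^sub>F n in sequentially. Q (\<theta> n) \<Longrightarrow> \<forall>\<^sub>F h in G. Q h"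
      using cluster_point[OF S(2), of \<theta>] \<theta> by (metis IntD2)
    have mono: "W (branch_prefix b n) \<subseteq> W (branch_prefix b m)" if "m \<le> n" for m n
      using that by (induction rule: dec_induct) (auto simp: W_simps)
    have "norm (\<theta>0 (X (W (branch_prefix b n))) -
      c (W (branch_prefix b n)) (b n) (X (W (branch_prefix b n)))) \<le> \<eta> / 3" (is "norm (\<theta>0 ?x - ?a) \<le> _") for n
    proof (rule tendsto_upperbound[OF _ _ \<theta>0(2)])
      show "((\<lambda>h. norm (h ?x - ?a)) \<longlongrightarrow> norm (\<theta>0 ?x - ?a)) G"
        by (intro tendsto_intros \<theta>0(3))
      have "norm (\<theta> m ?x - ?a) \<le> \<eta> / 3" if "m \<ge> Suc n" for m
        using \<theta>[of m] mono[OF that] by (auto simp: W_simps)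
      then show "\<forall>\<^sub>F h in G. norm (h ?x - ?a) \<le> \<eta> / 3"
        by (intro ev eventually_sequentiallyI[of "Suc n"])
    qed
    then show ?thesis using \<theta>0(1) by blast
  qed
  then obtain F where F: "\<And>b. F b \<in> S" "\<And>b n. norm (F b (X (W (branch_prefix b n))) -
      c (W (branch_prefix b n)) (b n) (X (W (branch_prefix b n)))) \<le> \<eta> / 3"
    by metis
  define N where "N = range (\<lambda>ts. X (W ts))"
  show thesis
  proof (rule that[of N F])
    show "countable N" unfolding N_def by (intro countable_image) simp
    show "N \<subseteq> unit_ball E" unfolding N_def using pickW by blast
    show "F b \<in> S" for b by (rule F(1))
    fix b b' :: "nat \<Rightarrow> bool" assume "b \<noteq> b'"
    then have "\<exists>n. b n \<noteq> b' n" by auto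
    define n where "n = (LEAST n. b n \<noteq> b' n)"
    have n: "b n \<noteq> b' n" unfolding n_def by (rule LeastI_ex) fact
    have "b i = b' i" if "i < n" for i using not_less_Least[of i "\<lambda>n. b n \<noteq> b' n"] that by (auto simp: n_def)
    then have eq: "branch_prefix b' n = branch_prefix b n" by (intro branch_prefix_cong) auto
    let ?U = "W (branch_prefix b n)"
    let ?x = "X ?U"
    have far: "\<eta> < norm (p ?U ?x - q ?U ?x)" using pickW by blast
    have near: "norm (F b ?x - c ?U (b n) ?x) \<le> \<eta> / 3" "norm (F b' ?x - c ?U (b' n) ?x) \<le> \<eta> / 3"
      using F(2)[of b n] F(2)[of b' n] by (simp_all add: eq)
    have "\<eta> < norm (c ?U (b n) ?x - c ?U (b' n) ?x)"
      using far n by (auto simp: c_def norm_minus_commute)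
    also have "\<dots> = norm ((F b ?x - F b' ?x) - (F b ?x - c ?U (b n) ?x) + (F b' ?x - c ?U (b' n) ?x))"
      by (simp add: algebra_simps)
    also have "\<dots> \<le> norm (F b ?x - F b' ?x) + norm (F b ?x - c ?U (b n) ?x) + norm (F b' ?x - c ?U (b' n) ?x)"
      by (intro order_trans[OF norm_triangle_ineq] add_mono norm_triangle_ineq4 order_refl)
    finally have "\<eta> / 3 < norm (F b ?x - F b' ?x)" using near by simp
    then show "\<exists>x\<in>N. \<eta> / 3 < norm (F b x - F b' x)" by (auto simp: N_def)
  qed
qed

lemma uncountable_branches: "uncountable (UNIV :: (nat \<Rightarrow> bool) set)"
proof
  assume "countable (UNIV :: (nat \<Rightarrow> bool) set)"
  then obtain f :: "(nat \<Rightarrow> bool) \<Rightarrow> nat" where "inj f" by (auto simp: countable_def)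
  then have "surj (inv f)" by (rule inj_imp_surj_inv)
  then obtain n where "inv f n = (\<lambda>i. \<not> inv f i i)" by (metis surjD)
  then show False by (metis)
qed

text \<open>
  The weak* topology of the dual ball is fragmented by the norm: the uncountably many branches
  of a dyadic tree would contradict the separability of the dual over the countable set that
  separates them.
\<close>

lemma fragmentability:
  assumes S: "S \<subseteq> unit_ball (dual E)" "compact S" "S \<noteq> {}" and "\<eta> > 0"
  obtains U where "open U" "U \<inter> S \<noteq> {}" "\<And>\<phi> \<psi>. \<phi> \<in> U \<inter> S \<Longrightarrow> \<psi> \<in> U \<inter> S \<Longrightarrow> nrm (dual E) (\<phi> - \<psi>) \<le> \<eta>"
proof -
  have "\<exists>U. open U \<and> U \<inter> S \<noteq> {} \<and> (\<forall>\<phi>\<in>U \<inter> S. \<forall>\<psi>\<in>U \<inter> S. nrm (dual E) (\<phi> - \<psi>) \<le> \<eta>)"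
  proof (rule ccontr)
    assume not: "\<not> ?thesis"
    have "\<exists>\<phi>\<in>U \<inter> S. \<exists>\<psi>\<in>U \<inter> S. \<eta> < nrm (dual E) (\<phi> - \<psi>)" if "open U" "U \<inter> S \<noteq> {}" for U
      using not that by (meson not_le)
    then obtain N F where N: "countable N" "N \<subseteq> unit_ball E" and F: "\<And>b::nat \<Rightarrow> bool. F b \<in> S"
      and sep: "\<And>b b'. b \<noteq> b' \<Longrightarrow> \<exists>x\<in>N. \<eta> / 3 < norm (F b x - F b' x)"
      using dyadic_tree[OF S _ \<open>\<eta> > 0\<close>] by metis
    obtain V where V: "countable V"
      and appr: "\<And>\<phi> e. \<phi> \<in> unit_ball (dual E) \<Longrightarrow> e > 0 \<Longrightarrow> \<exists>v\<in>V. \<forall>x\<in>N. norm (\<phi> x - v x) \<le> e"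
      using countable_uniform_approximation[OF N] by blast
    \<comment> \<open>Half of the separation of the branches, so that approximants of different branches differ.\<close>
    have "\<exists>v\<in>V. \<forall>x\<in>N. norm (F b x - v x) \<le> \<eta> / 6" for b
      using appr[of "F b" "\<eta> / 6"] F[of b] S(1) \<open>\<eta> > 0\<close> by auto
    then obtain v where v: "\<And>b. v b \<in> V" "\<And>b x. x \<in> N \<Longrightarrow> norm (F b x - v b x) \<le> \<eta> / 6" by metis
    have "inj v"
    proof (rule injI, rule ccontr)
      fix b b' assume eq: "v b = v b'" and "b \<noteq> b'"
      then obtain x where x: "x \<in> N" "\<eta> / 3 < norm (F b x - F b' x)" using sep by blast
      have "norm (F b x - F b' x) \<le> norm (F b x - v b x) + norm (F b' x - v b x)"
        using norm_triangle_ineq4[of "F b x - v b x" "F b' x - v b x"] by simp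
      then show False using v(2)[OF x(1), of b] v(2)[OF x(1), of b'] x(2) eq by simp
    qed
    moreover have "countable (range v)" using V v(1) by (intro countable_subset[OF _ V]) auto
    ultimately have "countable (UNIV :: (nat \<Rightarrow> bool) set)" using countable_image_inj_on by blast
    then show False using uncountable_branches by blast
  qed
  then show thesis using that by blast
qed

section \<open>Norm tightness of regular measures on the dual ball\<close>

definition dual_ball_cover :: "real \<Rightarrow> ('v \<Rightarrow> 'k) set \<Rightarrow> ('v \<Rightarrow> 'k) set" where
  "dual_ball_cover \<eta> F = (\<Union>\<psi>\<in>F. {\<phi> \<in> unit_ball (dual E). nrm (dual E) (\<phi> - \<psi>) \<le> \<eta>})"

lemma closed_dual_ball_cover:
  "finite F \<Longrightarrow> F \<subseteq> unit_ball (dual E) \<Longrightarrow> 0 \<le> \<eta> \<Longrightarrow> closed (dual_ball_cover \<eta> F)"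
  unfolding dual_ball_cover_def by (intro closed_UN ballI closed_ball_dual) auto

lemma dual_ball_cover_sets:
  assumes "finite F" "F \<subseteq> unit_ball (dual E)" "0 \<le> \<eta>"
  shows "dual_ball_cover \<eta> F \<in> sets (dual_ball_space E)"
proof -
  have "dual_ball_cover \<eta> F = unit_ball (dual E) \<inter> dual_ball_cover \<eta> F"
    by (auto simp: dual_ball_cover_def)
  then show ?thesis
    using closed_dual_ball_cover[OF assms] by (auto simp: sets_restrict_space)
qed

text \<open>
  Fragmentability is applied to the support of the measure on a compact set, all of whose
  nonempty relatively open parts have positive mass.
\<close>

lemma norm_small_part_of_positive_measure:
  assumes "finite_measure N" and sets_N: "sets N = sets (dual_ball_space E)"
    and reg: "compact_inner_regular N" and A: "A \<in> sets N" "measure N A > 0" and "\<eta> > 0"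
  obtains C \<psi> where "C \<in> sets N" "C \<subseteq> A" "measure N C > 0" "\<psi> \<in> unit_ball (dual E)"
    "C \<subseteq> dual_ball_cover \<eta> {\<psi>}"
proof -
  interpret finite_measure N by fact
  have space_N: "space N = unit_ball (dual E)" using sets_eq_imp_space_eq[OF sets_N] by simp
  have inner: "\<exists>K. compact K \<and> K \<subseteq> A \<and> measure N (A - K) < e" if "A \<in> sets N" "e > 0" for A e
    using reg that unfolding compact_inner_regular_def by blast
  have compact_sets: "K \<in> sets N" if "compact K" "K \<subseteq> unit_ball (dual E)" for K
    unfolding sets_N by (rule compact_in_sets[OF that])
  obtain K where K: "compact K" "K \<subseteq> A" "measure N (A - K) < measure N A" using inner[OF A] by blast
  have K_ball: "K \<subseteq> unit_ball (dual E)" using K(2) sets.sets_into_space[OF A(1)] space_N by auto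
  have K_sets: "K \<in> sets N" by (rule compact_sets[OF K(1) K_ball])
  have K_pos: "measure N K > 0" using finite_measure_Diff[OF A(1) K_sets K(2)] K(3) by simp
  have open_sets: "K \<inter> Y \<in> sets N" if "open Y" for Y
  proof -
    have "K \<inter> Y = K \<inter> (unit_ball (dual E) \<inter> Y)" using K_ball by auto
    moreover have "unit_ball (dual E) \<inter> Y \<in> sets N" using that by (auto simp: sets_N sets_restrict_space)
    ultimately show ?thesis using K_sets by (metis sets.Int)
  qed
  define Z where "Z = \<Union>{Y. open Y \<and> measure N (K \<inter> Y) = 0}"
  have Z: "open Z" by (auto simp: Z_def)
  define S where "S = K - Z"
  have S_compact: "compact S" unfolding S_def by (rule compact_diff[OF K(1) Z])
  have S_sets: "S \<in> sets N" using S_compact K_ball by (intro compact_sets) (auto simp: S_def)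
  have null: "measure N (K \<inter> Z) = 0"
  proof (rule ccontr)
    assume "measure N (K \<inter> Z) \<noteq> 0"
    then have "measure N (K \<inter> Z) > 0" by (simp add: zero_less_measure_iff)
    then obtain L where L: "compact L" "L \<subseteq> K \<inter> Z" "measure N (K \<inter> Z - L) < measure N (K \<inter> Z)"
      using inner[OF open_sets[OF Z]] by blast
    have L_sets: "L \<in> sets N" using L K_ball by (intro compact_sets) auto
    have "measure N L > 0" using finite_measure_Diff[OF open_sets[OF Z] L_sets L(2)] L(3) by simp
    obtain \<O> where \<O>: "\<O> \<subseteq> {Y. open Y \<and> measure N (K \<inter> Y) = 0}" "finite \<O>" "L \<subseteq> \<Union>\<O>"
    proof (rule compactE[OF L(1), of "{Y. open Y \<and> measure N (K \<inter> Y) = 0}"])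
      show "L \<subseteq> \<Union>{Y. open Y \<and> measure N (K \<inter> Y) = 0}" using L(2) unfolding Z_def by blast
    qed blast+
    have Y_sets: "(\<lambda>Y. K \<inter> Y) ` \<O> \<subseteq> sets N" using \<O>(1) open_sets by blast
    have "(\<Union>Y\<in>\<O>. K \<inter> Y) \<in> sets N" by (rule sets.finite_UN[OF \<O>(2)]) (use Y_sets in blast)
    moreover have "L \<subseteq> (\<Union>Y\<in>\<O>. K \<inter> Y)" using L(2) \<O>(3) by blast
    ultimately have "measure N L \<le> measure N (\<Union>Y\<in>\<O>. K \<inter> Y)" by (intro finite_measure_mono)
    also have "\<dots> \<le> (\<Sum>Y\<in>\<O>. measure N (K \<inter> Y))"
      by (rule finite_measure_subadditive_finite[OF \<O>(2) Y_sets])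
    also have "\<dots> = 0" using \<O>(1) by (intro sum.neutral) auto
    finally show False using \<open>measure N L > 0\<close> by simp
  qed
  have "S \<noteq> {}"
  proof
    assume "S = {}"
    then have "K \<inter> Z = K" by (auto simp: S_def)
    then show False using null K_pos by simp
  qed
  have "S \<subseteq> unit_ball (dual E)" using K_ball by (auto simp: S_def)
  obtain U where U: "open U" "U \<inter> S \<noteq> {}"
    and small: "\<And>\<phi> \<psi>. \<phi> \<in> U \<inter> S \<Longrightarrow> \<psi> \<in> U \<inter> S \<Longrightarrow> nrm (dual E) (\<phi> - \<psi>) \<le> \<eta>"
    by (rule fragmentability[OF \<open>S \<subseteq> unit_ball (dual E)\<close> S_compact \<open>S \<noteq> {}\<close> \<open>\<eta> > 0\<close>]) blast
  then obtain \<psi> where \<psi>: "\<psi> \<in> U \<inter> S" by blast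
  have "measure N (K \<inter> U) \<noteq> 0"
    using U(1) \<psi> unfolding S_def Z_def by blast
  have US_sets: "K \<inter> U - K \<inter> Z \<in> sets N" using open_sets U(1) Z by blast
  have "measure N (K \<inter> U) \<le> measure N ((K \<inter> U - K \<inter> Z) \<union> (K \<inter> Z))"
    using open_sets[OF U(1)] open_sets[OF Z] by (intro finite_measure_mono) auto
  also have "\<dots> \<le> measure N (K \<inter> U - K \<inter> Z) + measure N (K \<inter> Z)"
    using US_sets open_sets[OF Z] by (rule measure_Un_le)
  finally have "measure N (K \<inter> U - K \<inter> Z) > 0"
    using null \<open>measure N (K \<inter> U) \<noteq> 0\<close> measure_nonneg[of N "K \<inter> U"] by linarith
  moreover have US: "K \<inter> U - K \<inter> Z = U \<inter> S" by (auto simp: S_def)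
  moreover have "U \<inter> S \<subseteq> dual_ball_cover \<eta> {\<psi>}"
    using small[OF _ \<psi>] \<open>S \<subseteq> unit_ball (dual E)\<close> by (auto simp: dual_ball_cover_def)
  moreover have "U \<inter> S \<subseteq> A" using K(2) by (auto simp: S_def)
  moreover have "\<psi> \<in> unit_ball (dual E)" using \<psi> \<open>S \<subseteq> unit_ball (dual E)\<close> by blast
  moreover have "U \<inter> S \<in> sets N" using US_sets US by simp
  ultimately show thesis using that[of "U \<inter> S" \<psi>] by simp
qed

text \<open>
  Exhaustion: finite unions of norm balls that carry the mass up to its supremum must carry all
  of it, since a remainder of positive mass would contain a further norm-small part.
\<close>

theorem norm_tightness:
  assumes "finite_measure N" and sets_N: "sets N = sets (dual_ball_space E)"
    and reg: "compact_inner_regular N" and "\<eta> > 0" "\<epsilon> > 0"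
  obtains F where "finite F" "F \<subseteq> unit_ball (dual E)"
    "measure N (unit_ball (dual E) - dual_ball_cover \<eta> F) < \<epsilon>"
proof -
  interpret finite_measure N by fact
  have space_N: "space N = unit_ball (dual E)" using sets_eq_imp_space_eq[OF sets_N] by simp
  define \<F> where "\<F> = {F. finite F \<and> F \<subseteq> unit_ball (dual E)}"
  define s where "s = (SUP F\<in>\<F>. measure N (dual_ball_cover \<eta> F))"
  have cover_sets: "dual_ball_cover \<eta> F \<in> sets N" if "F \<in> \<F>" for F
    using that dual_ball_cover_sets[of F \<eta>] \<open>\<eta> > 0\<close> by (simp add: \<F>_def sets_N)
  have le_s: "measure N (dual_ball_cover \<eta> F) \<le> s" if "F \<in> \<F>" for F
    unfolding s_def using that by (intro cSUP_upper bdd_aboveI2[where M = "measure N (space N)"])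
      (auto intro: bounded_measure)
  have "\<exists>F\<in>\<F>. s - inverse (real (Suc n)) < measure N (dual_ball_cover \<eta> F)" for n
  proof -
    have "\<F> \<noteq> {}" by (auto simp: \<F>_def)
    moreover have "s - inverse (real (Suc n)) < Sup ((\<lambda>F. measure N (dual_ball_cover \<eta> F)) ` \<F>)"
      by (simp add: s_def)
    ultimately show ?thesis using less_cSupD[of "(\<lambda>F. measure N (dual_ball_cover \<eta> F)) ` \<F>"] by auto
  qed
  then obtain F where F: "\<And>n. F n \<in> \<F>" "\<And>n. s - inverse (real (Suc n)) < measure N (dual_ball_cover \<eta> (F n))"
    by metis
  define U where "U = (\<Union>n. dual_ball_cover \<eta> (F n))"
  have U_sets: "U \<in> sets N" unfolding U_def using cover_sets F(1) by auto
  have rest_sets: "space N - U \<in> sets N" using U_sets by auto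
  have rest: "measure N (space N - U) = 0"
  proof (rule ccontr)
    assume "measure N (space N - U) \<noteq> 0"
    then have "measure N (space N - U) > 0" by (simp add: zero_less_measure_iff)
    then obtain C \<psi> where C: "C \<in> sets N" "C \<subseteq> space N - U" "measure N C > 0" "\<psi> \<in> unit_ball (dual E)"
      "C \<subseteq> dual_ball_cover \<eta> {\<psi>}"
      using norm_small_part_of_positive_measure[OF assms(1,2,3) rest_sets _ \<open>\<eta> > 0\<close>] by blast
    obtain n where n: "inverse (real (Suc n)) < measure N C" using reals_Archimedean[OF C(3)] by blast
    have F': "insert \<psi> (F n) \<in> \<F>" using F(1)[of n] C(4) by (auto simp: \<F>_def)
    have disj: "dual_ball_cover \<eta> (F n) \<inter> C = {}" using C(2) by (auto simp: U_def)
    have "measure N (dual_ball_cover \<eta> (F n)) + measure N C = measure N (dual_ball_cover \<eta> (F n) \<union> C)"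
      using cover_sets[OF F(1)] C(1) disj by (intro finite_measure_Union[symmetric]) auto
    also have "\<dots> \<le> measure N (dual_ball_cover \<eta> (insert \<psi> (F n)))"
      using C(5) by (intro finite_measure_mono cover_sets[OF F']) (auto simp: dual_ball_cover_def)
    also have "\<dots> \<le> s" by (rule le_s[OF F'])
    finally show False using F(2)[of n] n by linarith
  qed
  define H where "H n = (\<Union>i\<le>n. F i)" for n
  have H: "H n \<in> \<F>" for n using F(1) by (auto simp: H_def \<F>_def)
  have cover_H: "dual_ball_cover \<eta> (H n) = (\<Union>i\<le>n. dual_ball_cover \<eta> (F i))" for n
    by (auto simp: H_def dual_ball_cover_def)
  have "(\<lambda>n. measure N (dual_ball_cover \<eta> (H n))) \<longlonglongrightarrow> measure N (\<Union>n. dual_ball_cover \<eta> (H n))"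
    using cover_sets[OF H] by (intro finite_Lim_measure_incseq) (auto simp: cover_H incseq_def intro: order_trans)
  moreover have "(\<Union>n. dual_ball_cover \<eta> (H n)) = U" by (auto simp: cover_H U_def)
  moreover have "measure N U = measure N (space N)"
    using rest finite_measure_compl[OF U_sets] by simp
  ultimately have "(\<lambda>n. measure N (dual_ball_cover \<eta> (H n))) \<longlonglongrightarrow> measure N (space N)" by simp
  then have "\<forall>\<^sub>F n in sequentially. measure N (space N) - \<epsilon> < measure N (dual_ball_cover \<eta> (H n))"
    using \<open>\<epsilon> > 0\<close> by (intro order_tendstoD(1)) auto
  then obtain n where n: "measure N (space N) - \<epsilon> < measure N (dual_ball_cover \<eta> (H n))"
    by (auto simp: eventually_sequentially)
  show thesis
  proof (rule that[of "H n"])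
    show "measure N (unit_ball (dual E) - dual_ball_cover \<eta> (H n)) < \<epsilon>"
      using n finite_measure_compl[OF cover_sets[OF H]] by (simp add: space_N)
  qed (use H[of n] in \<open>auto simp: \<F>_def\<close>)
qed

end


section \<open>Measures concentrated near the canonical copy of the dual\<close>

lemma norm_prod_list_diff_le:
  fixes f g :: "'b \<Rightarrow> 'k::real_normed_field"
  assumes "\<And>z. z \<in> set zs \<Longrightarrow> norm (f z) \<le> B z" "\<And>z. z \<in> set zs \<Longrightarrow> norm (g z) \<le> B z"
    and "\<And>z. z \<in> set zs \<Longrightarrow> norm (f z - g z) \<le> \<eta> * B z"
  shows "norm (prod_list (map f zs) - prod_list (map g zs)) \<le> real (length zs) * \<eta> * prod_list (map B zs)"
  using assms
proof (induction zs)
  case (Cons z zs)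
  let ?f = "prod_list (map f zs)" and ?g = "prod_list (map g zs)" and ?B = "prod_list (map B zs)"
  have IH: "norm (?f - ?g) \<le> real (length zs) * \<eta> * ?B" using Cons by simp
  have B: "0 \<le> B y" if "y \<in> set (z # zs)" for y
    using norm_ge_zero order_trans Cons.prems(1)[OF that] by blast
  have f_le: "norm ?f \<le> ?B"
    using Cons.prems(1) B
  proof (induction zs)
    case (Cons y ys)
    then show ?case by (auto simp: norm_mult intro!: mult_mono)
  qed simp
  have "f z * ?f - g z * ?g = (f z - g z) * ?f + g z * (?f - ?g)" by (simp add: algebra_simps)
  then have "norm (f z * ?f - g z * ?g) \<le> norm (f z - g z) * norm ?f + norm (g z) * norm (?f - ?g)"
    by (metis norm_mult norm_triangle_ineq)
  also have "\<dots> \<le> (\<eta> * B z) * ?B + B z * (real (length zs) * \<eta> * ?B)"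
    using Cons.prems(2,3)[of z] f_le IH B[of z]
    by (intro add_mono mult_mono order_trans[OF norm_ge_zero]) auto
  finally show ?case by (simp add: algebra_simps)
qed simp

context M_embedded
begin

abbreviation third_ball where "third_ball \<equiv> unit_ball (dual (bidual E))"

lemma canon_unit_ball: "\<phi> \<in> unit_ball (dual E) \<Longrightarrow> canon (dual E) \<phi> \<in> third_ball"
  using D.canon_mem_bidual[of \<phi>] D.nrm_canon_le[of \<phi>] by (auto simp: unit_ball_def)

definition far_from_canonical :: "real \<Rightarrow> ('v \<Rightarrow> 'k) set \<Rightarrow> ((('v \<Rightarrow> 'k) \<Rightarrow> 'k) \<Rightarrow> 'k) set" where
  "far_from_canonical \<eta> F =
     {\<Phi> \<in> third_ball. \<forall>\<phi>\<in>F. \<eta> < nrm (dual (bidual E)) (\<Phi> - canon (dual E) \<phi>)}"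

lemma near_canonical_sets:
  assumes "\<phi> \<in> unit_ball (dual E)" "0 \<le> \<eta>"
  shows "{\<Phi> \<in> third_ball. nrm (dual (bidual E)) (\<Phi> - canon (dual E) \<phi>) \<le> \<eta>} \<in>
    sets (dual_ball_space (bidual E))"
    (is "?S \<in> _")
proof -
  have "closed ?S" using assms by (intro DD.closed_ball_dual canon_unit_ball)
  then have "?S \<in> sets borel" by (rule borel_closed)
  moreover have "?S = third_ball \<inter> ?S" by blast
  ultimately show ?thesis unfolding sets_restrict_space by (rule image_eqI[rotated])
qed

lemma far_from_canonical_sets:
  assumes "finite F" "F \<subseteq> unit_ball (dual E)" "0 \<le> \<eta>"
  shows "far_from_canonical \<eta> F \<in> sets (dual_ball_space (bidual E))"
proof -
  have "far_from_canonical \<eta> F = third_ball -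
      (\<Union>\<phi>\<in>F. {\<Phi> \<in> third_ball. nrm (dual (bidual E)) (\<Phi> - canon (dual E) \<phi>) \<le> \<eta>})"
    by (auto simp: far_from_canonical_def not_le)
  also have "\<dots> \<in> sets (dual_ball_space (bidual E))"
    using assms sets.top[of "dual_ball_space (bidual E)"]
    by (intro sets.Diff sets.finite_UN near_canonical_sets) auto
  finally show ?thesis .
qed

lemma nearest_canonical_simple_function:
  assumes "finite F" "F \<subseteq> unit_ball (dual E)" "0 \<le> \<eta>"
  shows "\<exists>c. simple_function (dual_ball_space (bidual E)) c \<and> range c \<subseteq> unit_ball (dual E) \<and>
    (\<forall>\<Phi>\<in>third_ball - far_from_canonical \<eta> F. nrm (dual (bidual E)) (\<Phi> - canon (dual E) (c \<Phi>)) \<le> \<eta>)"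
  using assms(1,2)
proof (induction F rule: finite_induct)
  case empty
  then show ?case using D.zero_in_unit_ball
    by (intro exI[of _ "\<lambda>_. 0"]) (auto simp: far_from_canonical_def zero_fun_def)
next
  case (insert \<phi> F)
  then obtain c where c: "simple_function (dual_ball_space (bidual E)) c" "range c \<subseteq> unit_ball (dual E)"
    "\<And>\<Phi>. \<Phi> \<in> third_ball - far_from_canonical \<eta> F \<Longrightarrow> nrm (dual (bidual E)) (\<Phi> - canon (dual E) (c \<Phi>)) \<le> \<eta>"
    by blast
  let ?near = "\<lambda>\<Phi>. nrm (dual (bidual E)) (\<Phi> - canon (dual E) \<phi>) \<le> \<eta>"
  define c' where "c' \<Phi> = (if ?near \<Phi> then \<phi> else c \<Phi>)" for \<Phi>
  have "simple_function (dual_ball_space (bidual E)) c'"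
    unfolding c'_def using near_canonical_sets[of \<phi> \<eta>] insert.prems assms(3)
    by (intro simple_function_If c(1) simple_function_const) (simp_all only: space_dual_ball_space insert_subset)
  moreover have "range c' \<subseteq> unit_ball (dual E)" using c(2) insert.prems by (auto simp: c'_def)
  moreover have "nrm (dual (bidual E)) (\<Phi> - canon (dual E) (c' \<Phi>)) \<le> \<eta>"
    if far: "\<Phi> \<in> third_ball - far_from_canonical \<eta> (insert \<phi> F)" for \<Phi>
  proof (cases "?near \<Phi>")
    case True
    then have "c' \<Phi> = \<phi>" by (simp only: c'_def if_True)
    then show ?thesis using True by (simp only:)
  next
    case False
    then have "c' \<Phi> = c \<Phi>" by (simp only: c'_def if_False)
    moreover have "\<Phi> \<in> third_ball - far_from_canonical \<eta> F"
      using far False by (auto simp: far_from_canonical_def)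
    ultimately show ?thesis using c(3) by (simp only:)
  qed
  ultimately show ?case by blast
qed

text \<open>
  Replacing each functional by a nearby canonical one turns the form of a measure on the third
  dual ball into a finite sum of products of evaluations at functionals on \<open>E\<close>, up to a uniformly
  small error.
\<close>

lemma finite_type_approximation:
  assumes bv: "bv_measure (dual_ball_space (bidual E)) \<mu>"
    and F: "finite F" "F \<subseteq> unit_ball (dual E)" and "0 \<le> \<eta>"
    and far: "measure (variation_measure (dual_ball_space (bidual E)) \<mu>) (far_from_canonical \<eta> F) \<le> \<epsilon>"
  obtains G a where "finite G" "G \<subseteq> unit_ball (dual E)"
    "\<And>zs. zs \<in> bidual_lists \<Longrightarrow>
      norm (form_of_measure (bidual E) \<mu> zs - (\<Sum>\<phi>\<in>G. a \<phi> * prod_list (map (\<lambda>z. z \<phi>) zs))) \<le>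
      (real (length zs) * \<eta> * measure (variation_measure (dual_ball_space (bidual E)) \<mu>) third_ball + 2 * \<epsilon>) *
      prod_list (map (nrm (bidual E)) zs)"
proof -
  let ?M = "dual_ball_space (bidual E)"
  interpret bv_measure ?M \<mu> by fact
  obtain c where c: "simple_function ?M c" "range c \<subseteq> unit_ball (dual E)"
    "\<And>\<Phi>. \<Phi> \<in> third_ball - far_from_canonical \<eta> F \<Longrightarrow> nrm (dual (bidual E)) (\<Phi> - canon (dual E) (c \<Phi>)) \<le> \<eta>"
    using nearest_canonical_simple_function[OF F \<open>0 \<le> \<eta>\<close>] by blast
  define G where "G = c ` third_ball"
  define a where "a \<phi> = \<mu> (c -` {\<phi>} \<inter> third_ball)" for \<phi>
  have far_sets: "far_from_canonical \<eta> F \<in> sets m"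
    using far_from_canonical_sets[OF F \<open>0 \<le> \<eta>\<close>] by simp
  show thesis
  proof (rule that[of G a])
    show "finite G" using simple_functionD(1)[OF c(1)] by (simp add: G_def)
    show "G \<subseteq> unit_ball (dual E)" using c(2) by (auto simp: G_def)
    fix zs assume zs: "zs \<in> bidual_lists"
    let ?P = "prod_list (map (nrm (bidual E)) zs)"
    have P: "0 \<le> ?P" by (rule DD.prod_list_nrm_nonneg[OF zs])
    let ?f = "\<lambda>\<Phi>. prod_list (map \<Phi> zs)" and ?g = "\<lambda>\<Phi>. prod_list (map (\<lambda>z. z (c \<Phi>)) zs)"
    have inter: "far_from_canonical \<eta> F \<inter> third_ball = far_from_canonical \<eta> F"
      by (auto simp: far_from_canonical_def)
    have g: "simple_function ?M ?g" by (rule simple_function_compose1[OF c(1)])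
    have f_bm: "bounded_measurable ?M ?f" by (rule DD.bounded_measurable_eval'[OF zs])
    have g_bm: "bounded_measurable ?M ?g" by (rule bounded_measurable_simple[OF g])
    have bm: "bounded_measurable ?M (\<lambda>\<Phi>. ?f \<Phi> + (-1) * ?g \<Phi>)"
      by (rule bounded_measurable_add[OF f_bm bounded_measurable_cmult[OF g_bm]])
    have "scalar_integral ?M \<mu> ?g = (\<Sum>\<phi>\<in>G. a \<phi> * prod_list (map (\<lambda>z. z \<phi>) zs))"
      unfolding scalar_integral_eqI[OF has_scalar_integral_simple[OF g]]
      using simple_integral_compose[OF c(1), of "\<lambda>\<phi>. prod_list (map (\<lambda>z. z \<phi>) zs)"]
      by (simp add: G_def a_def mult.commute)
    then have "form_of_measure (bidual E) \<mu> zs - (\<Sum>\<phi>\<in>G. a \<phi> * prod_list (map (\<lambda>z. z \<phi>) zs)) =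
        scalar_integral ?M \<mu> (\<lambda>\<Phi>. ?f \<Phi> + (-1) * ?g \<Phi>)"
      unfolding scalar_integral_add[OF f_bm bounded_measurable_cmult[OF g_bm]] scalar_integral_cmult[OF g_bm]
      by (simp add: form_of_measure_def)
    also have "norm \<dots> \<le> (\<integral>\<Phi>. norm (?f \<Phi> + (-1) * ?g \<Phi>) \<partial>m)"
      by (rule norm_scalar_integral_le[OF bm])
    also have "\<dots> \<le> (\<integral>\<Phi>. real (length zs) * \<eta> * ?P + 2 * ?P * indicator (far_from_canonical \<eta> F) \<Phi> \<partial>m)"
    proof (rule integral_mono)
      show "integrable m (\<lambda>\<Phi>. norm (?f \<Phi> + (-1) * ?g \<Phi>))" by (rule integrable_norm_bounded[OF bm])
      show "integrable m (\<lambda>\<Phi>. real (length zs) * \<eta> * ?P + 2 * ?P * indicator (far_from_canonical \<eta> F) \<Phi>)"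
        using far_sets m.emeasure_finite[of "far_from_canonical \<eta> F"]
        by (intro Bochner_Integration.integrable_add integrable_mult_right integrable_real_indicator)
          (auto simp: less_top[symmetric])
      fix \<Phi> assume "\<Phi> \<in> space m"
      then have \<Phi>: "\<Phi> \<in> third_ball" by simp
      have \<Phi>_le: "norm (\<Phi> z) \<le> nrm (bidual E) z" if "z \<in> set zs" for z
        using DD.unit_ball_dual_le[OF \<Phi>] zs that by auto
      have c\<Phi>: "c \<Phi> \<in> unit_ball (dual E)" using c(2) by auto
      have c_le: "norm (z (c \<Phi>)) \<le> nrm (bidual E) z" if "z \<in> set zs" for z
        using DD.unit_ball_dual_le[OF canon_unit_ball[OF c\<Phi>], of z] zs that by (auto simp: canon_def)
      have 1: "norm (?f \<Phi> + (-1) * ?g \<Phi>) = norm (?f \<Phi> - ?g \<Phi>)" by simp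
      show "norm (?f \<Phi> + (-1) * ?g \<Phi>) \<le>
          real (length zs) * \<eta> * ?P + 2 * ?P * indicator (far_from_canonical \<eta> F) \<Phi>"
      proof (cases "\<Phi> \<in> far_from_canonical \<eta> F")
        case True
        have "norm (?f \<Phi> - ?g \<Phi>) \<le> norm (?f \<Phi>) + norm (?g \<Phi>)" by (rule norm_triangle_ineq4)
        also have "norm (?f \<Phi>) \<le> ?P" by (rule DD.norm_prod_list_eval_le[OF \<Phi> zs])
        also have "norm (?g \<Phi>) \<le> ?P"
        proof -
          have "?g \<Phi> = prod_list (map (canon (dual E) (c \<Phi>)) zs)"
            using zs by (intro arg_cong[where f = prod_list] map_cong refl) (auto simp: canon_def)
          then show ?thesis using DD.norm_prod_list_eval_le[OF canon_unit_ball[OF c\<Phi>] zs] by simp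
        qed
        finally show ?thesis unfolding 1 using True P \<open>0 \<le> \<eta>\<close> by (simp add: add_increasing)
      next
        case False
        have diff: "norm (\<Phi> z - z (c \<Phi>)) \<le> \<eta> * nrm (bidual E) z" if "z \<in> set zs" for z
        proof -
          have z: "z \<in> vecs (bidual E)" using zs that by auto
          have "\<Phi> - canon (dual E) (c \<Phi>) \<in> vecs (dual (bidual E))"
            using \<Phi> canon_unit_ball[OF c\<Phi>] by (intro DD.diff_mem_dual) (auto simp: unit_ball_def)
          from DD.dual_le_of_nrm[OF this c(3) z] \<Phi> False z show ?thesis by (simp add: canon_def)
        qed
        have "norm (?f \<Phi> - ?g \<Phi>) \<le> real (length zs) * \<eta> * ?P"
          by (rule norm_prod_list_diff_le[OF \<Phi>_le c_le diff])
        then show ?thesis unfolding 1 using False by simp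
      qed
    qed
    also have "\<dots> = real (length zs) * \<eta> * ?P * measure m third_ball +
        2 * ?P * measure m (far_from_canonical \<eta> F)"
      using far_sets m.emeasure_finite[of "far_from_canonical \<eta> F"]
      by (subst Bochner_Integration.integral_add)
        (auto intro!: integrable_mult_right integrable_real_indicator simp: less_top[symmetric] inter
          mult.commute)
    also have "\<dots> \<le> real (length zs) * \<eta> * ?P * measure m third_ball + 2 * ?P * \<epsilon>"
      using far P by (intro add_left_mono mult_left_mono) auto
    finally show "norm (form_of_measure (bidual E) \<mu> zs - (\<Sum>\<phi>\<in>G. a \<phi> * prod_list (map (\<lambda>z. z \<phi>) zs))) \<le>
        (real (length zs) * \<eta> * measure m third_ball + 2 * \<epsilon>) * ?P"
      by (simp add: algebra_simps)
  qed
qed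

lemma prod_list_nrm_canon_le:
  "prod_list (map (nrm (bidual E)) (map (canon E) xs)) \<le> prod_list (map (nrm E) xs)"
proof (induction xs)
  case (Cons x xs)
  have "map (canon E) xs \<in> bidual_lists"
    using canon_mem_bidual by (auto simp: lists_eq_set vecs_UNIV)
  then show ?case
    using Cons nrm_canon_le[of x] DD.prod_list_nrm_nonneg[of "map (canon E) xs"] nrm_nonneg[of x]
    by (auto simp: vecs_UNIV intro!: mult_mono)
qed simp

lemma symmetric_form_canon:
  assumes "symmetric_form (bidual E) k B"
  shows "symmetric_form E k (\<lambda>xs. B (map (canon E) xs))"
proof -
  have sym: "symmetric_multilinear (bidual E) k B" using assms by (simp add: symmetric_form_iff)
  obtain C where C: "\<And>zs. zs \<in> bidual_lists \<Longrightarrow> length zs = k \<Longrightarrow>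
      norm (B zs) \<le> C * prod_list (map (nrm (bidual E)) zs)"
    using assms unfolding symmetric_form_iff by blast
  have mem: "map (canon E) xs \<in> bidual_lists" for xs
    using canon_mem_bidual by (auto simp: lists_eq_set vecs_UNIV)
  have "symmetric_multilinear E k (\<lambda>xs. B (map (canon E) xs))"
    unfolding symmetric_multilinear_def
  proof (intro ballI impI conjI allI)
    fix xs i assume "xs \<in> lists (vecs E)" "length xs = k" "i < k"
    then have lin: "linear_form (bidual E) (\<lambda>z. B ((map (canon E) xs)[i := z]))"
      by (intro symmetric_multilinear_linear[OF sym mem]) auto
    show "linear_form E (\<lambda>x. B (map (canon E) (xs[i := x])))"
      unfolding linear_form_def map_update
    proof (intro conjI ballI allI)
      fix x y assume x: "x \<in> vecs E" and y: "y \<in> vecs E"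
      show "B ((map (canon E) xs)[i := canon E (x + y)]) =
          B ((map (canon E) xs)[i := canon E x]) + B ((map (canon E) xs)[i := canon E y])"
        unfolding canon_add[OF x y] by (rule linear_form_add[OF lin canon_mem_bidual[OF x] canon_mem_bidual[OF y]])
    next
      fix c x assume x: "x \<in> vecs E"
      show "B ((map (canon E) xs)[i := canon E (smul E c x)]) = c * B ((map (canon E) xs)[i := canon E x])"
        using linear_form_smul[OF lin canon_mem_bidual[OF x], of c] by (simp add: canon_smul[OF x])
    qed
  next
    fix xs ys assume "xs \<in> lists (vecs E)" "length xs = k" "mset ys = mset xs"
    then show "B (map (canon E) ys) = B (map (canon E) xs)"
      by (intro symmetric_multilinear_mset[OF sym mem]) auto
  qed
  moreover have "norm (B (map (canon E) xs)) \<le> \<bar>C\<bar> * prod_list (map (nrm E) xs)" if "length xs = k" for xs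
  proof -
    have "norm (B (map (canon E) xs)) \<le> C * prod_list (map (nrm (bidual E)) (map (canon E) xs))"
      using that by (intro C mem) simp
    also have "\<dots> \<le> \<bar>C\<bar> * prod_list (map (nrm E) xs)"
      using DD.prod_list_nrm_nonneg[OF mem[of xs]]
      by (intro mult_mono prod_list_nrm_canon_le) auto
    finally show ?thesis .
  qed
  ultimately show ?thesis unfolding symmetric_form_iff by blast
qed

lemma bounded_multilinear_prod:
  assumes "\<phi> \<in> unit_ball (dual E)"
  shows "bounded_multilinear n 1 (\<lambda>xs. prod_list (map \<phi> xs))"
proof (rule bounded_multilinearI)
  fix xs :: "'v list" and i assume "length xs = n" "i < n"
  then have "prod_list (map \<phi> (xs[i := x])) = \<phi> x * prod_list ((map \<phi> xs)[i := 1])" for x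
    unfolding map_update by (subst prod_list_update_one) auto
  then show "linear_form E (\<lambda>x. prod_list (map \<phi> (xs[i := x])))"
    using assms by (auto simp: linear_form_def unit_ball_dual_iff algebra_simps)
qed (use norm_prod_list_eval_le[OF assms] in \<open>auto simp: vecs_UNIV\<close>)

lemma iterated_eval_prod:
  assumes "\<phi> \<in> vecs (dual E)" "set zs \<subseteq> vecs (bidual E)"
  shows "iterated_eval zs (\<lambda>xs. c * prod_list (map \<phi> xs)) = c * prod_list (map (\<lambda>z. z \<phi>) zs)"
  using assms(2)
proof (induction zs arbitrary: c)
  case (Cons z zs)
  let ?p = "prod_list (map (\<lambda>z. z \<phi>) zs)"
  have z: "z \<in> vecs (bidual E)" using Cons.prems by simp
  have "iterated_eval zs (\<lambda>xs. c * prod_list (map \<phi> (x # xs))) = (c * ?p) * \<phi> x" for x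
    using Cons.IH[of "c * \<phi> x"] Cons.prems by (simp add: mult_ac)
  then have "iterated_eval (z # zs) (\<lambda>xs. c * prod_list (map \<phi> xs)) = z (\<lambda>x. (c * ?p) * \<phi> x)" by simp
  also have "\<dots> = c * ?p * z \<phi>" using dual_smul[OF z assms(1), of "c * ?p"] by simp
  finally show ?case by (simp add: mult_ac)
qed simp

lemma iterated_eval_finite_type:
  assumes zs: "zs \<in> bidual_lists" and "finite G" "G \<subseteq> unit_ball (dual E)"
  shows "\<exists>C. bounded_multilinear (length zs) C (\<lambda>xs. \<Sum>\<phi>\<in>G. a \<phi> * prod_list (map \<phi> xs))"
    and "iterated_eval zs (\<lambda>xs. \<Sum>\<phi>\<in>G. a \<phi> * prod_list (map \<phi> xs)) =
      (\<Sum>\<phi>\<in>G. a \<phi> * prod_list (map (\<lambda>z. z \<phi>) zs))"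
proof -
  have zero: "bounded_multilinear (length zs) 0 (\<lambda>_. 0)"
    by (rule bounded_multilinearI) (auto simp: linear_form_def)
  have "(\<exists>C. bounded_multilinear (length zs) C (\<lambda>xs. \<Sum>\<phi>\<in>G. a \<phi> * prod_list (map \<phi> xs))) \<and>
      iterated_eval zs (\<lambda>xs. \<Sum>\<phi>\<in>G. a \<phi> * prod_list (map \<phi> xs)) =
      (\<Sum>\<phi>\<in>G. a \<phi> * prod_list (map (\<lambda>z. z \<phi>) zs))"
    using assms(2,3)
  proof (induction G rule: finite_induct)
    case empty
    then show ?case using zero norm_iterated_eval_le[OF zs zero] by auto
  next
    case (insert \<phi> G)
    then obtain C where C: "bounded_multilinear (length zs) C (\<lambda>xs. \<Sum>\<phi>\<in>G. a \<phi> * prod_list (map \<phi> xs))"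
      and IH: "iterated_eval zs (\<lambda>xs. \<Sum>\<phi>\<in>G. a \<phi> * prod_list (map \<phi> xs)) =
        (\<Sum>\<phi>\<in>G. a \<phi> * prod_list (map (\<lambda>z. z \<phi>) zs))" by auto
    have \<phi>: "\<phi> \<in> unit_ball (dual E)" using insert.prems by simp
    have eq: "(\<lambda>xs. \<Sum>\<phi>\<in>insert \<phi> G. a \<phi> * prod_list (map \<phi> xs)) =
        (\<lambda>xs. (\<Sum>\<phi>\<in>G. a \<phi> * prod_list (map \<phi> xs)) + a \<phi> * prod_list (map \<phi> xs))"
      using insert.hyps by (simp add: add.commute)
    have "iterated_eval zs (\<lambda>xs. prod_list (map \<phi> xs)) = prod_list (map (\<lambda>z. z \<phi>) zs)"
      using iterated_eval_prod[of \<phi> zs 1] \<phi> zs by (auto simp: unit_ball_def)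
    then show ?case
      unfolding eq iterated_eval_lincomb[OF zs C bounded_multilinear_prod[OF \<phi>]]
      using bounded_multilinear_lincomb[OF C bounded_multilinear_prod[OF \<phi>]] insert.hyps IH
      by (auto simp: add.commute)
  qed
  then show "\<exists>C. bounded_multilinear (length zs) C (\<lambda>xs. \<Sum>\<phi>\<in>G. a \<phi> * prod_list (map \<phi> xs))"
    and "iterated_eval zs (\<lambda>xs. \<Sum>\<phi>\<in>G. a \<phi> * prod_list (map \<phi> xs)) =
      (\<Sum>\<phi>\<in>G. a \<phi> * prod_list (map (\<lambda>z. z \<phi>) zs))" by blast+
qed

text \<open>
  For such finite sums the iterated evaluation is again evaluation, so a measure that is nearly
  carried by the canonical copy of the dual nearly represents the Aron-Berner extension of the
  polynomial it induces on \<open>E\<close>.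
\<close>

lemma aron_berner_near_representation:
  assumes \<mu>: "\<mu> \<in> representing_measures (bidual E) k Q" and extends: "\<And>x. Q (canon E x) = P x"
    and F: "finite F" "F \<subseteq> unit_ball (dual E)" and "0 \<le> \<eta>"
    and far: "measure (variation_measure (dual_ball_space (bidual E)) \<mu>) (far_from_canonical \<eta> F) \<le> \<epsilon>"
    and z: "z \<in> vecs (bidual E)"
  shows "norm (aron_berner E k P z - Q z) \<le>
    2 * (real k * \<eta> * measure (variation_measure (dual_ball_space (bidual E)) \<mu>) third_ball + 2 * \<epsilon>) *
      nrm (bidual E) z ^ k"
proof -
  let ?m = "variation_measure (dual_ball_space (bidual E)) \<mu>"
  define \<delta> where "\<delta> = real k * \<eta> * measure ?m third_ball + 2 * \<epsilon>"
  have "0 \<le> \<epsilon>" using far measure_nonneg order_trans by blast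
  then have \<delta>: "0 \<le> \<delta>" using \<open>0 \<le> \<eta>\<close> by (simp add: \<delta>_def)
  have bv: "bv_measure (dual_ball_space (bidual E)) \<mu>"
    using \<mu> by (simp add: DD.representing_measures_iff regular_borel_bv_iff)
  have assocQ: "associated_form (bidual E) k Q (form_of_measure (bidual E) \<mu>)"
    by (rule DD.associated_form_of_measure[OF \<mu>])
  define A where "A xs = form_of_measure (bidual E) \<mu> (map (canon E) xs)" for xs
  have assocP: "associated_form E k P A"
    unfolding associated_form_def
  proof
    show "symmetric_form E k A"
      using assocQ symmetric_form_canon unfolding A_def associated_form_def by blast
    show "\<forall>x\<in>vecs E. P x = A (replicate k x)"
    proof
      fix x assume "x \<in> vecs E"
      then have "Q (canon E x) = form_of_measure (bidual E) \<mu> (replicate k (canon E x))"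
        using assocQ canon_mem_bidual unfolding associated_form_def by blast
      then show "P x = A (replicate k x)" by (simp only: extends A_def map_replicate)
    qed
  qed
  obtain C where A: "bounded_multilinear k C A"
    by (rule bounded_multilinear_of_symmetric_form[of k A]) (use assocP in \<open>simp_all add: associated_form_def\<close>)
  obtain G a where G: "finite G" "G \<subseteq> unit_ball (dual E)"
    and appr': "\<And>zs. zs \<in> bidual_lists \<Longrightarrow>
      norm (form_of_measure (bidual E) \<mu> zs - (\<Sum>\<phi>\<in>G. a \<phi> * prod_list (map (\<lambda>z. z \<phi>) zs))) \<le>
      (real (length zs) * \<eta> * measure ?m third_ball + 2 * \<epsilon>) * prod_list (map (nrm (bidual E)) zs)"
    by (rule finite_type_approximation[OF bv F \<open>0 \<le> \<eta>\<close> far]) blast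
  have appr: "norm (form_of_measure (bidual E) \<mu> zs - (\<Sum>\<phi>\<in>G. a \<phi> * prod_list (map (\<lambda>z. z \<phi>) zs))) \<le>
      \<delta> * prod_list (map (nrm (bidual E)) zs)" if "zs \<in> bidual_lists" "length zs = k" for zs
    using appr'[OF that(1)] unfolding that(2) \<delta>_def .
  define T where "T xs = (\<Sum>\<phi>\<in>G. a \<phi> * prod_list (map \<phi> xs))" for xs
  define zs where "zs = replicate k z"
  have zs: "zs \<in> bidual_lists" "length zs = k" using z by (auto simp: zs_def lists_eq_set)
  obtain C' where T: "bounded_multilinear k C' T"
    using iterated_eval_finite_type(1)[OF zs(1) G, of a] zs(2) by (auto simp: T_def[abs_def])
  have evalT: "iterated_eval zs T = (\<Sum>\<phi>\<in>G. a \<phi> * prod_list (map (\<lambda>z. z \<phi>) zs))"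
    using iterated_eval_finite_type(2)[OF zs(1) G, of a] by (simp add: T_def[abs_def])
  have AT: "bounded_multilinear k \<delta> (\<lambda>xs. A xs + (-1) * T xs)"
  proof (rule bounded_multilinearI)
    fix xs :: "'v list" assume xs: "length xs = k"
    have mem: "map (canon E) xs \<in> bidual_lists"
      using canon_mem_bidual by (auto simp: lists_eq_set vecs_UNIV)
    have "T xs = (\<Sum>\<phi>\<in>G. a \<phi> * prod_list (map (\<lambda>z. z \<phi>) (map (canon E) xs)))"
      unfolding T_def using G(2)
      by (intro sum.cong refl arg_cong2[where f = "(*)"] arg_cong[where f = prod_list])
        (auto simp: canon_def unit_ball_def)
    then have "norm (A xs + (-1) * T xs) \<le> \<delta> * prod_list (map (nrm (bidual E)) (map (canon E) xs))"
      using appr[OF mem] xs by (simp add: A_def)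
    also have "\<dots> \<le> \<delta> * prod_list (map (nrm E) xs)"
      using \<delta> by (intro mult_left_mono prod_list_nrm_canon_le)
    finally show "norm (A xs + (-1) * T xs) \<le> \<delta> * prod_list (map (nrm E) xs)" .
  qed (rule bounded_multilinear_linear[OF bounded_multilinear_lincomb[OF A T]])
  have "norm (iterated_eval zs (\<lambda>xs. A xs + (-1) * T xs)) \<le> \<delta> * prod_list (map (nrm (bidual E)) zs)"
    using AT \<delta> zs by (intro norm_iterated_eval_le) auto
  also have "iterated_eval zs (\<lambda>xs. A xs + (-1) * T xs) = iterated_eval zs A - iterated_eval zs T"
    using iterated_eval_lincomb[OF zs(1), of C A C' T "-1"] A T zs(2) by simp
  finally have 1: "norm (iterated_eval zs A - iterated_eval zs T) \<le> \<delta> * nrm (bidual E) z ^ k"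
    by (simp add: zs_def prod_list_replicate)
  have 2: "norm (Q z - iterated_eval zs T) \<le> \<delta> * nrm (bidual E) z ^ k"
  proof -
    have "Q z = form_of_measure (bidual E) \<mu> zs"
      using assocQ z by (simp add: associated_form_def zs_def)
    then show ?thesis using appr[OF zs] unfolding evalT by (simp add: zs_def prod_list_replicate)
  qed
  have "aron_berner E k P z - Q z = (iterated_eval zs A - iterated_eval zs T) - (Q z - iterated_eval zs T)"
    using aron_berner_eq[OF assocP z] by (simp add: zs_def)
  then have "norm (aron_berner E k P z - Q z) \<le>
      norm (iterated_eval zs A - iterated_eval zs T) + norm (Q z - iterated_eval zs T)"
    by (simp only: norm_triangle_ineq4)
  also have "\<dots> \<le> \<delta> * nrm (bidual E) z ^ k + \<delta> * nrm (bidual E) z ^ k" by (rule add_mono[OF 1 2])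
  finally show ?thesis unfolding \<delta>_def by (simp only: mult_2 distrib_right)
qed

end


section \<open>Existence and uniqueness of the norm preserving extension\<close>

lemma zero_if_norm_le_small_multiples:
  fixes d :: "'b::real_normed_vector"
  assumes "\<And>t. 0 < t \<Longrightarrow> t < 1 \<Longrightarrow> norm d \<le> t * K"
  shows "d = 0"
proof (rule ccontr)
  assume "d \<noteq> 0"
  then have d: "norm d > 0" by simp
  then have K: "K > 0" using assms[of "1/2"] by linarith
  define t where "t = min (1/2) (norm d / (2 * K))"
  have "0 < t" "t < 1" using d K by (auto simp: t_def)
  then have "norm d \<le> t * K" by (rule assms)
  also have "\<dots> \<le> norm d / (2 * K) * K" using K by (intro mult_right_mono) (auto simp: t_def)
  also have "\<dots> < norm d" using d K by simp
  finally show False by simp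
qed

context M_embedded
begin

lemma nrm_canon_diff_le:
  assumes "\<phi> \<in> unit_ball (dual E)" "\<psi> \<in> unit_ball (dual E)"
  shows "nrm (dual (bidual E)) (canon (dual E) \<phi> - canon (dual E) \<psi>) \<le> nrm (dual E) (\<phi> - \<psi>)"
proof -
  have mem: "\<phi> \<in> vecs (dual E)" "\<psi> \<in> vecs (dual E)" using assms by (auto simp: unit_ball_def)
  have "canon (dual E) \<phi> = canon (dual E) (\<phi> - \<psi>) + canon (dual E) \<psi>"
    using D.canon_add[OF diff_mem_dual[OF mem] mem(2)] by simp
  then have "canon (dual E) \<phi> - canon (dual E) \<psi> = canon (dual E) (\<phi> - \<psi>)" by simp
  then show ?thesis using D.nrm_canon_le[OF diff_mem_dual[OF mem]] by (simp only:)
qed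

lemma nrm_diff_commute:
  assumes "\<phi> \<in> vecs (dual E)" "\<psi> \<in> vecs (dual E)"
  shows "nrm (dual E) (\<phi> - \<psi>) = nrm (dual E) (\<psi> - \<phi>)"
proof -
  have "(\<lambda>x. (-1) * (\<psi> - \<phi>) x) = \<phi> - \<psi>" by auto
  then show ?thesis using nrm_smul_dual[OF diff_mem_dual[OF assms(2,1)], of "-1"] by simp
qed

lemma nrm_diff_triangle:
  assumes "\<phi> \<in> vecs (dual E)" "\<psi> \<in> vecs (dual E)" "\<theta> \<in> vecs (dual E)"
  shows "nrm (dual E) (\<phi> - \<psi>) \<le> nrm (dual E) (\<phi> - \<theta>) + nrm (dual E) (\<psi> - \<theta>)"
proof -
  have "\<phi> - \<psi> = (\<phi> - \<theta>) + (\<theta> - \<psi>)" by simp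
  then show ?thesis
    using nrm_add_dual[OF diff_mem_dual[OF assms(1,3)] diff_mem_dual[OF assms(3,2)]]
      nrm_diff_commute[OF assms(3,2)] by (simp only:)
qed

text \<open>
  On a norm totally bounded set the weak* topology is that of the norm: finitely many of the
  covering balls, which are weak* closed, miss a given point and can be avoided by a
  neighbourhood. Hence the canonical embedding, which is norm continuous, is continuous there.
\<close>

lemma continuous_on_canon_totally_bounded:
  assumes C: "C \<subseteq> unit_ball (dual E)"
    and tb: "\<And>\<eta>. \<eta> > 0 \<Longrightarrow> \<exists>F. finite F \<and> F \<subseteq> unit_ball (dual E) \<and> C \<subseteq> dual_ball_cover \<eta> F"
  shows "continuous_on C (canon (dual E))"
proof (rule continuous_on_coordinatewise_then_product)
  fix z :: "('v \<Rightarrow> 'k) \<Rightarrow> 'k"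
  show "continuous_on C (\<lambda>\<phi>. canon (dual E) \<phi> z)"
  proof (cases "z \<in> vecs (bidual E)")
    case False
    then show ?thesis by (simp add: canon_def)
  next
    case z: True
    show ?thesis
      unfolding continuous_on_topological
    proof (intro ballI allI impI)
      fix \<phi> B assume \<phi>: "\<phi> \<in> C" and B: "open B" "canon (dual E) \<phi> z \<in> B"
      then obtain e where e: "e > 0" "ball (canon (dual E) \<phi> z) e \<subseteq> B" using open_contains_ball by blast
      have nz: "0 \<le> nrm (bidual E) z" by (rule D.dual_nrm_nonneg[OF z])
      define \<eta> where "\<eta> = e / (2 * (nrm (bidual E) z + 1))"
      have \<eta>: "\<eta> > 0" using e(1) nz by (simp add: \<eta>_def)
      have small: "nrm (bidual E) z * (2 * \<eta>) < e"
      proof -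
        have "\<eta> * (2 * (nrm (bidual E) z + 1)) = e"
          unfolding \<eta>_def using nz by (intro iffD1[OF nonzero_eq_divide_eq]) auto
        then show ?thesis using \<eta> by (simp add: algebra_simps)
      qed
      obtain F where F: "finite F" "F \<subseteq> unit_ball (dual E)" "C \<subseteq> dual_ball_cover \<eta> F" using tb[OF \<eta>] by blast
      define F' where "F' = {\<theta> \<in> F. \<eta> < nrm (dual E) (\<phi> - \<theta>)}"
      have "closed (dual_ball_cover \<eta> F')"
        using F \<eta> by (intro closed_dual_ball_cover) (auto simp: F'_def)
      moreover have "\<phi> \<notin> dual_ball_cover \<eta> F'" by (auto simp: dual_ball_cover_def F'_def)
      moreover have "canon (dual E) \<psi> z \<in> B" if \<psi>: "\<psi> \<in> C" "\<psi> \<in> - dual_ball_cover \<eta> F'" for \<psi>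
      proof -
        obtain \<theta> where \<theta>: "\<theta> \<in> F" "nrm (dual E) (\<psi> - \<theta>) \<le> \<eta>" "\<psi> \<in> unit_ball (dual E)"
          using \<psi>(1) F(3) unfolding dual_ball_cover_def by blast
        then have "\<theta> \<notin> F'" using \<psi>(2) by (auto simp: dual_ball_cover_def)
        then have "nrm (dual E) (\<phi> - \<theta>) \<le> \<eta>" using \<theta>(1) by (auto simp: F'_def)
        moreover have mem: "\<phi> \<in> vecs (dual E)" "\<psi> \<in> vecs (dual E)" "\<theta> \<in> vecs (dual E)"
          using \<phi> \<psi>(1) C \<theta>(1) F(2) by (auto simp: unit_ball_def)
        ultimately have "nrm (dual E) (\<phi> - \<psi>) \<le> 2 * \<eta>"
          using nrm_diff_triangle[OF mem] \<theta>(2) by linarith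
        then have "nrm (bidual E) z * nrm (dual E) (\<phi> - \<psi>) < e"
          using mult_left_mono[OF _ nz] small by (meson le_less_trans)
        moreover have "z \<phi> - z \<psi> = z (\<phi> - \<psi>)"
          using dual_add[OF z diff_mem_dual[OF mem(1,2)] mem(2)] by simp
        ultimately have "norm (z \<phi> - z \<psi>) < e"
          using D.dual_le_nrm[OF z diff_mem_dual[OF mem(1,2)]] by simp
        then have "canon (dual E) \<psi> z \<in> ball (canon (dual E) \<phi> z) e"
          using z by (simp add: canon_def dist_norm)
        then show ?thesis using e(2) by blast
      qed
      ultimately show "\<exists>A. open A \<and> \<phi> \<in> A \<and> (\<forall>\<psi>\<in>C. \<psi> \<in> A \<longrightarrow> canon (dual E) \<psi> z \<in> B)"
        by (intro exI[of _ "- dual_ball_cover \<eta> F'"]) auto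
    qed
  qed
qed

lemma large_compact_with_continuous_canon:
  assumes "finite_measure N" and sets_N: "sets N = sets (dual_ball_space E)"
    and reg: "compact_inner_regular N" and "\<epsilon> > 0"
  obtains C where "compact C" "C \<subseteq> unit_ball (dual E)" "continuous_on C (canon (dual E))"
    "measure N (unit_ball (dual E) - C) < \<epsilon>"
proof -
  interpret finite_measure N by fact
  have space_N: "space N = unit_ball (dual E)" using sets_eq_imp_space_eq[OF sets_N] by simp
  have "\<exists>F. finite F \<and> F \<subseteq> unit_ball (dual E) \<and>
      measure N (unit_ball (dual E) - dual_ball_cover (inverse (real (Suc n))) F) < \<epsilon> / 2 * (1/2) ^ Suc n" for n
  proof -
    have "0 < inverse (real (Suc n))" "0 < \<epsilon> / 2 * (1/2) ^ Suc n" using \<open>\<epsilon> > 0\<close> by simp_all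
    then show ?thesis using norm_tightness[OF assms(1-3)] by metis
  qed
  then obtain F where F: "\<And>n. finite (F n)" "\<And>n. F n \<subseteq> unit_ball (dual E)"
    "\<And>n. measure N (unit_ball (dual E) - dual_ball_cover (inverse (real (Suc n))) (F n)) < \<epsilon> / 2 * (1/2) ^ Suc n"
    by metis
  let ?c = "\<lambda>n. dual_ball_cover (inverse (real (Suc n))) (F n)"
  define C where "C = unit_ball (dual E) \<inter> (\<Inter>n. ?c n)"
  have closed: "closed (?c n)" for n using F(1,2) by (intro closed_dual_ball_cover) auto
  have "compact C"
    unfolding C_def using closed by (intro compact_Int_closed compact_unit_ball_dual closed_INT) auto
  moreover have "continuous_on C (canon (dual E))"
  proof (rule continuous_on_canon_totally_bounded)
    fix \<eta> :: real assume "\<eta> > 0"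
    then obtain n where "inverse (real (Suc n)) < \<eta>" using reals_Archimedean by blast
    then have "?c n \<subseteq> dual_ball_cover \<eta> (F n)"
      unfolding dual_ball_cover_def using less_imp_le order_trans by blast
    then show "\<exists>F. finite F \<and> F \<subseteq> unit_ball (dual E) \<and> C \<subseteq> dual_ball_cover \<eta> F"
      using F(1,2) by (intro exI[of _ "F n"]) (auto simp: C_def)
  qed (simp add: C_def)
  moreover have "measure N (unit_ball (dual E) - C) < \<epsilon>"
  proof -
    have sets: "unit_ball (dual E) - ?c n \<in> sets N" for n
      using dual_ball_cover_sets[OF F(1,2), of "inverse (real (Suc n))" n] sets.compl_sets[of "?c n" N]
      by (simp add: sets_N space_N)
    have geo: "(\<lambda>n. \<epsilon> / 2 * (1/2) ^ Suc n) sums (\<epsilon> / 2 * 1)"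
      by (intro sums_mult power_half_series)
    have summ: "summable (\<lambda>n. measure N (unit_ball (dual E) - ?c n))"
      by (rule summable_comparison_test'[OF sums_summable[OF geo], where N = 0])
        (use F(3) less_imp_le in auto)
    have "measure N (unit_ball (dual E) - C) = measure N (\<Union>n. unit_ball (dual E) - ?c n)"
      by (intro arg_cong[where f = "measure N"]) (auto simp: C_def)
    also have "\<dots> \<le> (\<Sum>n. measure N (unit_ball (dual E) - ?c n))"
      using sets summ by (intro finite_measure_subadditive_countably) auto
    also have "\<dots> \<le> (\<Sum>n. \<epsilon> / 2 * (1/2) ^ Suc n)"
      using F(3) by (intro suminf_le summ sums_summable[OF geo]) (simp add: less_imp_le)
    also have "\<dots> = \<epsilon> / 2" using sums_unique[OF geo] by simp
    finally show ?thesis using \<open>\<epsilon> > 0\<close> by simp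
  qed
  ultimately show thesis using that by (auto simp: C_def)
qed

text \<open>
  The image of a representing measure under the canonical embedding of the dual in the third
  dual represents the Aron-Berner extension. The embedding need not be weak* continuous, but it is so
  on large compact sets, which is enough for the image to be a regular Borel measure.
\<close>

theorem aron_berner_representation:
  assumes \<mu>: "\<mu> \<in> representing_measures E k P"
  obtains \<nu> where "\<nu> \<in> representing_measures (bidual E) k (aron_berner E k P)"
    "measure (variation_measure (dual_ball_space (bidual E)) \<nu>) third_ball \<le>
      measure (variation_measure (dual_ball_space E) \<mu>) (unit_ball (dual E))"
    "\<And>x. aron_berner E k P (canon E x) = P x"
proof -
  let ?M = "dual_ball_space E" and ?M' = "dual_ball_space (bidual E)" and ?B = "unit_ball (dual E)"
  have reg: "regular_borel_bv ?B \<mu>" using \<mu> by (simp add: representing_measures_iff)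
  interpret bv_measure ?M \<mu> using reg by (simp add: regular_borel_bv_iff)
  have inner: "compact_inner_regular m" using reg by (simp add: regular_borel_bv_iff)
  have "\<exists>C. compact C \<and> C \<subseteq> ?B \<and> continuous_on C (canon (dual E)) \<and>
      measure m (?B - C) < inverse (real (Suc i))" for i
    by (rule large_compact_with_continuous_canon[OF m.finite_measure_axioms sets_variation_measure inner,
        of "inverse (real (Suc i))"]) auto
  then obtain C where C: "\<And>i. compact (C i)" "\<And>i. C i \<subseteq> ?B" "\<And>i. continuous_on (C i) (canon (dual E))"
    "\<And>i. measure m (?B - C i) < inverse (real (Suc i))"
    by metis
  define A where "A = (\<Union>i. C i)"
  have C_sets: "C i \<in> sets ?M" for i using C(1,2) by (rule compact_in_sets)
  have A: "A \<in> sets ?M" using C_sets by (auto simp: A_def)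
  have AB: "A \<subseteq> ?B" using C(2) by (auto simp: A_def)
  have B_sets: "?B \<in> sets ?M" using sets.top[of ?M] by simp
  have small: "measure m (A - C i) < inverse (real (Suc i)) \<and> measure m (?B - A) < inverse (real (Suc i))" for i
  proof -
    have "measure m (A - C i) \<le> measure m (?B - C i)" "measure m (?B - A) \<le> measure m (?B - C i)"
      using AB C_sets A B_sets by (auto intro!: m.finite_measure_mono simp: A_def)
    then show ?thesis using C(4)[of i] by linarith
  qed
  have null: "measure m (?B - A) = 0"
  proof (rule ccontr)
    assume "measure m (?B - A) \<noteq> 0"
    then have "measure m (?B - A) > 0" by (simp add: zero_less_measure_iff)
    then show False using reals_Archimedean small not_less_iff_gr_or_eq by (metis less_trans)
  qed
  have g: "canon (dual E) \<in> measurable (restrict_space ?M A) ?M'"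
  proof (rule measurable_restrict_space2)
    show "canon (dual E) \<in> space (restrict_space ?M A) \<rightarrow> third_ball"
      using canon_unit_ball by (auto simp: space_restrict_space)
    show "canon (dual E) \<in> borel_measurable (restrict_space ?M A)"
    proof (rule measurable_piecewise_restrict[where C = "range C"])
      fix \<Omega> assume "\<Omega> \<in> range C"
      then obtain i where \<Omega>: "\<Omega> = C i" by blast
      have "sets (restrict_space (restrict_space ?M A) \<Omega>) = sets (restrict_space borel \<Omega>)"
        using AB C(2)[of i] by (simp add: sets_restrict_restrict_space \<Omega> A_def Int_absorb1 UN_upper)
      then show "canon (dual E) \<in> borel_measurable (restrict_space (restrict_space ?M A) \<Omega>)"
        using borel_measurable_continuous_on_restrict[OF C(3)[of i]] measurable_cong_sets[OF _ refl] \<Omega> by blast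
      show "\<Omega> \<inter> space (restrict_space ?M A) \<in> sets (restrict_space ?M A)"
      proof -
        have "\<Omega> \<inter> space (restrict_space ?M A) = A \<inter> C i"
          using AB by (auto simp: \<Omega> space_restrict_space)
        then show ?thesis using C_sets[of i] by (simp only: sets_restrict_space[of ?M A] image_eqI)
      qed
    qed (auto simp: A_def space_restrict_space)
  qed
  define \<nu> where "\<nu> = pushforward \<mu> 1 A (canon (dual E))"
  have reg_\<nu>: "regular_borel_bv third_ball \<nu>"
    unfolding \<nu>_def
  proof (rule regular_borel_bv_pushforward[OF reg A g])
    fix e :: real assume "e > 0"
    then obtain i where "inverse (real (Suc i)) < e" using reals_Archimedean by blast
    then show "\<exists>K. compact K \<and> K \<subseteq> A \<and> continuous_on K (canon (dual E)) \<and> measure m (A - K) < e"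
      using C(1,3) small[of i] by (intro exI[of _ "C i"]) (auto simp: A_def)
  qed
  define Q where "Q z = scalar_integral ?M' \<nu> (\<lambda>\<Phi>. \<Phi> z ^ k)" for z
  have \<nu>: "\<nu> \<in> representing_measures (bidual E) k Q"
    using reg_\<nu> by (simp add: DD.representing_measures_iff Q_def)
  interpret \<nu>: bv_measure ?M' \<nu> using reg_\<nu> by (simp add: regular_borel_bv_iff)
  have m_\<nu>: "measure \<nu>.m S \<le> measure m (A \<inter> canon (dual E) -` S)" if "S \<in> sets ?M'" for S
    using measure_pushforward_le[OF A g that, of 1] by (simp add: \<nu>_def)
  have mass: "measure \<nu>.m third_ball \<le> measure m ?B"
  proof -
    have "measure \<nu>.m third_ball \<le> measure m (A \<inter> canon (dual E) -` third_ball)"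
      using sets.top[of ?M'] by (intro m_\<nu>) simp
    also have "\<dots> \<le> measure m ?B" using AB B_sets by (intro m.finite_measure_mono) auto
    finally show ?thesis .
  qed
  have extends: "Q (canon E x) = P x" for x
  proof -
    have x: "x \<in> vecs E" by (simp add: vecs_UNIV)
    have bm: "bounded_measurable ?M (\<lambda>\<phi>. \<phi> x ^ k)" by (rule bounded_measurable_power[OF x])
    have bm': "bounded_measurable ?M' (\<lambda>\<Phi>. \<Phi> (canon E x) ^ k)"
      by (rule DD.bounded_measurable_power[OF canon_mem_bidual[OF x]])
    let ?h = "\<lambda>\<phi>. if \<phi> \<in> A then 1 * canon (dual E) \<phi> (canon E x) ^ k else 0"
    note push = scalar_integral_pushforward[OF A g bm', of 1]
    have Q: "Q (canon E x) = scalar_integral ?M \<mu> ?h" using push(2) by (simp add: Q_def \<nu>_def)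
    have bmd: "bounded_measurable ?M (\<lambda>\<phi>. \<phi> x ^ k + (-1) * ?h \<phi>)"
      by (rule bounded_measurable_add[OF bm bounded_measurable_cmult[OF push(1)]])
    have "norm (scalar_integral ?M \<mu> (\<lambda>\<phi>. \<phi> x ^ k + (-1) * ?h \<phi>)) \<le>
        (\<integral>\<phi>. norm (\<phi> x ^ k + (-1) * ?h \<phi>) \<partial>m)"
      by (rule norm_scalar_integral_le[OF bmd])
    also have "\<dots> = (\<integral>\<phi>. 0 \<partial>m)"
    proof (rule integral_cong_AE)
      have "?B - A \<in> null_sets m" using null A B_sets by (auto simp: null_sets_def m.emeasure_eq_measure)
      then have "AE \<phi> in m. \<phi> \<notin> ?B - A" by (rule AE_not_in)
      then show "AE \<phi> in m. norm (\<phi> x ^ k + (-1) * ?h \<phi>) = 0"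
      proof (rule AE_mp, intro AE_I2 impI)
        fix \<phi> assume "\<phi> \<in> space m" "\<phi> \<notin> ?B - A"
        then have "\<phi> \<in> A" by simp
        then have "\<phi> \<in> vecs (dual E)" using AB by (auto simp: unit_ball_def)
        then have "?h \<phi> = \<phi> x ^ k"
          using \<open>\<phi> \<in> A\<close> canon_mem_bidual[OF x] by (simp add: canon_def)
        then show "norm (\<phi> x ^ k + (-1) * ?h \<phi>) = 0" by simp
      qed
    qed (use borel_measurable_integrable[OF integrable_norm_bounded[OF bmd]] in auto)
    finally have "scalar_integral ?M \<mu> (\<lambda>\<phi>. \<phi> x ^ k + (-1) * ?h \<phi>) = 0" by simp
    then have "scalar_integral ?M \<mu> (\<lambda>\<phi>. \<phi> x ^ k) = Q (canon E x)"
      unfolding Q scalar_integral_add[OF bm bounded_measurable_cmult[OF push(1)]] scalar_integral_cmult[OF push(1)]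
      by simp
    then show ?thesis using \<mu> x by (simp add: representing_measures_iff)
  qed
  have eq: "aron_berner E k P z = Q z" if z: "z \<in> vecs (bidual E)" for z
  proof -
    have "norm (aron_berner E k P z - Q z) \<le>
        t * (2 * (real k * measure \<nu>.m third_ball + 2) * nrm (bidual E) z ^ k)" if "t > 0" for t
    proof -
      obtain F where F: "finite F" "F \<subseteq> ?B" "measure m (?B - dual_ball_cover t F) < t"
        by (rule norm_tightness[OF m.finite_measure_axioms sets_variation_measure inner \<open>t > 0\<close> \<open>t > 0\<close>])
      have far_sets: "far_from_canonical t F \<in> sets ?M'"
        using F \<open>t > 0\<close> by (intro far_from_canonical_sets) auto
      have cover_sets: "dual_ball_cover t F \<in> sets ?M" using F \<open>t > 0\<close> by (intro dual_ball_cover_sets) auto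
      have "A \<inter> canon (dual E) -` far_from_canonical t F \<subseteq> ?B - dual_ball_cover t F"
      proof
        fix \<phi> assume "\<phi> \<in> A \<inter> canon (dual E) -` far_from_canonical t F"
        then have \<phi>: "\<phi> \<in> ?B" "\<And>\<psi>. \<psi> \<in> F \<Longrightarrow> t < nrm (dual (bidual E)) (canon (dual E) \<phi> - canon (dual E) \<psi>)"
          using AB by (auto simp: far_from_canonical_def)
        have "t < nrm (dual E) (\<phi> - \<psi>)" if "\<psi> \<in> F" for \<psi>
          using \<phi>(2)[OF that] nrm_canon_diff_le[OF \<phi>(1), of \<psi>] F(2) that by (meson less_le_trans subsetD)
        then show "\<phi> \<in> ?B - dual_ball_cover t F" using \<phi>(1) by (fastforce simp: dual_ball_cover_def)
      qed
      then have "measure m (A \<inter> canon (dual E) -` far_from_canonical t F) \<le> measure m (?B - dual_ball_cover t F)"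
        using B_sets cover_sets by (intro m.finite_measure_mono) auto
      then have "measure \<nu>.m (far_from_canonical t F) \<le> t" using m_\<nu>[OF far_sets] F(3) by linarith
      from aron_berner_near_representation[OF \<nu> extends F(1,2) less_imp_le[OF \<open>t > 0\<close>] this z]
      show ?thesis by (simp add: algebra_simps)
    qed
    then have "aron_berner E k P z - Q z = 0" by (rule zero_if_norm_le_small_multiples) simp
    then show ?thesis by simp
  qed
  have "\<nu> \<in> representing_measures (bidual E) k (aron_berner E k P)"
    using \<nu> eq by (simp add: DD.representing_measures_iff)
  moreover have "aron_berner E k P (canon E x) = P x" for x
    using eq[OF canon_mem_bidual] extends by (simp add: vecs_UNIV)
  ultimately show thesis using that mass by blast
qed

text \<open>
  The functionals whose restriction to \<open>E\<close> has norm at most \<open>1 - \<delta>\<close> contribute little to the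
  norm of the restricted polynomial: their restrictions can be stretched to the unit ball if the
  measure is multiplied by \<open>(1 - \<delta>) ^ k\<close>, without changing the polynomial.
\<close>

lemma integral_norm_restriction_le:
  assumes \<mu>: "\<mu> \<in> representing_measures (bidual E) k Q" and ext: "\<And>x. Q (canon E x) = P x"
    and \<delta>: "0 \<le> \<delta>" "\<delta> < 1"
  defines "S \<equiv> {\<Phi> \<in> third_ball. nrm (dual E) (restriction E \<Phi>) \<le> 1 - \<delta>}"
  shows "S \<in> sets (dual_ball_space (bidual E))"
    and "integral_norm E k P \<le>
      measure (variation_measure (dual_ball_space (bidual E)) \<mu>) (third_ball - S) +
      (1 - \<delta>) ^ k * measure (variation_measure (dual_ball_space (bidual E)) \<mu>) S"
proof -
  let ?M = "dual_ball_space (bidual E)" and ?M' = "dual_ball_space E" and ?B = "unit_ball (dual E)"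
  have reg: "regular_borel_bv third_ball \<mu>" using \<mu> by (simp add: DD.representing_measures_iff)
  interpret bv_measure ?M \<mu> using reg by (simp add: regular_borel_bv_iff)
  have "nrm (dual E) (restriction E \<Phi>) \<le> 1 - \<delta> \<longleftrightarrow> (\<forall>x. norm (\<Phi> (canon E x)) \<le> (1 - \<delta>) * nrm E x)"
    if "\<Phi> \<in> third_ball" for \<Phi>
  proof
    assume le: "nrm (dual E) (restriction E \<Phi>) \<le> 1 - \<delta>"
    have "restriction E \<Phi> \<in> vecs (dual E)" using that by (auto simp: unit_ball_def restriction_mem)
    from dual_le_of_nrm[OF this le] show "\<forall>x. norm (\<Phi> (canon E x)) \<le> (1 - \<delta>) * nrm E x"
      by (simp add: restriction_def vecs_UNIV)
  qed (use \<delta> in \<open>auto intro!: dual_nrm_leI simp: restriction_def\<close>)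
  then have "S = third_ball \<inter> (\<Inter>x. {\<Phi>. norm (\<Phi> (canon E x)) \<le> (1 - \<delta>) * nrm E x})"
    by (auto simp: S_def)
  moreover have "closed (\<Inter>x. {\<Phi> :: (('v \<Rightarrow> 'k) \<Rightarrow> 'k) \<Rightarrow> 'k. norm (\<Phi> (canon E x)) \<le> (1 - \<delta>) * nrm E x})"
    by (intro closed_INT ballI closed_Collect_le continuous_intros continuous_on_product_coordinates)
  ultimately show S: "S \<in> sets ?M" by (simp add: sets_restrict_space)
  define T where "T = third_ball - S"
  have T: "T \<in> sets ?M" using sets.compl_sets[OF S] by (simp add: T_def)
  define b :: 'k where "b = of_real (1 / (1 - \<delta>))"
  have cont: "continuous_on W (restriction E)" for W
    unfolding restriction_def
    by (intro continuous_on_coordinatewise_then_product continuous_on_subset[OF continuous_on_product_coordinates]) auto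
  have cont_b: "continuous_on W (\<lambda>\<Phi> x. b * restriction E \<Phi> x)" for W
    unfolding restriction_def
    by (intro continuous_on_coordinatewise_then_product continuous_intros
        continuous_on_subset[OF continuous_on_product_coordinates]) auto
  have ran: "restriction E ` T \<subseteq> ?B"
    using restriction_mem by (fastforce simp: T_def unit_ball_def)
  have ran_b: "(\<lambda>\<Phi> x. b * restriction E \<Phi> x) ` S \<subseteq> ?B"
  proof
    fix \<phi> assume "\<phi> \<in> (\<lambda>\<Phi> x. b * restriction E \<Phi> x) ` S"
    then obtain \<Phi> where \<Phi>: "\<Phi> \<in> S" "\<phi> = (\<lambda>x. b * restriction E \<Phi> x)" by blast
    then have mem: "restriction E \<Phi> \<in> vecs (dual E)" "nrm (dual E) (restriction E \<Phi>) \<le> 1 - \<delta>"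
      by (auto simp: S_def unit_ball_def restriction_mem)
    have "norm b = 1 / (1 - \<delta>)" unfolding b_def norm_of_real using \<delta>(2) by simp
    then have "nrm (dual E) \<phi> \<le> 1"
      using nrm_smul_dual[OF mem(1), of b] mem(2) \<delta>(2) by (simp add: \<Phi>(2) pos_divide_le_eq)
    then show "\<phi> \<in> ?B" using smul_mem_dual[OF mem(1)] by (simp add: unit_ball_def \<Phi>(2))
  qed
  define a :: 'k where "a = of_real ((1 - \<delta>) ^ k)"
  have ab: "a * (b * y) ^ k = y ^ k" for y
  proof -
    have "(1 - \<delta>) ^ k * (1 / (1 - \<delta>)) ^ k = 1" using \<delta>(2) by (simp flip: power_mult_distrib)
    then have "a * b ^ k = 1" unfolding a_def b_def by (metis of_real_1 of_real_mult of_real_power)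
    then show ?thesis by (simp add: power_mult_distrib flip: mult.assoc)
  qed
  define \<nu>1 where "\<nu>1 = pushforward \<mu> 1 T (restriction E)"
  define \<nu>2 where "\<nu>2 = pushforward \<mu> a S (\<lambda>\<Phi> x. b * restriction E \<Phi> x)"
  note g1 = regular_borel_bv_pushforward_continuous[OF reg T cont ran]
  note g2 = regular_borel_bv_pushforward_continuous[OF reg S cont_b ran_b]
  have reg12: "regular_borel_bv ?B \<nu>1" "regular_borel_bv ?B \<nu>2" unfolding \<nu>1_def \<nu>2_def by (rule g1(2), rule g2(2))
  then have bv12: "bv_measure ?M' \<nu>1" "bv_measure ?M' \<nu>2" by (simp_all add: regular_borel_bv_iff)
  define \<nu> where "\<nu> W = \<nu>1 W + \<nu>2 W" for W
  have "\<nu> \<in> representing_measures E k P"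
    unfolding representing_measures_iff
  proof (intro conjI ballI)
    show "regular_borel_bv ?B \<nu>" unfolding \<nu>_def by (rule regular_borel_bv_add[OF reg12])
    fix x assume x: "x \<in> vecs E"
    have bm: "bounded_measurable ?M' (\<lambda>\<phi>. \<phi> x ^ k)" by (rule bounded_measurable_power[OF x])
    note i1 = scalar_integral_pushforward[OF T g1(1) bm, of 1]
    note i2 = scalar_integral_pushforward[OF S g2(1) bm, of a]
    have "scalar_integral ?M' \<nu> (\<lambda>\<phi>. \<phi> x ^ k) =
        scalar_integral ?M' \<nu>1 (\<lambda>\<phi>. \<phi> x ^ k) + scalar_integral ?M' \<nu>2 (\<lambda>\<phi>. \<phi> x ^ k)"
      unfolding \<nu>_def by (rule scalar_integral_measure_add[OF bv12 bm])
    also have "\<dots> = scalar_integral ?M \<mu> (\<lambda>\<Phi>. (if \<Phi> \<in> T then 1 * restriction E \<Phi> x ^ k else 0) +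
        (if \<Phi> \<in> S then a * (b * restriction E \<Phi> x) ^ k else 0))"
      unfolding scalar_integral_add[OF i1(1) i2(1)] \<nu>1_def \<nu>2_def i1(2) i2(2) ..
    also have "\<dots> = scalar_integral ?M \<mu> (\<lambda>\<Phi>. \<Phi> (canon E x) ^ k)"
      by (intro scalar_integral_cong) (auto simp: T_def ab restriction_def)
    also have "\<dots> = P x"
      using \<mu> canon_mem_bidual[OF x] unfolding DD.representing_measures_iff by (simp add: ext)
    finally show "scalar_integral ?M' \<nu> (\<lambda>\<phi>. \<phi> x ^ k) = P x" .
  qed
  then have "integral_norm E k P \<le> measure (variation_measure ?M' \<nu>) ?B" by (rule integral_norm_le)
  also have "\<dots> \<le> measure (variation_measure ?M' \<nu>1) ?B + measure (variation_measure ?M' \<nu>2) ?B"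
    unfolding \<nu>_def using sets.top[of ?M'] by (intro measure_add_le bv12) simp
  also have "\<dots> \<le> measure m T + (1 - \<delta>) ^ k * measure m S"
  proof (rule add_mono)
    have B: "?B \<in> sets ?M'" using sets.top[of ?M'] by simp
    have "measure (variation_measure ?M' \<nu>1) ?B \<le> norm (1::'k) * measure m (T \<inter> restriction E -` ?B)"
      unfolding \<nu>1_def by (rule measure_pushforward_le[OF T g1(1) B])
    also have "\<dots> \<le> measure m T" using T by (auto intro!: m.finite_measure_mono)
    finally show "measure (variation_measure ?M' \<nu>1) ?B \<le> measure m T" .
    have "measure (variation_measure ?M' \<nu>2) ?B \<le>
        norm a * measure m (S \<inter> (\<lambda>\<Phi> x. b * restriction E \<Phi> x) -` ?B)"
      unfolding \<nu>2_def by (rule measure_pushforward_le[OF S g2(1) B])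
    also have "\<dots> \<le> norm a * measure m S" using S by (auto intro!: m.finite_measure_mono mult_left_mono)
    also have "norm a = (1 - \<delta>) ^ k" unfolding a_def norm_of_real using \<delta>(2) by simp
    finally show "measure (variation_measure ?M' \<nu>2) ?B \<le> (1 - \<delta>) ^ k * measure m S" .
  qed
  finally show "integral_norm E k P \<le> measure m (third_ball - S) + (1 - \<delta>) ^ k * measure m S"
    by (simp add: T_def)
qed

text \<open>
  For \<open>\<delta> = 0\<close> the stretched part is the whole ball, and the previous bound becomes the norm of
  the given measure.
\<close>

lemma integral_norm_extension_ge:
  assumes Q: "Q \<in> integral_polynomials (bidual E) k" and ext: "\<And>x. Q (canon E x) = P x"
  shows "integral_norm E k P \<le> integral_norm (bidual E) k Q"
proof (rule field_le_epsilon)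
  fix e :: real assume "e > 0"
  obtain \<mu> where \<mu>: "\<mu> \<in> representing_measures (bidual E) k Q"
    "measure (variation_measure (dual_ball_space (bidual E)) \<mu>) third_ball < integral_norm (bidual E) k Q + e"
    by (rule DD.integral_norm_approx[OF Q \<open>e > 0\<close>])
  have "{\<Phi> \<in> third_ball. nrm (dual E) (restriction E \<Phi>) \<le> 1 - 0} = third_ball"
    using restriction_mem(2) by (fastforce simp: unit_ball_def)
  then show "integral_norm E k P \<le> integral_norm (bidual E) k Q + e"
    using integral_norm_restriction_le(2)[OF \<mu>(1) ext, of 0] \<mu>(2) by simp
qed

theorem aron_berner_norm_preserving:
  assumes P: "P \<in> integral_polynomials E k"
  shows "norm_preserving_extension E k P (aron_berner E k P)"
proof -
  have rep: "representing_measures (bidual E) k (aron_berner E k P) \<noteq> {} \<and>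
      (\<forall>x. aron_berner E k P (canon E x) = P x)"
    using P aron_berner_representation unfolding integral_polynomials_iff by (metis empty_iff ex_in_conv)
  then have mem: "aron_berner E k P \<in> integral_polynomials (bidual E) k"
    by (simp add: DD.integral_polynomials_iff aron_berner_def)
  have "integral_norm (bidual E) k (aron_berner E k P) \<le> integral_norm E k P"
  proof (rule field_le_epsilon)
    fix e :: real assume "e > 0"
    obtain \<mu> where \<mu>: "\<mu> \<in> representing_measures E k P"
      "measure (variation_measure (dual_ball_space E) \<mu>) (unit_ball (dual E)) < integral_norm E k P + e"
      by (rule integral_norm_approx[OF P \<open>e > 0\<close>])
    obtain \<nu> where "\<nu> \<in> representing_measures (bidual E) k (aron_berner E k P)"
      "measure (variation_measure (dual_ball_space (bidual E)) \<nu>) third_ball \<le>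
        measure (variation_measure (dual_ball_space E) \<mu>) (unit_ball (dual E))"
      by (rule aron_berner_representation[OF \<mu>(1)])
    then show "integral_norm (bidual E) k (aron_berner E k P) \<le> integral_norm E k P + e"
      using DD.integral_norm_le[of \<nu> k "aron_berner E k P"] \<mu>(2) by linarith
  qed
  then show ?thesis
    using mem rep integral_norm_extension_ge[OF mem, of P] by (auto simp: norm_preserving_extension_def)
qed

text \<open>
  A nearly norm attaining measure of a norm preserving extension gives small mass to the
  functionals whose restriction to \<open>E\<close> is not of norm nearly one. All others are, by the M-ideal
  property, close to their canonical part, whose distribution is norm tight.
\<close>

theorem norm_preserving_extension_unique:
  assumes "k > 0" and Q: "norm_preserving_extension E k P Q"
  shows "Q = aron_berner E k P"
proof
  fix z
  let ?M = "dual_ball_space (bidual E)" and ?B = "unit_ball (dual E)"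
  have Q_int: "Q \<in> integral_polynomials (bidual E) k" and ext: "\<And>x. Q (canon E x) = P x"
    and norm_eq: "integral_norm (bidual E) k Q = integral_norm E k P"
    using Q by (auto simp: norm_preserving_extension_def vecs_UNIV)
  show "Q z = aron_berner E k P z"
  proof (cases "z \<in> vecs (bidual E)")
    case False
    then show ?thesis using Q_int by (simp add: DD.integral_polynomials_iff aron_berner_def)
  next
    case z: True
    \<comment> \<open>The factors 2 come from the distance \<open>2 * t\<close> to the canonical functionals and from the two
      exceptional sets of mass at most \<open>t\<close> below.\<close>
    have "norm (aron_berner E k P z - Q z) \<le>
        t * (2 * (2 * real k * (integral_norm E k P + 1) + 4) * nrm (bidual E) z ^ k)"
      if t: "0 < t" "t < 1" for t
    proof -
      define \<gamma> where "\<gamma> = 1 - (1 - t) ^ k"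
      have "(1 - t) ^ k < 1" "0 \<le> (1 - t) ^ k" using t \<open>k > 0\<close> by (auto simp: power_less_one_iff)
      then have \<gamma>: "\<gamma> > 0" "\<gamma> \<le> 1" by (auto simp: \<gamma>_def)
      obtain \<mu> where \<mu>: "\<mu> \<in> representing_measures (bidual E) k Q"
        "measure (variation_measure ?M \<mu>) third_ball < integral_norm (bidual E) k Q + t * \<gamma>"
        using DD.integral_norm_approx[OF Q_int, of "t * \<gamma>"] t(1) \<gamma>(1) by auto
      have reg: "regular_borel_bv third_ball \<mu>" using \<mu>(1) by (simp add: DD.representing_measures_iff)
      interpret bv_measure ?M \<mu> using reg by (simp add: regular_borel_bv_iff)
      have inner: "\<exists>K. compact K \<and> K \<subseteq> A \<and> measure m (A - K) < e" if "A \<in> sets ?M" "e > 0" for A e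
        using reg that by (simp add: regular_borel_bv_iff compact_inner_regular_def)
      define S where "S = {\<Phi> \<in> third_ball. nrm (dual E) (restriction E \<Phi>) \<le> 1 - t}"
      note shell = integral_norm_restriction_le[OF \<mu>(1) ext less_imp_le[OF t(1)] t(2), folded S_def]
      have S: "S \<in> sets ?M" by (rule shell(1))
      have third: "third_ball \<in> sets ?M" using sets.top[of ?M] by simp
      have "measure m (third_ball - S) = measure m third_ball - measure m S"
        using S third sets.sets_into_space[OF S] by (intro m.finite_measure_Diff) auto
      then have "\<gamma> * measure m S < t * \<gamma>"
        using shell(2) \<mu>(2) norm_eq by (simp add: \<gamma>_def algebra_simps)
      then have small_S: "measure m S < t" using \<gamma>(1) by (simp add: mult.commute)
      have cont: "continuous_on third_ball (restriction E)"
        unfolding restriction_def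
        by (intro continuous_on_coordinatewise_then_product continuous_on_subset[OF continuous_on_product_coordinates]) auto
      have ran: "restriction E ` third_ball \<subseteq> ?B"
        using restriction_mem by (fastforce simp: unit_ball_def)
      have meas: "restriction E \<in> measurable m (dual_ball_space E)"
        using borel_measurable_continuous_on_restrict[OF cont] ran
        by (auto simp: measurable_cong_sets[OF sets_variation_measure refl] intro!: measurable_restrict_space2)
      define N where "N = distr m (dual_ball_space E) (restriction E)"
      have fin_N: "finite_measure N" unfolding N_def by (rule m.finite_measure_distr[OF meas])
      have sets_N: "sets N = sets (dual_ball_space E)" by (simp add: N_def)
      have measure_N: "measure N A = measure m (restriction E -` A \<inter> third_ball)" if "A \<in> sets N" for A
        using measure_distr[OF meas, of A] that by (simp add: N_def)
      have reg_N: "compact_inner_regular N"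
        unfolding compact_inner_regular_def
      proof (intro ballI allI impI)
        fix A and e :: real assume A: "A \<in> sets N" and "e > 0"
        have pre: "restriction E -` A \<inter> third_ball \<in> sets ?M"
          using measurable_sets[OF meas, of A] A by (simp add: N_def)
        obtain K where K: "compact K" "K \<subseteq> restriction E -` A \<inter> third_ball"
          "measure m (restriction E -` A \<inter> third_ball - K) < e" using inner[OF pre \<open>e > 0\<close>] by blast
        have comp: "compact (restriction E ` K)"
          using K by (intro compact_continuous_image continuous_on_subset[OF cont]) auto
        have im: "restriction E ` K \<in> sets N"
          unfolding sets_N using K(2) ran by (intro compact_in_sets[OF comp]) auto
        have "K \<in> sets ?M" using K by (intro compact_in_sets) auto
        then have "measure N (A - restriction E ` K) \<le> measure m (restriction E -` A \<inter> third_ball - K)"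
          using A im pre unfolding measure_N[OF sets.Diff[OF A im]]
          by (intro m.finite_measure_mono) auto
        then show "\<exists>K. compact K \<and> K \<subseteq> A \<and> measure N (A - K) < e"
          using comp K by (intro exI[of _ "restriction E ` K"]) auto
      qed
      obtain F where F: "finite F" "F \<subseteq> ?B" "measure N (?B - dual_ball_cover t F) < t"
        by (rule norm_tightness[OF fin_N sets_N reg_N t(1) t(1)])
      define R where "R = restriction E -` (?B - dual_ball_cover t F) \<inter> third_ball"
      have cover: "?B - dual_ball_cover t F \<in> sets N"
        using dual_ball_cover_sets[OF F(1,2), of t] t(1) sets.top[of "dual_ball_space E"] by (auto simp: sets_N)
      have R: "R \<in> sets ?M" "measure m R < t"
        using measurable_sets[OF meas, of "?B - dual_ball_cover t F"] cover measure_N[OF cover] F(3)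
        by (simp_all add: R_def N_def)
      have "far_from_canonical (2 * t) F \<subseteq> S \<union> R"
      proof
        fix \<Phi> assume far: "\<Phi> \<in> far_from_canonical (2 * t) F"
        then have \<Phi>: "\<Phi> \<in> third_ball" by (simp add: far_from_canonical_def)
        then have \<Phi>': "\<Phi> \<in> vecs (dual (bidual E))" "nrm (dual (bidual E)) \<Phi> \<le> 1"
          by (auto simp: unit_ball_def)
        let ?\<phi> = "restriction E \<Phi>"
        have \<phi>: "?\<phi> \<in> ?B" using \<Phi> ran by auto
        show "\<Phi> \<in> S \<union> R"
        proof (rule ccontr)
          assume not: "\<Phi> \<notin> S \<union> R"
          then have "1 - t < nrm (dual E) ?\<phi>" using \<Phi> by (auto simp: S_def)
          then have close: "nrm (dual (bidual E)) (\<Phi> - canon (dual E) ?\<phi>) < t"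
            using norm_restriction_add[OF \<Phi>'(1)] \<Phi>'(2) by linarith
          have "?\<phi> \<in> dual_ball_cover t F" using not \<Phi> \<phi> by (auto simp: R_def)
          then obtain \<psi> where \<psi>: "\<psi> \<in> F" "nrm (dual E) (?\<phi> - \<psi>) \<le> t"
            unfolding dual_ball_cover_def by blast
          have \<psi>B: "\<psi> \<in> ?B" using \<psi>(1) F(2) by blast
          have mem: "canon (dual E) ?\<phi> \<in> vecs (dual (bidual E))" "canon (dual E) \<psi> \<in> vecs (dual (bidual E))"
            using canon_unit_ball[OF \<phi>] canon_unit_ball[OF \<psi>B] by (auto simp: unit_ball_def)
          have "\<Phi> - canon (dual E) \<psi> =
              (\<Phi> - canon (dual E) ?\<phi>) + (canon (dual E) ?\<phi> - canon (dual E) \<psi>)" by simp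
          then have "nrm (dual (bidual E)) (\<Phi> - canon (dual E) \<psi>) \<le>
              nrm (dual (bidual E)) (\<Phi> - canon (dual E) ?\<phi>) +
              nrm (dual (bidual E)) (canon (dual E) ?\<phi> - canon (dual E) \<psi>)"
            using DD.nrm_add_dual[OF DD.diff_mem_dual[OF \<Phi>'(1) mem(1)] DD.diff_mem_dual[OF mem]]
            by (simp only:)
          also have "\<dots> \<le> t + t"
            using close nrm_canon_diff_le[OF \<phi> \<psi>B] \<psi>(2) by linarith
          finally show False using far \<psi>(1) by (fastforce simp: far_from_canonical_def)
        qed
      qed
      then have "measure m (far_from_canonical (2 * t) F) \<le> measure m (S \<union> R)"
        using S R(1) by (intro m.finite_measure_mono) auto
      also have "\<dots> \<le> measure m S + measure m R" using S R(1) by (intro measure_Un_le) auto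
      also have "\<dots> \<le> 2 * t" using small_S R(2) by simp
      finally have far: "measure m (far_from_canonical (2 * t) F) \<le> 2 * t" .
      have "norm (aron_berner E k P z - Q z) \<le>
          2 * (real k * (2 * t) * measure m third_ball + 2 * (2 * t)) * nrm (bidual E) z ^ k"
        by (rule aron_berner_near_representation[OF \<mu>(1) ext F(1,2) _ far z]) (use t in simp)
      also have "\<dots> \<le> 2 * (real k * (2 * t) * (integral_norm E k P + 1) + 2 * (2 * t)) * nrm (bidual E) z ^ k"
      proof -
        have "t * \<gamma> \<le> 1" using t \<gamma> by (intro mult_le_one) auto
        then have "measure m third_ball \<le> integral_norm E k P + 1" using \<mu>(2) norm_eq by simp
        then show ?thesis
          using t D.dual_nrm_nonneg[OF z]
          by (intro mult_right_mono mult_left_mono add_right_mono zero_le_power) auto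
      qed
      finally show ?thesis by (simp add: algebra_simps)
    qed
    then have "aron_berner E k P z - Q z = 0" by (rule zero_if_norm_le_small_multiples)
    then show ?thesis by simp
  qed
qed

end

theorem corollary2p11:
  fixes sm :: "'k::real_or_complex \<Rightarrow> 'a::banach \<Rightarrow> 'a"
    and X :: "('k, 'a) nspace"
    and P :: "'a \<Rightarrow> 'k"
    and k :: nat
  assumes "vector_space sm"
    and "\<And>c x. norm (sm c x) = norm c * norm x"
    and "X = type_space sm"
    and "M_ideal (bidual X) (canon X ` vecs X)"
    and "k > 0"
    and "P \<in> integral_polynomials X k"
  shows "norm_preserving_extension X k P (aron_berner X k P) \<and>
         (\<forall>Q. norm_preserving_extension X k P Q \<longrightarrow> Q = aron_berner X k P)"
proof -
  interpret normed_space X unfolding assms(3) by (rule normed_space_type_space[OF assms(2)])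
  interpret M_embedded X
    by standard (use assms(3,4) in \<open>simp_all add: type_space_def\<close>)
  show ?thesis
    using aron_berner_norm_preserving[OF assms(6)] norm_preserving_extension_unique[OF assms(5)] by blast
qed

end
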